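(* Let $\mu$ be a probability measure on $\mathbb R^n$ with finite second moment and finite Fisher information $I(\mu\mid\gamma)<\infty$. Then there exist random vectors $Y,W$ on a common probability space, with finite second moments, such that $Y+W$ has law $\mu$, $\mathbb E[\langle Y,W\rangle]=0$, and, writing $\nu$ for the law of $Y$, \[ \delta(\mu)\ge\frac12\mathrm W_2^2(\nu,\gamma). \]
   Context: $\gamma$ is the standard Gaussian measure on $\mathbb R^n$. For $\mu$ with density $f=d\mu/d\gamma$, $\delta(\mu)=\frac12\int|\nabla\log f|^2d\mu-\int\log f\,d\mu$ is the log-Sobolev deficit. $\mathrm W_2(\mu,\nu)=\inf\mathbb E[|X-Y|^2]^{1/2}$ over couplings $(X,Y)$ of $(\mu,\nu)$. *)

theory Defs
  imports "HOL-Probability.Probability"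
begin

definition gauss_density :: "'a::euclidean_space \<Rightarrow> real" where
  "gauss_density x = (2 * pi) powr (- real DIM('a) / 2) * exp (- (norm x)\<^sup>2 / 2)"

definition gaussian :: "'a::euclidean_space measure" where
  "gaussian = density lborel (\<lambda>x. ennreal (gauss_density x))"

definition test_function :: "('a::euclidean_space \<Rightarrow> real) \<Rightarrow> bool" where
  "test_function \<phi> \<longleftrightarrow>
     (\<forall>x. \<phi> differentiable (at x)) \<and>
     (\<forall>v. continuous_on UNIV (\<lambda>x. frechet_derivative \<phi> (at x) v)) \<and>
     compact (closure {x. \<phi> x \<noteq> 0})"

definition locally_integrable :: "('a::euclidean_space \<Rightarrow> 'b::{banach,second_countable_topology}) \<Rightarrow> bool" where
  "locally_integrable g \<longleftrightarrow> (\<forall>K. compact K \<longrightarrow> set_integrable lborel K g)"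

definition weak_gradient :: "('a::euclidean_space \<Rightarrow> real) \<Rightarrow> ('a \<Rightarrow> 'a) \<Rightarrow> bool" where
  "weak_gradient f G \<longleftrightarrow>
     locally_integrable f \<and> locally_integrable G \<and>
     (\<forall>\<phi> v. test_function \<phi> \<longrightarrow>
        (\<integral>x. f x * frechet_derivative \<phi> (at x) v \<partial>lborel)
          = - (\<integral>x. (G x \<bullet> v) * \<phi> x \<partial>lborel))"

text \<open>Fisher information of \<mu> = f\<gamma> relative to \<gamma>, with \<nabla> log f = G / f.\<close>
definition fisher_info :: "'a::euclidean_space measure \<Rightarrow> ('a \<Rightarrow> real) \<Rightarrow> ('a \<Rightarrow> 'a) \<Rightarrow> ennreal" where
  "fisher_info \<mu> f G = (\<integral>\<^sup>+ x. ennreal ((norm (G x /\<^sub>R f x))\<^sup>2) \<partial>\<mu>)"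

definition lsi_deficit :: "'a::euclidean_space measure \<Rightarrow> ('a \<Rightarrow> real) \<Rightarrow> ('a \<Rightarrow> 'a) \<Rightarrow> real" where
  "lsi_deficit \<mu> f G = (1/2) * (\<integral>x. (norm (G x /\<^sub>R f x))\<^sup>2 \<partial>\<mu>) - (\<integral>x. ln (f x) \<partial>\<mu>)"

definition couplings :: "'a::euclidean_space measure \<Rightarrow> 'a measure \<Rightarrow> ('a \<times> 'a) measure set" where
  "couplings \<mu> \<nu> = {\<pi>. prob_space \<pi> \<and> sets \<pi> = sets (borel :: ('a \<times> 'a) measure) \<and>
                        distr \<pi> borel fst = \<mu> \<and> distr \<pi> borel snd = \<nu>}"

definition W2sq :: "'a::euclidean_space measure \<Rightarrow> 'a measure \<Rightarrow> ennreal" where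
  "W2sq \<mu> \<nu> = (INF \<pi> \<in> couplings \<mu> \<nu>. \<integral>\<^sup>+ z. ennreal ((dist (fst z) (snd z))\<^sup>2) \<partial>\<pi>)"

end

theory Submission
  imports Defs
begin

text \<open>
  Write \<open>v = \<nabla> log f\<close>, \<open>m = E |X|\<^sup>2\<close> with \<open>X\<close> of law \<open>\<mu>\<close>, and \<open>n\<close> for the dimension. Let \<open>Z = T X\<close>, where \<open>T\<close> is
  the Knothe (triangular, increasing) map from \<open>\<mu>\<close> to \<open>\<gamma>\<close>. The change of variables formula and \<open>log t \<le> t - 1\<close> give
  \<open>log f \<le> |x|\<^sup>2 / 2 - |T x|\<^sup>2 / 2 + \<Sum>k. (\<partial>\<^sub>k T\<^sub>k - 1)\<close>. Integrating against \<open>\<mu>\<close>, by parts in each coordinate,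
  yields \<open>E |X - v(X) - Z|\<^sup>2 \<le> 2 \<delta>(\<mu>)\<close>. Since \<open>E \<langle>X, v(X)\<rangle> = m - n\<close>, the correlation \<open>c = E \<langle>X, Z\<rangle>\<close> satisfies
  \<open>n - c = E \<langle>X, X - v(X) - Z\<rangle> \<le> \<surd>(2 \<delta> m)\<close>. If \<open>c \<le> n\<close>, let \<open>Y\<close> be the projection of \<open>Z\<close> to the \<open>L\<^sup>2\<close> sphere
  with diameter \<open>[0, X]\<close>; then \<open>E |Y - Z|\<^sup>2 \<le> 2 \<delta>\<close>. If \<open>c > n\<close>, changing the sign
  of \<open>Z\<close> at random gives a Gaussian \<open>Y\<close> with \<open>E \<langle>X, Y\<rangle> = n = E |Y|\<^sup>2\<close>.
\<close>

subsection \<open>Antiderivatives of integrable functions\<close>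

text \<open>The density is only weakly differentiable and may vanish. Every identity is therefore
  reduced to lines: a weak partial derivative is recorded as \<open>g = antideriv (D i)\<close> on
  almost every line parallel to an axis, a form that passes to marginals by Fubini. The triangular
  map suits this form, being built from one-dimensional rearrangements with the product of its
  diagonal derivatives as Jacobian determinant. The obstacle is the zero set of the density, where
  the map is uncontrolled; contributions from there disappear because \<open>D i\<close> vanishes
  almost everywhere on it. The constant 2 \<delta> is exact bookkeeping: replacing the mean of log f
  in E |v|^2 - 2 E log f by its upper bound from the map, and using E <X, v> = m - n, produces
  precisely E |X - v - Z|^2. In \<open>L^2\<close>, c \<le> n means that Z lies on or outside the
  sphere, and then the bound on n - c keeps it within sqrt (2 \<delta>) of the sphere. For c > n
  that bound says nothing, but a Gaussian Y has distance 0 from the Gaussian, so only orthogonality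
  has to be arranged. The random sign is independent of X, which is why the sample space consists of
  pairs.\<close>

definition antideriv :: "(real \<Rightarrow> real) \<Rightarrow> real \<Rightarrow> real" where
  "antideriv D s = (\<integral>t. indicator {..s} t * D t \<partial>lborel)"

lemma integrable_indicator_mult [simp, intro]:
  fixes D :: "'b \<Rightarrow> real"
  assumes "integrable M D" "A \<in> sets M"
  shows "integrable M (\<lambda>t. indicator A t * D t)"
  using integrable_mult_indicator[OF assms(2,1)] by simp

lemma antideriv_cong_AE:
  assumes "AE t in lborel. D t = E t" "D \<in> borel_measurable borel" "E \<in> borel_measurable borel"
  shows "antideriv D s = antideriv E s"
  unfolding antideriv_def using assms by (intro integral_cong_AE) auto

lemma antideriv_diff:
  assumes "integrable lborel D" "a \<le> b"
  shows "antideriv D b - antideriv D a = (\<integral>t. indicator {a<..b} t * D t \<partial>lborel)"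
proof -
  have "antideriv D b - antideriv D a = (\<integral>t. indicator {..b} t * D t - indicator {..a} t * D t \<partial>lborel)"
    unfolding antideriv_def using assms(1) by (subst Bochner_Integration.integral_diff) auto
  also have "\<dots> = (\<integral>t. indicator {a<..b} t * D t \<partial>lborel)"
    using assms(2) by (intro Bochner_Integration.integral_cong) (auto simp: indicator_def)
  finally show ?thesis .
qed

lemma antideriv_tendsto_at_top:
  assumes "integrable lborel D"
  shows "(antideriv D \<longlongrightarrow> integral\<^sup>L lborel D) at_top"
  unfolding antideriv_def
  supply [measurable] = borel_measurable_integrable[OF assms]
proof (rule integral_dominated_convergence_at_top)
  show "integrable lborel (\<lambda>t. norm (D t))" using assms by simp
  show "AE x in lborel. ((\<lambda>i. indicator {..i} x * D x) \<longlongrightarrow> D x) at_top"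
  proof (rule AE_I2)
    fix x :: real
    show "((\<lambda>i. indicator {..i} x * D x) \<longlongrightarrow> D x) at_top"
      by (rule tendsto_eventually, rule eventually_mono[OF eventually_ge_at_top[of x]]) auto
  qed
  show "eventually (\<lambda>i. AE x in lborel. norm (indicator {..i} x * D x) \<le> norm (D x)) at_top"
    by (auto simp: indicator_def)
qed simp_all

lemma antideriv_tendsto_at_bot:
  assumes "integrable lborel D"
  shows "(antideriv D \<longlongrightarrow> 0) at_bot"
proof -
  note [measurable] = borel_measurable_integrable[OF assms]
  have "((\<lambda>s. antideriv D (-s)) \<longlongrightarrow> integral\<^sup>L lborel (\<lambda>_::real. 0::real)) at_top"
    unfolding antideriv_def
  proof (rule integral_dominated_convergence_at_top)
    show "integrable lborel (\<lambda>t. norm (D t))" using assms by simp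
    show "AE x in lborel. ((\<lambda>i. indicator {..-i} x * D x) \<longlongrightarrow> 0) at_top"
    proof (rule AE_I2)
      fix x :: real
      show "((\<lambda>i. indicator {..-i} x * D x) \<longlongrightarrow> 0) at_top"
        by (rule tendsto_eventually, rule eventually_mono[OF eventually_gt_at_top[of "-x"]]) auto
    qed
    show "eventually (\<lambda>i. AE x in lborel. norm (indicator {..-i} x * D x) \<le> norm (D x)) at_top"
      by (auto simp: indicator_def)
  qed simp_all
  then show ?thesis by (simp add: filterlim_at_bot_mirror)
qed

lemma continuous_antideriv:
  assumes "integrable lborel D"
  shows "isCont (antideriv D) s"
  supply [measurable] = borel_measurable_integrable[OF assms]
  unfolding continuous_at_sequentially comp_def
proof (intro allI impI)
  fix X :: "nat \<Rightarrow> real" assume X: "X \<longlonglongrightarrow> s"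
  show "(\<lambda>n. antideriv D (X n)) \<longlonglongrightarrow> antideriv D s"
    unfolding antideriv_def
  proof (rule integral_dominated_convergence[where w="\<lambda>t. norm (D t)"])
    \<comment> \<open>The indicators of \<open>{..X i}\<close> converge to that of
      \<open>{..s}\<close> except possibly at \<open>s\<close> itself, a null set.\<close>
    have "AE x in lborel. x \<noteq> s" by (rule AE_lborel_singleton)
    then show "AE x in lborel. (\<lambda>i. indicator {..X i} x * D x) \<longlonglongrightarrow> indicator {..s} x * D x"
    proof eventually_elim
      case (elim x)
      consider "x < s" | "s < x" using elim by linarith
      then show ?case
      proof cases
        case 1
        have "eventually (\<lambda>i. x < X i) sequentially" using X 1 by (rule order_tendstoD)
        then show ?thesis
          by (intro tendsto_eventually, elim eventually_mono) (use 1 in auto)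
      next
        case 2
        have "eventually (\<lambda>i. X i < x) sequentially" using X 2 by (rule order_tendstoD)
        then show ?thesis
          by (intro tendsto_eventually, elim eventually_mono) (use 2 in auto)
      qed
    qed
    show "\<And>i. AE x in lborel. norm (indicator {..X i} x * D x) \<le> norm (D x)"
      by (auto simp: indicator_def)
  qed (use assms in simp_all)
qed

lemma antideriv_measurable [measurable]:
  assumes "integrable lborel D" shows "antideriv D \<in> borel_measurable borel"
  using continuous_antideriv[OF assms] by (intro borel_measurable_continuous_onI)
    (simp add: continuous_at_imp_continuous_on)

lemma antideriv_mono:
  assumes "integrable lborel D" "AE t in lborel. 0 \<le> D t" "a \<le> b"
  shows "antideriv D a \<le> antideriv D b"
  unfolding antideriv_def
proof (rule integral_mono_AE)
  show "AE x in lborel. indicator {..a} x * D x \<le> indicator {..b} x * D x"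
    using assms(2) by eventually_elim (use assms(3) in \<open>auto simp: indicator_def\<close>)
qed (use assms(1) in auto)

text \<open>On \<open>[s - 1, s + 1]\<close> the antiderivative differs by a constant from the
  integral with base point \<open>s - 1\<close>, so the classical fundamental theorem applies; this
  base point leaves \<open>s\<close> in the interior of the interval.\<close>

lemma antideriv_has_derivative:
  assumes D: "integrable lborel D" and c: "\<And>x. isCont D x"
  shows "(antideriv D has_real_derivative D s) (at s)"
proof -
  have cont: "continuous_on A D" for A using c by (simp add: continuous_at_imp_continuous_on)
  have eq: "antideriv D x = antideriv D (s - 1) + integral {s - 1..x} D" if "x \<ge> s - 1" for x
  proof -
    have "antideriv D x - antideriv D (s-1) = (\<integral>t. indicator {s-1<..x} t * D t \<partial>lborel)"
      using that D by (rule antideriv_diff[rotated])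
    also have "\<dots> = (\<integral>t. indicator {s-1..x} t * D t \<partial>lborel)"
      using D AE_lborel_singleton[of "s-1"] by (intro integral_cong_AE) (auto simp: indicator_def)
    also have "\<dots> = integral {s-1..x} D"
      using set_borel_integral_eq_integral(2)[of "{s-1..x}" D] D
      by (auto simp: set_integrable_def set_lebesgue_integral_def)
    finally show ?thesis by simp
  qed
  have "((\<lambda>x. integral {s - 1..x} D) has_real_derivative D s) (at s within {s-1..s+1})"
    by (rule integral_has_real_derivative) (auto intro: cont)
  then have "((\<lambda>x. antideriv D (s-1) + integral {s - 1..x} D) has_real_derivative D s) (at s within {s-1..s+1})"
    by (auto intro!: derivative_eq_intros)
  then have "(antideriv D has_real_derivative D s) (at s within {s-1..s+1})"
    by (rule has_field_derivative_transform_within[where d=1]) (simp_all add: eq[symmetric])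
  then show ?thesis by (simp add: at_within_Icc_at)
qed

section \<open>Boundary terms at infinity and integration by parts on the line\<close>

lemma emeasure_lborel_atLeast: "emeasure lborel {R::real..} = \<infinity>"
proof (rule ccontr)
  assume "emeasure lborel {R..} \<noteq> \<infinity>"
  then obtain n where n: "emeasure lborel {R..} < of_nat n"
    using ennreal_Ex_less_of_nat by (auto simp: less_top)
  have "of_nat n = emeasure lborel {R..R + real n}" by (simp add: ennreal_of_nat_eq_real_of_nat)
  also have "\<dots> \<le> emeasure lborel {R..}" by (intro emeasure_mono) auto
  finally show False using n by simp
qed

text \<open>At plus infinity \<open>antideriv D\<close> tends to the total integral of
  \<open>D\<close>, and an integrable function cannot stay away from zero on a half-line of infinite
  measure.\<close>

lemma integral_eq_0_if_antideriv_integrable: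
  assumes D: "integrable lborel D" and w: "integrable lborel (antideriv D)"
  shows "integral\<^sup>L lborel D = 0"
proof (rule ccontr)
  define L where "L = \<bar>integral\<^sup>L lborel D\<bar>"
  assume "integral\<^sup>L lborel D \<noteq> 0"
  then have L: "L > 0" by (simp add: L_def)
  have "((\<lambda>s. \<bar>antideriv D s\<bar>) \<longlongrightarrow> L) at_top"
    unfolding L_def by (intro tendsto_rabs antideriv_tendsto_at_top D)
  then have "eventually (\<lambda>s. L / 2 < \<bar>antideriv D s\<bar>) at_top"
    using L by (intro order_tendstoD) auto
  then obtain R where R: "\<And>s. s \<ge> R \<Longrightarrow> L / 2 < \<bar>antideriv D s\<bar>"
    by (auto simp: eventually_at_top_linorder)
  have "\<infinity> = (\<integral>\<^sup>+ s. ennreal (L/2) * indicator {R..} s \<partial>lborel)"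
    using L by (simp add: nn_integral_cmult_indicator emeasure_lborel_atLeast ennreal_mult_top)
  also have "\<dots> \<le> (\<integral>\<^sup>+ s. norm (antideriv D s) \<partial>lborel)"
    using R by (intro nn_integral_mono) (auto simp: indicator_def intro!: ennreal_leI less_imp_le)
  also have "\<dots> < \<infinity>" using w by (auto simp: integrable_iff_bounded)
  finally show False by simp
qed

text \<open>Writing \<open>S t = \<integral>\<^sub>m\<^sup>t d\<close>, both sides are the double integral of \<open>d s * D t\<close>
  over the region between \<open>m\<close> and \<open>t\<close>.\<close>

lemma integral_by_parts_Fubini:
  fixes w D d S :: "real \<Rightarrow> real"
  assumes D: "integrable lborel D" and D0: "integral\<^sup>L lborel D = 0"
    and w [measurable]: "w \<in> borel_measurable borel" 
    and wD: "AE s in lborel. w s = antideriv D s"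
    and d [measurable]: "d \<in> borel_measurable borel" and d0: "\<And>s. 0 \<le> d s"
    and DS: "integrable lborel (\<lambda>t. D t * S t)"
    and S: "AE t in lborel. D t \<noteq> 0 \<longrightarrow>
       (m \<le> t \<longrightarrow> 0 \<le> S t \<and> (\<integral>\<^sup>+s. ennreal (d s) * indicator {m..t} s \<partial>lborel) = ennreal (S t)) \<and>
       (t \<le> m \<longrightarrow> S t \<le> 0 \<and> (\<integral>\<^sup>+s. ennreal (d s) * indicator {t..m} s \<partial>lborel) = ennreal (- S t))"
  shows "integrable lborel (\<lambda>s. w s * d s)"
    and "(\<integral>s. w s * d s \<partial>lborel) = - (\<integral>t. D t * S t \<partial>lborel)"
proof -
  have [measurable]: "D \<in> borel_measurable borel" using D by (simp add: borel_measurable_integrable)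
  have [measurable]: "(\<lambda>t. D t * S t) \<in> borel_measurable borel"
    using DS by (auto dest: borel_measurable_integrable)
  \<comment> \<open>The kernel is 1 for m \<le> s \<le> t, it is -1 for t \<le> s < m, and 0
    otherwise. Integrating \<open>d s\<close> against it in \<open>s\<close> gives
    \<open>S t\<close>; integrating \<open>D t\<close> against it in \<open>t\<close> gives
    \<open>- w s\<close>, for m \<le> s through the vanishing total integral of
    \<open>D\<close>.\<close>
  define K :: "real \<Rightarrow> real \<Rightarrow> real" where
    "K s t = (if m \<le> s then (if s \<le> t then 1 else 0) else (if t \<le> s then -1 else 0))" for s t
  have K[measurable]: "(\<lambda>(s, t). K s t) \<in> borel_measurable (borel \<Otimes>\<^sub>M borel)"
    unfolding K_def by measurable
  define F where "F s t = K s t * d s * D t" for s t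
  have F[measurable]: "(\<lambda>(s, t). F s t) \<in> borel_measurable (borel \<Otimes>\<^sub>M borel)"
    unfolding F_def using K by measurable
  have K1: "AE s in lborel. \<bar>K s t\<bar> = (if m \<le> t then indicator {m..t} s else indicator {t..m} s)" for t
    using AE_lborel_singleton[of m] by eventually_elim (auto simp: K_def indicator_def)
  \<comment> \<open>\<open>S\<close> is tied to \<open>d\<close> only where \<open>D t\<close> is
    nonzero; where \<open>D t = 0\<close> both sides vanish. This later allows \<open>S\<close> to
    be a transport map that is uncontrolled outside the support of the density.\<close>
  have nn: "(\<integral>\<^sup>+s. norm (F s t) \<partial>lborel) = norm (D t * S t)" 
    if *: "D t \<noteq> 0 \<longrightarrow>
       (m \<le> t \<longrightarrow> 0 \<le> S t \<and> (\<integral>\<^sup>+s. ennreal (d s) * indicator {m..t} s \<partial>lborel) = ennreal (S t)) \<and>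
       (t \<le> m \<longrightarrow> S t \<le> 0 \<and> (\<integral>\<^sup>+s. ennreal (d s) * indicator {t..m} s \<partial>lborel) = ennreal (- S t))" for t
  proof (cases "D t = 0")
    case True then show ?thesis by (simp add: F_def)
  next
    case False
    have "(\<integral>\<^sup>+s. norm (F s t) \<partial>lborel) = (\<integral>\<^sup>+s. ennreal \<bar>D t\<bar> * (ennreal (d s) * (if m \<le> t then indicator {m..t} s else indicator {t..m} s)) \<partial>lborel)"
      using K1[of t]
      by (intro nn_integral_cong_AE, elim eventually_mono)
         (auto simp: F_def abs_mult d0 ennreal_mult' mult_ac indicator_def)
    also have "\<dots> = ennreal \<bar>D t\<bar> * (if m \<le> t then ennreal (S t) else ennreal (- S t))"
      using * False by (subst nn_integral_cmult) auto
    also have "\<dots> = norm (D t * S t)"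
      using * False by (auto simp: abs_mult ennreal_mult' abs_of_nonneg abs_of_nonpos)
    finally show ?thesis .
  qed
  have "(\<integral>\<^sup>+ z. norm (case z of (s,t) \<Rightarrow> F s t) \<partial>(lborel \<Otimes>\<^sub>M lborel)) = (\<integral>\<^sup>+t. (\<integral>\<^sup>+s. norm (F s t) \<partial>lborel) \<partial>lborel)"
    by (subst lborel_pair.nn_integral_snd[symmetric]) auto
  also have "\<dots> = (\<integral>\<^sup>+t. norm (D t * S t) \<partial>lborel)"
    using S by (intro nn_integral_cong_AE, elim eventually_mono) (rule nn, simp)
  also have "\<dots> < \<infinity>" using DS by (auto simp: integrable_iff_bounded)
  finally have Fint: "integrable (lborel \<Otimes>\<^sub>M lborel) (\<lambda>(s,t). F s t)"
    by (intro integrableI_bounded) auto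
  have i1: "AE s in lborel. (\<integral>t. F s t \<partial>lborel) = - (w s * d s)"
    using wD
  proof eventually_elim
    case (elim s)
    have "(\<integral>t. K s t * D t \<partial>lborel) = - w s"
    proof (cases "m \<le> s")
      case True
      have "(\<integral>t. K s t * D t \<partial>lborel) = (\<integral>t. D t - indicator {..s} t * D t \<partial>lborel)"
        using True AE_lborel_singleton[of s] by (intro integral_cong_AE) (auto simp: K_def indicator_def)
      also have "\<dots> = - antideriv D s"
        using D by (subst Bochner_Integration.integral_diff) (auto simp: antideriv_def D0)
      finally show ?thesis using elim by simp
    next
      case False
      have "(\<integral>t. K s t * D t \<partial>lborel) = (\<integral>t. - (indicator {..s} t * D t) \<partial>lborel)"
        using False by (intro Bochner_Integration.integral_cong) (auto simp: K_def indicator_def)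
      then show ?thesis using elim by (simp add: antideriv_def)
    qed
    then have "d s * (\<integral>t. K s t * D t \<partial>lborel) = - (w s * d s)" by simp
    then show ?case unfolding F_def by (simp add: mult_ac flip: integral_mult_right_zero)
  qed
  have i2: "AE t in lborel. (\<integral>s. F s t \<partial>lborel) = D t * S t"
    using S
  proof eventually_elim
    case (elim t)
    show ?case
    proof (cases "D t = 0")
      case True then show ?thesis by (simp add: F_def)
    next
      case False
      have "(\<integral>s. K s t * d s \<partial>lborel) = S t"
      proof (cases "m \<le> t")
        case True
        have "(\<integral>s. K s t * d s \<partial>lborel) = (\<integral>s. d s * indicator {m..t} s \<partial>lborel)"
          using True AE_lborel_singleton[of m] by (intro integral_cong_AE) (auto simp: K_def indicator_def)
        also have "\<dots> = S t"
          using True False elim d0 by (subst integral_eq_nn_integral) (auto simp: ennreal_mult' ennreal_indicator)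
        finally show ?thesis .
      next
        case tm: False
        have "(\<integral>s. K s t * d s \<partial>lborel) = (\<integral>s. - (d s * indicator {t..m} s) \<partial>lborel)"
          using tm AE_lborel_singleton[of m] by (intro integral_cong_AE) (auto simp: K_def indicator_def)
        also have "\<dots> = - (\<integral>s. d s * indicator {t..m} s \<partial>lborel)" by simp
        also have "\<dots> = S t"
          using tm False elim d0 by (subst integral_eq_nn_integral) (auto simp: ennreal_mult' ennreal_indicator)
        finally show ?thesis .
      qed
      then have "(\<integral>s. K s t * d s \<partial>lborel) * D t = D t * S t" by simp
      then show ?thesis unfolding F_def by (simp flip: integral_mult_left_zero)
    qed
  qed
  have mF1: "(\<lambda>s. \<integral>t. F s t \<partial>lborel) \<in> borel_measurable borel" using F by measurable
  have mF2: "(\<lambda>t. \<integral>s. F s t \<partial>lborel) \<in> borel_measurable borel" using F by measurable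
  have "integrable lborel (\<lambda>s. \<integral>t. F s t \<partial>lborel)"
    using lborel_pair.integrable_fst[OF Fint] by simp
  then have "integrable lborel (\<lambda>s. - (w s * d s))"
    by (rule Bochner_Integration.integrable_cong_AE_imp[OF _ _ i1]) simp
  then show "integrable lborel (\<lambda>s. w s * d s)" by simp
  have "- (\<integral>s. w s * d s \<partial>lborel) = (\<integral>s. (\<integral>t. F s t \<partial>lborel) \<partial>lborel)"
    unfolding Bochner_Integration.integral_minus[symmetric] using i1 mF1
    by (intro integral_cong_AE) (simp_all add: eq_commute)
  also have "\<dots> = (\<integral>t. (\<integral>s. F s t \<partial>lborel) \<partial>lborel)"
    using lborel_pair.Fubini_integral[OF Fint] by simp
  also have "\<dots> = (\<integral>t. D t * S t \<partial>lborel)"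
    using i2 mF2 by (intro integral_cong_AE) auto
  finally show "(\<integral>s. w s * d s \<partial>lborel) = - (\<integral>t. D t * S t \<partial>lborel)" by simp
qed

section \<open>Functions determined by their integrals over boxes\<close>

lemma mem_box_One:
  fixes x :: "'a::euclidean_space"
  assumes "norm x < r" shows "x \<in> box (- r *\<^sub>R One) (r *\<^sub>R One)"
proof -
  have "\<bar>x \<bullet> b\<bar> < r" if "b \<in> Basis" for b
    using Basis_le_norm[OF that, of x] assms by linarith
  then show ?thesis
    by (auto simp: mem_box inner_Basis inner_sum_left abs_less_iff minus_less_iff)
qed

text \<open>Open boxes form an intersection-stable generator of the Borel sets, so a Dynkin system
  argument carries the vanishing to all Borel sets, and there uniqueness of densities
  applies.\<close>

lemma AE_eq_0_if_box_integrals_eq_0: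
  fixes e :: "'a::euclidean_space \<Rightarrow> real"
  assumes e: "integrable lborel e"
    and box: "\<And>a b. (\<integral>x. indicator (box a b) x * e x \<partial>lborel) = 0"
  shows "AE x in lborel. e x = 0"
proof -
  have [measurable]: "e \<in> borel_measurable borel" using e by simp
  \<comment> \<open>The space is an increasing union of boxes. The total integral is what the
    complement step below subtracts from.\<close>
  have tot: "integral\<^sup>L lborel e = 0"
  proof -
    define B where "B n = box (- real n *\<^sub>R One) (real n *\<^sub>R One :: 'a)" for n
    have "(\<lambda>n. \<integral>x. indicator (B n) x * e x \<partial>lborel) \<longlonglongrightarrow> integral\<^sup>L lborel e"
    proof (rule integral_dominated_convergence[where w="\<lambda>x. norm (e x)"])
      show "AE x in lborel. (\<lambda>i. indicator (B i) x * e x) \<longlonglongrightarrow> e x"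
      proof (rule AE_I2)
        fix x :: 'a
        have "eventually (\<lambda>n. x \<in> B n) sequentially"
        proof -
          obtain N :: nat where N: "norm x < N" using reals_Archimedean2 by blast
          have "x \<in> B n" if "n \<ge> N" for n
            unfolding B_def by (rule mem_box_One) (use N that in linarith)
          then show ?thesis by (auto simp: eventually_sequentially)
        qed
        then show "(\<lambda>i. indicator (B i) x * e x) \<longlonglongrightarrow> e x"
          by (intro tendsto_eventually) (erule eventually_mono, simp)
      qed
    qed (use e in \<open>auto simp: indicator_def B_def\<close>)
    then have "(\<lambda>n::nat. 0) \<longlonglongrightarrow> integral\<^sup>L lborel e" by (simp add: B_def box)
    then show ?thesis by (simp add: LIMSEQ_const_iff)
  qed
  have z: "(\<integral>x. indicator A x * e x \<partial>lborel) = 0" if "A \<in> sets borel" for A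
  proof -
    have A: "A \<in> sigma_sets UNIV (range (\<lambda>(a, b). box a b :: 'a set))"
      using that unfolding borel_eq_box by simp
    have sub: "range (\<lambda>(a, b). box a b :: 'a set) \<subseteq> Pow UNIV" by simp
    have int: "Int_stable (range (\<lambda>(a, b). box a b :: 'a set))"
    proof (rule Int_stableI)
      fix A B assume "A \<in> range (\<lambda>(a, b). box a b :: 'a set)" "B \<in> range (\<lambda>(a, b). box a b :: 'a set)"
      then obtain a b c d where "A = box a b" "B = box c d" by auto
      then obtain u v where "A \<inter> B = box u v" using box_Int_box by blast
      then show "A \<inter> B \<in> range (\<lambda>(a, b). box a b :: 'a set)"
        by (intro image_eqI[where x="(u, v)"]) auto
    qed
    show ?thesis
      using int sub A
    proof (induction rule: sigma_sets_induct_disjoint)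
      case (basic A) then show ?case using box by auto
    next
      case empty then show ?case by simp
    next
      case (compl A)
      have [measurable]: "A \<in> sets borel"
        using compl(1) unfolding borel_eq_box by simp
      have "(\<integral>x. indicator (UNIV - A) x * e x \<partial>lborel) = (\<integral>x. e x - indicator A x * e x \<partial>lborel)"
        by (intro Bochner_Integration.integral_cong) (auto simp: indicator_def)
      also have "\<dots> = 0" using e compl by (subst Bochner_Integration.integral_diff) (auto simp: tot)
      finally show ?case .
    next
      case (union A)
      have A[measurable]: "A i \<in> sets borel" for i
        using union(2) unfolding borel_eq_box by auto
      have "(\<lambda>n. \<integral>x. (\<Sum>i<n. indicator (A i) x * e x) \<partial>lborel) \<longlonglongrightarrow> (\<integral>x. indicator (\<Union>(range A)) x * e x \<partial>lborel)"
      proof (rule integral_dominated_convergence[where w="\<lambda>x. norm (e x)"])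
        have *: "(\<Sum>i<n. indicator (A i) x * e x) = indicator (\<Union>i<n. A i) x * e x" for n x
        proof -
          have "(indicator (\<Union>i<n. A i) x :: real) = (\<Sum>i<n. indicator (A i) x)"
            using union(1) by (intro indicator_UN_disjoint) (auto simp: disjoint_family_on_def)
          then show ?thesis by (simp add: sum_distrib_right)
        qed
        show "AE x in lborel. (\<lambda>n. \<Sum>i<n. indicator (A i) x * e x) \<longlonglongrightarrow> indicator (\<Union>(range A)) x * e x"
          unfolding * by (intro AE_I2 tendsto_mult tendsto_const LIMSEQ_indicator_UN[unfolded comp_def])
        show "AE x in lborel. norm (\<Sum>i<n. indicator (A i) x * e x) \<le> norm (e x)" for n
          unfolding * by (auto simp: indicator_def)
      qed (use e in auto)
      moreover have "(\<integral>x. (\<Sum>i<n. indicator (A i) x * e x) \<partial>lborel) = 0" for n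
        using e union(3) by (subst Bochner_Integration.integral_sum) auto
      ultimately show ?case by (simp add: LIMSEQ_const_iff)
    qed
  qed
  have "AE x in lborel. e x = (\<lambda>_. 0) x"
    by (rule density_unique_real) (use e z in \<open>auto simp: set_lebesgue_integral_def\<close>)
  then show ?thesis by simp
qed

lemma AE_eq_0_if_antideriv_eq_0:
  assumes "integrable lborel E" "\<And>s. antideriv E s = 0"
  shows "AE s in lborel. E s = 0"
proof (rule AE_eq_0_if_box_integrals_eq_0)
  fix a b :: real
  show "(\<integral>x. indicator (box a b) x * E x \<partial>lborel) = 0"
  proof (cases "a \<le> b")
    case True
    have "(\<integral>x. indicator (box a b) x * E x \<partial>lborel) = (\<integral>x. indicator {a<..b} x * E x \<partial>lborel)"
      using assms(1) AE_lborel_singleton[of b] by (intro integral_cong_AE) (auto simp: indicator_def)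
    also have "\<dots> = 0" using antideriv_diff[OF assms(1) True] assms(2) by simp
    finally show ?thesis .
  qed simp
qed fact

section \<open>Product rule, and the derivative on the zero set\<close>

text \<open>The product is a double integral over the square with both variables at most
  \<open>s\<close>. The diagonal splits it into two triangles, and in each the inner integral is
  again an antiderivative.\<close>

lemma antideriv_mult:
  assumes D: "integrable lborel D" and E: "integrable lborel E"
  shows "antideriv D s * antideriv E s = antideriv (\<lambda>t. D t * antideriv E t + E t * antideriv D t) s"
    and "integrable lborel (\<lambda>t. D t * antideriv E t)"
proof -
  have [measurable]: "D \<in> borel_measurable borel" "E \<in> borel_measurable borel" using D E by auto
  have DE: "integrable (lborel \<Otimes>\<^sub>M lborel) (\<lambda>(t, r). D t * E r)"
  proof (rule integrableI_bounded)
    have "(\<integral>\<^sup>+ x. ennreal (norm (case x of (t, r) \<Rightarrow> D t * E r)) \<partial>(lborel \<Otimes>\<^sub>M lborel))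
       = (\<integral>\<^sup>+ t. ennreal \<bar>D t\<bar> * (\<integral>\<^sup>+ r. ennreal \<bar>E r\<bar> \<partial>lborel) \<partial>lborel)"
      by (subst lborel.nn_integral_fst[symmetric]) (auto simp: abs_mult ennreal_mult' nn_integral_cmult)
    also have "\<dots> = (\<integral>\<^sup>+ t. ennreal \<bar>D t\<bar> \<partial>lborel) * (\<integral>\<^sup>+ r. ennreal \<bar>E r\<bar> \<partial>lborel)"
      by (simp add: nn_integral_multc)
    also have "\<dots> < \<infinity>" using D E by (auto simp: integrable_iff_bounded ennreal_mult_less_top)
    finally show "(\<integral>\<^sup>+ x. ennreal (norm (case x of (t, r) \<Rightarrow> D t * E r)) \<partial>(lborel \<Otimes>\<^sub>M lborel)) < \<infinity>" .
  qed auto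
  have lower: "integrable (lborel \<Otimes>\<^sub>M lborel) (\<lambda>(t, r). indicator {..t} r * (D t * E r))" 
  proof (rule Bochner_Integration.integrable_bound[OF DE])
    have "(\<lambda>(t, r). indicator {..t} r * (D t * E r)) = (\<lambda>(t, r). (if r \<le> t then 1 else 0) * (D t * E r))"
      by (auto simp: indicator_def)
    then show "(\<lambda>(t, r). indicator {..t} r * (D t * E r)) \<in> borel_measurable (lborel \<Otimes>\<^sub>M lborel)"
      by (simp del: mult_eq_0_iff)
  qed (auto simp: indicator_def)
  have in1: "(\<integral>r. indicator {..t} r * (D t * E r) \<partial>lborel) = D t * antideriv E t" for t
    unfolding antideriv_def by (simp add: mult.left_commute flip: integral_mult_right_zero)
  show "integrable lborel (\<lambda>t. D t * antideriv E t)"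
    using lborel_pair.integrable_fst[OF lower] by (simp add: in1)
  \<comment> \<open>\<open>F1\<close> lives on the triangle r \<le> t and \<open>F2\<close> on t
    \<le> r. They overlap on the diagonal only, which is a null set for each fixed
    \<open>t\<close>.\<close>
  define F1 where "F1 t r = indicator {..s} t * (indicator {..t} r * (D t * E r))" for t r
  define F2 where "F2 t r = indicator {..s} r * (indicator {..r} t * (D t * E r))" for t r
  have F1: "integrable (lborel \<Otimes>\<^sub>M lborel) (\<lambda>(t,r). F1 t r)"
  proof (rule Bochner_Integration.integrable_bound[OF DE])
    have "(\<lambda>(t, r). F1 t r) = (\<lambda>(t, r). (if r \<le> t then 1 else 0) * indicator {..s} t * (D t * E r))"
      by (auto simp: indicator_def F1_def)
    then show "(\<lambda>(t, r). F1 t r) \<in> borel_measurable (lborel \<Otimes>\<^sub>M lborel)"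
      by (simp del: mult_eq_0_iff)
  qed (auto simp: indicator_def F1_def)
  have F2: "integrable (lborel \<Otimes>\<^sub>M lborel) (\<lambda>(t,r). F2 t r)"
  proof (rule Bochner_Integration.integrable_bound[OF DE])
    have "(\<lambda>(t, r). F2 t r) = (\<lambda>(t, r). (if t \<le> r then 1 else 0) * indicator {..s} r * (D t * E r))"
      by (auto simp: indicator_def F2_def)
    then show "(\<lambda>(t, r). F2 t r) \<in> borel_measurable (lborel \<Otimes>\<^sub>M lborel)"
      by (simp del: mult_eq_0_iff)
  qed (auto simp: indicator_def F2_def)
  have i1: "(\<integral>r. F1 t r \<partial>lborel) = indicator {..s} t * (D t * antideriv E t)" for t
    unfolding F1_def by (simp add: in1)
  have i2: "(\<integral>t. F2 t r \<partial>lborel) = indicator {..s} r * (E r * antideriv D r)" for r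
    unfolding F2_def antideriv_def by (simp add: mult_ac flip: integral_mult_right_zero)
  have "antideriv D s * antideriv E s = (\<integral>t. (\<integral>r. indicator {..s} t * D t * (indicator {..s} r * E r) \<partial>lborel) \<partial>lborel)"
    unfolding antideriv_def by simp
  also have "\<dots> = (\<integral>t. (\<integral>r. F1 t r + F2 t r \<partial>lborel) \<partial>lborel)"
  proof (rule Bochner_Integration.integral_cong[OF refl])
    fix t :: real
    have "(\<lambda>r. F1 t r) = (\<lambda>r. (if r \<le> t then 1 else 0) * indicator {..s} t * (D t * E r))"
      "(\<lambda>r. F2 t r) = (\<lambda>r. (if t \<le> r then 1 else 0) * indicator {..s} r * (D t * E r))"
      by (auto simp: indicator_def F1_def F2_def)
    then have [measurable]: "F1 t \<in> borel_measurable borel" "F2 t \<in> borel_measurable borel"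
      by (simp_all del: mult_eq_0_iff)
    show "(\<integral>r. indicator {..s} t * D t * (indicator {..s} r * E r) \<partial>lborel) = (\<integral>r. F1 t r + F2 t r \<partial>lborel)"
      using AE_lborel_singleton[of t]
      by (intro integral_cong_AE) (auto simp: F1_def F2_def indicator_def)
  qed
  also have "\<dots> = integral\<^sup>L (lborel \<Otimes>\<^sub>M lborel) (\<lambda>(t,r). F1 t r + F2 t r)"
    using lborel_pair.integral_fst'[of "\<lambda>(t,r). F1 t r + F2 t r"] Bochner_Integration.integrable_add[OF F1 F2]
    by (simp add: case_prod_unfold)
  also have "\<dots> = integral\<^sup>L (lborel \<Otimes>\<^sub>M lborel) (\<lambda>(t,r). F1 t r) + integral\<^sup>L (lborel \<Otimes>\<^sub>M lborel) (\<lambda>(t,r). F2 t r)"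
    using Bochner_Integration.integral_add[OF F1 F2] by (simp add: case_prod_unfold)
  also have "integral\<^sup>L (lborel \<Otimes>\<^sub>M lborel) (\<lambda>(t,r). F1 t r) = (\<integral>t. indicator {..s} t * (D t * antideriv E t) \<partial>lborel)"
    using lborel_pair.integral_fst'[OF F1] by (simp add: i1)
  also have "integral\<^sup>L (lborel \<Otimes>\<^sub>M lborel) (\<lambda>(t,r). F2 t r) = (\<integral>r. indicator {..s} r * (E r * antideriv D r) \<partial>lborel)"
    using lborel_pair.integral_snd[OF F2] by (simp add: i2)
  also have "(\<integral>t. indicator {..s} t * (D t * antideriv E t) \<partial>lborel) + \<dots> = antideriv (\<lambda>t. D t * antideriv E t + E t * antideriv D t) s"
  proof -
    have "integrable lborel (\<lambda>t. indicator {..s} t * (D t * antideriv E t))"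
      using lborel_pair.integrable_fst[OF F1] by (simp add: i1)
    moreover have "integrable lborel (\<lambda>t. indicator {..s} t * (E t * antideriv D t))"
      using lborel_pair.integrable_snd[OF F2] by (simp add: i2)
    ultimately show ?thesis
      unfolding antideriv_def by (simp add: distrib_left)
  qed
  finally show "antideriv D s * antideriv E s = antideriv (\<lambda>t. D t * antideriv E t + E t * antideriv D t) s" .
qed

text \<open>With \<open>w = antideriv D\<close>, the polynomials \<open>(1 - (1 - w)\<^sup>k) / k\<close> tend to \<open>0\<close>
  uniformly while their derivatives \<open>(1 - w)\<^sup>k\<^sup>-\<^sup>1 D\<close> tend to \<open>D\<close> on \<open>{w = 0}\<close> and to \<open>0\<close> elsewhere.\<close>

lemma deriv_eq_0_on_zeros:
  assumes D: "integrable lborel D" and nonneg: "\<And>s. 0 \<le> antideriv D s"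
  shows "AE s in lborel. antideriv D s = 0 \<longrightarrow> D s = 0"
proof -
  have bdd: "antideriv D s \<le> (\<integral>t. \<bar>D t\<bar> \<partial>lborel)" for s
    unfolding antideriv_def
    by (rule integral_mono) (use D in \<open>auto split: split_indicator intro!: integrable_indicator_mult\<close>)
  \<comment> \<open>Adding 1 makes \<open>M\<close> positive and the normalised antiderivative
    \<open>w\<close> strictly smaller than 1. Then \<open>1 - w\<close> lies in
    \<open>(0, 1]\<close>, and its powers tend to the indicator of the zero set of
    \<open>w\<close>.\<close>
  define M where "M = (\<integral>t. \<bar>D t\<bar> \<partial>lborel) + 1"
  have M: "M > 0" unfolding M_def by (smt (verit) Bochner_Integration.integral_nonneg abs_ge_zero)
  define E where "E t = D t / M" for t
  have E: "integrable lborel E" unfolding E_def using D by simp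
  have aE: "antideriv E s = antideriv D s / M" for s
    unfolding antideriv_def E_def by simp
  define w where "w = antideriv E"
  have w0: "0 \<le> w s" and w1: "w s < 1" for s
    unfolding w_def aE using nonneg[of s] bdd[of s] M by (auto simp: divide_simps) (auto simp: M_def)
  have [measurable]: "w \<in> borel_measurable borel" unfolding w_def by (rule antideriv_measurable[OF E])
  have [measurable]: "E \<in> borel_measurable borel" using E by simp
  have intk: "integrable lborel (\<lambda>t. (1 - w t) ^ k * E t)" for k
  proof (rule Bochner_Integration.integrable_bound[OF E])
    show "AE t in lborel. norm ((1 - w t) ^ k * E t) \<le> norm (E t)"
    proof (rule AE_I2)
      fix t
      have "\<bar>1 - w t\<bar> ^ k \<le> 1" using w0[of t] w1[of t] by (intro power_le_one) auto
      then show "norm ((1 - w t) ^ k * E t) \<le> norm (E t)"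
        by (simp add: abs_mult power_abs mult_left_le_one_le)
    qed
  qed simp
  \<comment> \<open>The derivative of the k-th power of \<open>1 - w\<close>, by induction from the
    product rule. The truncated \<open>k - 1\<close> at \<open>k = 0\<close> is harmless because of
    the factor \<open>k\<close>.\<close>
  have pk: "1 - (1 - w s) ^ k = antideriv (\<lambda>t. real k * ((1 - w t) ^ (k - 1) * E t)) s" for k s
  proof (induction k arbitrary: s)
    case 0 then show ?case by (simp add: antideriv_def)
  next
    case (Suc k)
    define R where "R = (\<lambda>t. real k * ((1 - w t) ^ (k - 1) * E t))"
    have R: "integrable lborel R" unfolding R_def using intk by simp
    have aR: "antideriv R = (\<lambda>s. 1 - (1 - w s) ^ k)" using Suc by (auto simp: R_def)
    have "1 - (1 - w s) ^ Suc k = antideriv R s + antideriv E s - antideriv E s * antideriv R s"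
      unfolding aR by (simp add: w_def algebra_simps)
    also have "\<dots> = antideriv R s + antideriv E s - antideriv (\<lambda>t. E t * antideriv R t + R t * antideriv E t) s"
      using antideriv_mult(1)[OF E R] by simp
    also have "\<dots> = antideriv (\<lambda>t. R t + E t - (E t * antideriv R t + R t * antideriv E t)) s"
    proof -
      have 1: "integrable lborel (\<lambda>t. indicator {..s} t * R t)" "integrable lborel (\<lambda>t. indicator {..s} t * E t)"
        using R E by auto
      have 2: "integrable lborel (\<lambda>t. indicator {..s} t * (E t * antideriv R t + R t * antideriv E t))"
        by (intro integrable_indicator_mult Bochner_Integration.integrable_add antideriv_mult(2) R E) simp
      show ?thesis
        unfolding antideriv_def[of _ s] right_diff_distrib distrib_left[of _ "R _" "E _"]
        using 1 2 by simp
    qed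
    also have "(\<lambda>t. R t + E t - (E t * antideriv R t + R t * antideriv E t)) =
       (\<lambda>t. real (Suc k) * ((1 - w t) ^ (Suc k - 1) * E t))"
    proof
      fix t
      have "R t * (1 - w t) = real k * (1 - w t) ^ k * E t"
        unfolding R_def by (cases k) auto
      then show "R t + E t - (E t * antideriv R t + R t * antideriv E t) = real (Suc k) * ((1 - w t) ^ (Suc k - 1) * E t)"
        unfolding aR by (simp add: w_def algebra_simps)
    qed
    finally show ?case .
  qed
  define Z where "Z t = indicator {t. w t = 0} t * E t" for t
  have Z: "integrable lborel Z" unfolding Z_def using E by (intro integrable_indicator_mult) auto
  have "antideriv Z s = 0" for s
  proof -
    have "(\<lambda>k. antideriv (\<lambda>t. (1 - w t) ^ k * E t) s) \<longlonglongrightarrow> antideriv Z s"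
      unfolding antideriv_def
    proof (rule integral_dominated_convergence[where w="\<lambda>t. norm (E t)"])
      show "AE t in lborel. (\<lambda>k. indicator {..s} t * ((1 - w t) ^ k * E t)) \<longlonglongrightarrow> indicator {..s} t * Z t"
      proof (intro AE_I2 tendsto_mult tendsto_const)
        fix t
        show "(\<lambda>k. (1 - w t) ^ k * E t) \<longlonglongrightarrow> Z t"
        proof (cases "w t = 0")
          case False
          then have "(\<lambda>k. (1 - w t) ^ k * E t) \<longlonglongrightarrow> 0 * E t"
            using w0[of t] w1[of t] by (intro tendsto_mult tendsto_const LIMSEQ_realpow_zero) auto
          then show ?thesis using False by (simp add: Z_def)
        qed (simp add: Z_def)
      qed
      show "AE t in lborel. norm (indicator {..s} t * ((1 - w t) ^ k * E t)) \<le> norm (E t)" for k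
      proof (rule AE_I2)
        fix t
        have "\<bar>1 - w t\<bar> ^ k \<le> 1" using w0[of t] w1[of t] by (intro power_le_one) auto
        then show "norm (indicator {..s} t * ((1 - w t) ^ k * E t)) \<le> norm (E t)"
          by (simp add: abs_mult power_abs mult_left_le_one_le indicator_def)
      qed
    qed (use E Z in auto)
    moreover have "(\<lambda>k. antideriv (\<lambda>t. (1 - w t) ^ k * E t) s) \<longlonglongrightarrow> 0"
    proof (rule Lim_null_comparison)
      show "(\<lambda>k. inverse (real (Suc k))) \<longlonglongrightarrow> 0" by (rule LIMSEQ_inverse_real_of_nat)
      show "\<forall>\<^sub>F k in sequentially. norm (antideriv (\<lambda>t. (1 - w t) ^ k * E t) s) \<le> inverse (real (Suc k))"
      proof (intro always_eventually allI)
        fix k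
        \<comment> \<open>By \<open>pk\<close>, k + 1 times the antiderivative of
          \<open>(1 - w) ^ k * E\<close> is 1 minus a power of \<open>1 - w\<close>, a number in
          \<open>[0, 1]\<close>.\<close>
        have "real (Suc k) * antideriv (\<lambda>t. (1 - w t) ^ k * E t) s = 1 - (1 - w s) ^ Suc k"
          unfolding pk by (simp add: antideriv_def mult.left_commute del: of_nat_Suc power_Suc)
        moreover have "0 \<le> (1 - w s) ^ Suc k" "(1 - w s) ^ Suc k \<le> 1"
          using w0[of s] w1[of s] by (auto intro!: power_le_one mult_le_one zero_le_power)
        ultimately have "\<bar>real (Suc k) * antideriv (\<lambda>t. (1 - w t) ^ k * E t) s\<bar> \<le> 1" by linarith
        then show "norm (antideriv (\<lambda>t. (1 - w t) ^ k * E t) s) \<le> inverse (real (Suc k))"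
          by (simp add: abs_mult divide_simps mult.commute del: of_nat_Suc)
      qed
    qed
    ultimately show ?thesis by (rule LIMSEQ_unique)
  qed
  then have "AE s in lborel. Z s = 0" by (rule AE_eq_0_if_antideriv_eq_0[OF Z])
  then show ?thesis
    by eventually_elim (use M in \<open>auto simp: Z_def w_def aE E_def\<close>)
qed

subsection \<open>Transport on the line\<close>

abbreviation std_normal_cdf :: "real \<Rightarrow> real" where
  "std_normal_cdf \<equiv> antideriv std_normal_density"

lemma isCont_std_normal_density: "isCont std_normal_density x"
  unfolding std_normal_density_def by (intro continuous_intros) auto

lemma integrable_std_normal_density: "integrable lborel std_normal_density"
  by (rule integrable_normal_density) simp

lemma std_normal_cdf_has_derivative:
  "(std_normal_cdf has_real_derivative std_normal_density s) (at s)"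
  by (rule antideriv_has_derivative[OF integrable_std_normal_density isCont_std_normal_density])

lemma std_normal_cdf_strict_mono: "a < b \<Longrightarrow> std_normal_cdf a < std_normal_cdf b"
  by (rule DERIV_pos_imp_increasing)
    (assumption, intro exI conjI, rule std_normal_cdf_has_derivative, rule normal_density_pos, simp)

lemma std_normal_cdf_less_iff [simp]: "std_normal_cdf a < std_normal_cdf b \<longleftrightarrow> a < b"
  using std_normal_cdf_strict_mono[of a b] std_normal_cdf_strict_mono[of b a]
  by (cases a b rule: linorder_cases) auto

lemma std_normal_cdf_le_iff [simp]: "std_normal_cdf a \<le> std_normal_cdf b \<longleftrightarrow> a \<le> b"
  by (meson not_le std_normal_cdf_less_iff)

lemma std_normal_cdf_eq_iff [simp]: "std_normal_cdf a = std_normal_cdf b \<longleftrightarrow> a = b"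
  by (metis less_irrefl linorder_neqE_linordered_idom std_normal_cdf_less_iff)

lemma std_normal_cdf_at_top: "(std_normal_cdf \<longlongrightarrow> 1) at_top"
  using antideriv_tendsto_at_top[OF integrable_std_normal_density] by (simp add: integral_normal_density)

lemma std_normal_cdf_at_bot: "(std_normal_cdf \<longlongrightarrow> 0) at_bot"
  using antideriv_tendsto_at_bot[OF integrable_std_normal_density] .

lemma antideriv_nonneg: "AE t in lborel. 0 \<le> D t \<Longrightarrow> 0 \<le> antideriv D s"
  unfolding antideriv_def by (rule integral_nonneg_AE) (elim eventually_mono, simp add: indicator_def)

lemma antideriv_le_integral: 
  assumes "integrable lborel D" "AE t in lborel. 0 \<le> D t"
  shows "antideriv D s \<le> integral\<^sup>L lborel D"
  unfolding antideriv_def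
proof (rule integral_mono_AE)
  show "AE x in lborel. indicator {..s} x * D x \<le> D x"
    using assms(2) by eventually_elim (simp add: indicator_def)
qed (use assms in \<open>auto intro!: integrable_indicator_mult\<close>)

lemma std_normal_cdf_gt_0: "0 < std_normal_cdf s"
  by (rule le_less_trans[OF antideriv_nonneg[of std_normal_density "s - 1"]]) auto

lemma std_normal_cdf_lt_1: "std_normal_cdf s < 1"
proof -
  have "std_normal_cdf s < std_normal_cdf (s + 1)" by (rule std_normal_cdf_strict_mono) simp
  also have "\<dots> \<le> 1"
    using antideriv_le_integral[OF integrable_std_normal_density, of "s + 1"]
    by (simp add: integral_normal_density)
  finally show ?thesis .
qed

lemma IVT_between_limits:
  fixes F :: "real \<Rightarrow> real"
  assumes "\<And>x. isCont F x" "(F \<longlongrightarrow> l) at_bot" "(F \<longlongrightarrow> u) at_top" "l < p" "p < u"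
  obtains b where "F b = p"
proof -
  have "eventually (\<lambda>x. F x < p) at_bot" using assms by (intro order_tendstoD) auto
  then obtain a where a: "\<And>x. x \<le> a \<Longrightarrow> F x < p" by (auto simp: eventually_at_bot_linorder)
  have "eventually (\<lambda>x. p < F x) at_top" using assms by (intro order_tendstoD) auto
  then obtain c where c: "\<And>x. x \<ge> c \<Longrightarrow> p < F x" by (auto simp: eventually_at_top_linorder)
  have "\<exists>b\<ge>a. b \<le> max a c \<and> F b = p"
    using a[of a] c[of "max a c"] assms(1) by (intro IVT) auto
  then show ?thesis using that by blast
qed

text \<open>The value 0 off the open unit interval is a mere default: a density gives no mass to the
  points where its distribution function is 0 or 1, see \<open>F_strict_AE\<close>.\<close>

definition std_normal_quantile :: "real \<Rightarrow> real" where
  "std_normal_quantile p = (if 0 < p \<and> p < 1 then THE t. std_normal_cdf t = p else 0)"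

lemma std_normal_quantile_cdf [simp]: "std_normal_quantile (std_normal_cdf t) = t"
  using std_normal_cdf_gt_0 std_normal_cdf_lt_1 by (simp add: std_normal_quantile_def)

lemma std_normal_cdf_quantile [simp]:
  assumes "0 < p" "p < 1" shows "std_normal_cdf (std_normal_quantile p) = p"
proof -
  obtain t where "std_normal_cdf t = p"
    using IVT_between_limits[OF continuous_antideriv[OF integrable_std_normal_density]
        std_normal_cdf_at_bot std_normal_cdf_at_top assms] by blast
  then show ?thesis by (metis std_normal_quantile_cdf)
qed

lemma std_normal_quantile_le_iff:
  assumes "0 < p" "p < 1"
  shows "std_normal_quantile p \<le> t \<longleftrightarrow> p \<le> std_normal_cdf t"
  using assms std_normal_cdf_le_iff[of "std_normal_quantile p" t] by simp

lemma std_normal_quantile_measurable [measurable]: "std_normal_quantile \<in> borel_measurable borel"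
proof -
  have [measurable]: "{0<..<1::real} \<in> sets borel" by simp
  show ?thesis
    unfolding borel_measurable_iff_le
  proof
    fix t
    \<comment> \<open>Within the unit interval the sublevel set is cut out by
      \<open>std_normal_cdf t\<close>; the points outside, with their default value 0, belong to it
      exactly when 0 \<le> t.\<close>
    have "{p. std_normal_quantile p \<le> t} =
      ({0<..<1} \<inter> {..std_normal_cdf t}) \<union> (if 0 \<le> t then - {0<..<1} else {})"
      using std_normal_quantile_le_iff by (auto simp: std_normal_quantile_def)
    then show "{p \<in> space borel. std_normal_quantile p \<le> t} \<in> sets borel" by auto
  qed
qed

lemma std_normal_quantile_has_derivative:
  assumes "0 < p" "p < 1"
  shows "(std_normal_quantile has_real_derivative inverse (std_normal_density (std_normal_quantile p))) (at p)"
proof (rule DERIV_inverse_function[where a=0 and b=1])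
  show "(std_normal_cdf has_real_derivative std_normal_density (std_normal_quantile p)) (at (std_normal_quantile p))"
    by (rule std_normal_cdf_has_derivative)
  show "std_normal_density (std_normal_quantile p) \<noteq> 0"
    using normal_density_pos[of 1 0 "std_normal_quantile p"] by simp
  let ?t = "std_normal_quantile p"
  \<comment> \<open>The inverse of a continuous injective function is continuous at interior points;
    the radius 1 around \<open>?t\<close> is arbitrary.\<close>
  have "isCont std_normal_quantile (std_normal_cdf ?t)"
    by (rule isCont_inverse_function2[where a="?t - 1" and b="?t + 1"])
       (auto intro: continuous_antideriv integrable_std_normal_density)
  then show "isCont std_normal_quantile p" using assms by simp
qed (use assms in auto)

section \<open>Monotone rearrangement of a density on the line\<close>

text \<open>\<open>w\<close> agrees with \<open>antideriv D\<close> only almost everywhere. The sign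
  at every point follows because \<open>antideriv D\<close> is continuous, hence everywhere the
  derivative of the nondecreasing function \<open>antideriv w\<close>.\<close>

lemma antideriv_nonneg_if_AE_eq:
  assumes w_nonneg: "\<And>s. 0 \<le> w s" and w_int: "integrable lborel w"
    and D_int: "integrable lborel D" and w_eq: "AE s in lborel. w s = antideriv D s"
  shows "0 \<le> antideriv D s"
proof (rule ccontr)
  have a_int: "integrable lborel (antideriv D)"
    using antideriv_measurable[OF D_int] w_int w_eq
    by (subst integrable_cong_AE[where g=w]) auto
  have eq: "antideriv (antideriv D) = antideriv w"
  proof
    show "antideriv (antideriv D) s = antideriv w s" for s
      using w_eq antideriv_measurable[OF D_int] w_int by (intro antideriv_cong_AE) auto
  qed
  have deriv: "(antideriv w has_real_derivative antideriv D s) (at s)"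
    using antideriv_has_derivative[OF a_int continuous_antideriv[OF D_int]] by (simp add: eq)
  assume "\<not> 0 \<le> antideriv D s"
  then have "antideriv D s < 0" by simp
  from DERIV_neg_dec_right[OF deriv this] obtain d
    where "d > 0" "\<forall>h>0. h < d \<longrightarrow> antideriv w (s + h) < antideriv w s"
    by blast
  then have "antideriv w (s + d / 2) < antideriv w s" by simp
  then show False using antideriv_mono[OF w_int, of s "s + d/2"] w_nonneg \<open>d > 0\<close> by simp
qed

text \<open>Transport maps are uncontrolled where the density vanishes; this lemma removes the zero
  set from every integral of \<open>D\<close> against such a map.\<close>

lemma density_zero_imp_deriv_zero:
  assumes w_nonneg: "\<And>s. 0 \<le> w s" and w_int: "integrable lborel w"
    and D_int: "integrable lborel D" and w_eq: "AE s in lborel. w s = antideriv D s"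
  shows "AE s in lborel. w s = 0 \<longrightarrow> D s = 0"
  using deriv_eq_0_on_zeros[OF D_int antideriv_nonneg_if_AE_eq[OF assms]] w_eq
  by eventually_elim simp

text \<open>A model of one fibre of a joint density. Fibres are not normalised, so their mass
  \<open>c\<close> is carried along. \<open>w_eq\<close> is absolute continuity, imposed up to a
  null set because a weakly differentiable function is determined only so far. The map
  \<open>T\<close> below is the increasing rearrangement of \<open>w / c\<close> onto the standard
  normal law.\<close>

locale line_density =
  fixes w D :: "real \<Rightarrow> real" and c :: real
  assumes w_nonneg: "\<And>s. 0 \<le> w s"
    and w_int: "integrable lborel w"
    and D_int: "integrable lborel D"
    and w_eq: "AE s in lborel. w s = antideriv D s"
    and c_eq: "c = integral\<^sup>L lborel w"
    and c_pos: "0 < c"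
begin

definition F :: "real \<Rightarrow> real" where "F s = antideriv w s / c"
definition T :: "real \<Rightarrow> real" where "T s = std_normal_quantile (F s)"

lemma meas [measurable]: "w \<in> borel_measurable borel" "D \<in> borel_measurable borel"
  using w_int D_int by simp_all

lemma a_int: "integrable lborel (antideriv D)"
  using antideriv_measurable[OF D_int] w_int w_eq
  by (subst integrable_cong_AE[where g=w]) auto

lemma antideriv_w: "antideriv w = antideriv (antideriv D)"
proof
  show "antideriv w s = antideriv (antideriv D) s" for s
    using w_eq antideriv_measurable[OF D_int] by (intro antideriv_cong_AE) auto
qed

lemma D_total: "integral\<^sup>L lborel D = 0"
  using integral_eq_0_if_antideriv_integrable[OF D_int a_int] .

text \<open>With the continuous representative \<open>antideriv D\<close> in place of
  \<open>w\<close>, the distribution function is differentiable at every point, so the classical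
  chain rule and fundamental theorem become available for \<open>T\<close>.\<close>

lemma F_deriv: "(F has_real_derivative antideriv D s / c) (at s)"
  unfolding F_def[abs_def] antideriv_w
  by (intro DERIV_cdivide antideriv_has_derivative[OF a_int continuous_antideriv[OF D_int]])

lemma F_cont: "isCont F s"
  using F_deriv by (rule DERIV_isCont)

lemma F_measurable [measurable]: "F \<in> borel_measurable borel"
  unfolding F_def[abs_def] using antideriv_measurable[OF w_int] by simp

lemma T_measurable [measurable]: "T \<in> borel_measurable borel"
  unfolding T_def[abs_def] by measurable

lemma F_mono: "a \<le> b \<Longrightarrow> F a \<le> F b"
  unfolding F_def using antideriv_mono[OF w_int, of a b] w_nonneg c_pos by (simp add: divide_right_mono)

lemma F_nonneg: "0 \<le> F s" and F_le_1: "F s \<le> 1"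
  unfolding F_def using antideriv_nonneg[of w s] antideriv_le_integral[OF w_int, of s] w_nonneg c_pos c_eq by auto

lemma F_at_bot: "(F \<longlongrightarrow> 0) at_bot"
  unfolding F_def[abs_def] using antideriv_tendsto_at_bot[OF w_int] c_pos by (auto intro!: tendsto_eq_intros)

lemma F_at_top: "(F \<longlongrightarrow> 1) at_top"
  unfolding F_def[abs_def] using antideriv_tendsto_at_top[OF w_int] c_pos c_eq
  by (auto intro!: tendsto_eq_intros)

lemma a_nonneg: "0 \<le> antideriv D s"
  using antideriv_nonneg_if_AE_eq w_nonneg w_int D_int w_eq by blast

text \<open>A positive derivative makes \<open>F\<close> increase strictly across \<open>s\<close>,
  so \<open>F s\<close> is neither the smallest nor the largest value of \<open>F\<close>.\<close>

lemma F_strict: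
  assumes "0 < antideriv D s" shows "0 < F s" "F s < 1"
proof -
  have pos: "antideriv D s / c > 0" using c_pos assms by simp
  obtain d where "d > 0" "\<forall>h>0. h < d \<longrightarrow> F s < F (s + h)"
    using DERIV_pos_inc_right[OF F_deriv pos] by blast
  then have "F s < F (s + d / 2)" by simp
  then show "F s < 1" using F_le_1[of "s + d/2"] by simp
  obtain d where "d > 0" "\<forall>h>0. h < d \<longrightarrow> F (s - h) < F s"
    using DERIV_pos_inc_left[OF F_deriv pos] by blast
  then have "F (s - d / 2) < F s" by simp
  then show "0 < F s" using F_nonneg[of "s - d/2"] by simp
qed

lemma D_zero: "AE s in lborel. w s = 0 \<longrightarrow> D s = 0"
  by (rule density_zero_imp_deriv_zero[OF w_nonneg w_int D_int w_eq])

lemma F_strict_AE: "AE s in lborel. w s \<noteq> 0 \<longrightarrow> 0 < F s \<and> F s < 1"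
  using w_eq by eventually_elim (use F_strict a_nonneg in \<open>auto simp: less_le\<close>)

text \<open>The one-dimensional Jacobian equation: the derivative of \<open>T\<close> times the
  normal density at \<open>T s\<close> is the normalised density at \<open>s\<close>.\<close>

lemma T_deriv:
  assumes "0 < F s" "F s < 1"
  shows "(T has_real_derivative antideriv D s / (c * std_normal_density (T s))) (at s)"
proof -
  have "(T has_real_derivative inverse (std_normal_density (std_normal_quantile (F s))) * (antideriv D s / c)) (at s)"
    unfolding T_def[abs_def]
    by (rule DERIV_chain2[OF std_normal_quantile_has_derivative[OF assms] F_deriv])
  then show ?thesis by (simp add: T_def divide_inverse mult_ac)
qed

text \<open>By monotonicity the strict bounds at the end points keep \<open>F\<close> inside the
  open unit interval on all of \<open>[a, b]\<close>, so \<open>T\<close> is differentiable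
  throughout, even at zeros of \<open>w\<close> in between.\<close>

lemma nn_integral_T_deriv:
  assumes "0 < F a" "F b < 1" "a \<le> b"
  shows "(\<integral>\<^sup>+s. ennreal (w s / (c * std_normal_density (T s))) * indicator {a..b} s \<partial>lborel) = ennreal (T b - T a)"
    and "T a \<le> T b"
proof -
  have *: "0 < F s" "F s < 1" if "s \<in> {a..b}" for s
    using F_mono[of a s] F_mono[of s b] that assms by auto
  have "(\<integral>\<^sup>+s. ennreal (w s / (c * std_normal_density (T s))) * indicator {a..b} s \<partial>lborel)
     = (\<integral>\<^sup>+s. ennreal (antideriv D s / (c * std_normal_density (T s))) * indicator {a..b} s \<partial>lborel)"
    using w_eq by (intro nn_integral_cong_AE) (elim eventually_mono, simp)
  also have "\<dots> = ennreal (T b - T a)"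
    using antideriv_measurable[OF D_int] * c_pos a_nonneg assms(3)
    by (intro nn_integral_FTC_Icc) (auto intro!: T_deriv divide_nonneg_nonneg mult_nonneg_nonneg)
  finally show "(\<integral>\<^sup>+s. ennreal (w s / (c * std_normal_density (T s))) * indicator {a..b} s \<partial>lborel) = ennreal (T b - T a)" .
  show "T a \<le> T b"
  proof -
    have "std_normal_cdf (T a) \<le> std_normal_cdf (T b)"
      using *[of a] *[of b] assms F_mono[of a b] by (simp add: T_def)
    then show ?thesis by simp
  qed
qed

lemma by_parts:
  assumes DT: "integrable lborel (\<lambda>t. D t * T t)"
  shows "integrable lborel (\<lambda>s. w s * (w s / (c * std_normal_density (T s))))"
    and "(\<integral>s. w s * (w s / (c * std_normal_density (T s))) \<partial>lborel) = - (\<integral>t. D t * T t \<partial>lborel)"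
proof -
  \<comment> \<open>The base point is mapped to the normal median: \<open>T m = 0\<close>, so
    integrating the derivative of \<open>T\<close> from \<open>m\<close> yields \<open>T\<close>
    itself without a constant.\<close>
  obtain m where m: "F m = std_normal_cdf 0"
    using IVT_between_limits[OF F_cont F_at_bot F_at_top std_normal_cdf_gt_0 std_normal_cdf_lt_1] by blast
  have Tm: "T m = 0" by (simp add: T_def m)
  have Fm: "0 < F m" "F m < 1" using m std_normal_cdf_gt_0[of 0] std_normal_cdf_lt_1[of 0] by auto
  \<comment> \<open>Almost everywhere, a nonzero \<open>D t\<close> forces a nonzero
    \<open>w t\<close> and thus \<open>0 < F t < 1\<close>. With the same bounds at
    \<open>m\<close>, the whole interval between \<open>m\<close> and \<open>t\<close> is covered by
    \<open>nn_integral_T_deriv\<close>.\<close>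
  have *: "AE t in lborel. D t \<noteq> 0 \<longrightarrow>
       (m \<le> t \<longrightarrow> 0 \<le> T t \<and> (\<integral>\<^sup>+s. ennreal (w s / (c * std_normal_density (T s))) * indicator {m..t} s \<partial>lborel) = ennreal (T t)) \<and>
       (t \<le> m \<longrightarrow> T t \<le> 0 \<and> (\<integral>\<^sup>+s. ennreal (w s / (c * std_normal_density (T s))) * indicator {t..m} s \<partial>lborel) = ennreal (- T t))"
    using F_strict_AE D_zero
  proof eventually_elim
    case (elim t)
    then show ?case
      using nn_integral_T_deriv[of m t] nn_integral_T_deriv[of t m] Fm Tm by auto
  qed
  have d0: "0 \<le> w s / (c * std_normal_density (T s))" for s
    using w_nonneg c_pos by (intro divide_nonneg_nonneg mult_nonneg_nonneg) auto
  have dm: "(\<lambda>s. w s / (c * std_normal_density (T s))) \<in> borel_measurable borel" by measurable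
  note R = integral_by_parts_Fubini[OF D_int D_total meas(1) w_eq dm d0 DT *]
  show "integrable lborel (\<lambda>s. w s * (w s / (c * std_normal_density (T s))))" by (rule R(1))
  show "(\<integral>s. w s * (w s / (c * std_normal_density (T s))) \<partial>lborel) = - (\<integral>t. D t * T t \<partial>lborel)"
    by (rule R(2))
qed

text \<open>The same double integral with \<open>d = 1\<close>, \<open>S t = t\<close> and base
  point 0.\<close>

lemma by_parts_id:
  assumes "integrable lborel (\<lambda>t. D t * t)"
  shows "(\<integral>t. D t * t \<partial>lborel) = - c"
proof -
  have "(\<integral>s. w s * 1 \<partial>lborel) = - (\<integral>t. D t * t \<partial>lborel)"
    by (rule integral_by_parts_Fubini(2)[OF D_int D_total meas(1) w_eq _ _ assms, where m=0]) auto
  then show ?thesis by (simp add: c_eq)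
qed

text \<open>Laws are compared through distribution functions: up to a null set, \<open>T s\<close>
  is at most \<open>t\<close> exactly when \<open>F s\<close> is at most
  \<open>std_normal_cdf t\<close>. An arbitrary \<open>h\<close> and the mass \<open>c\<close> as a
  factor put the identity into a form that can be integrated over fibres.\<close>

lemma law:
  assumes h [measurable]: "h \<in> borel_measurable borel"
  shows "(\<integral>\<^sup>+s. ennreal (w s) * h (T s) \<partial>lborel) = ennreal c * (\<integral>\<^sup>+z. ennreal (std_normal_density z) * h z \<partial>lborel)"
proof -
  define M where "M = density lborel (\<lambda>s. ennreal (w s / c))"
  define N where "N = density lborel (\<lambda>s. ennreal (std_normal_density s))"
  have sM[measurable_cong]: "sets M = sets borel" and sN[measurable_cong]: "sets N = sets borel" 
    by (simp_all add: M_def N_def)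
  have ent: "(\<integral>\<^sup>+ s. ennreal (w s / c) * indicator {..b} s \<partial>lborel) = ennreal (F b)" for b
  proof -
    have "(\<integral>\<^sup>+ s. ennreal (w s / c) * indicator {..b} s \<partial>lborel) = (\<integral>\<^sup>+ s. ennreal (indicator {..b} s * w s / c) \<partial>lborel)"
      by (intro nn_integral_cong) (simp add: indicator_def)
    also have "\<dots> = ennreal (\<integral>s. indicator {..b} s * w s / c \<partial>lborel)"
      using w_int w_nonneg c_pos by (intro nn_integral_eq_integral) auto
    finally show ?thesis by (simp add: F_def antideriv_def)
  qed
  have "emeasure M (space M) = (\<integral>\<^sup>+ s. ennreal (w s / c) \<partial>lborel)"
    by (simp add: M_def emeasure_density)
  also have "\<dots> = ennreal (\<integral>s. w s / c \<partial>lborel)"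
    by (rule nn_integral_eq_integral) (use w_int w_nonneg c_pos in auto)
  also have "\<dots> = 1" using c_pos by (simp flip: c_eq)
  finally have pM: "prob_space M" by (rule prob_spaceI)
  have pN: "prob_space N" unfolding N_def by (rule prob_space_normal_density) simp
  interpret M: prob_space M by fact
  interpret N: prob_space N by fact
  have mM: "measure M {..b} = F b" for b
    using ent[of b] F_nonneg by (simp add: measure_def M_def emeasure_density)
  have UM: "AE s in M. 0 < F s \<and> F s < 1"
    unfolding M_def using F_strict_AE c_pos
    by (subst AE_density) (simp, elim eventually_mono, auto)
  have "distr M borel T = N"
  proof (rule cdf_unique)
    show "real_distribution (distr M borel T)"
      by (intro real_distribution.intro M.prob_space_distr real_distribution_axioms.intro) auto
    show "real_distribution N"
      by (intro real_distribution.intro pN real_distribution_axioms.intro) (auto simp: N_def)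
    show "cdf (distr M borel T) = cdf N"
    proof
      fix t
      define p where "p = std_normal_cdf t"
      have p: "0 < p" "p < 1" unfolding p_def using std_normal_cdf_gt_0 std_normal_cdf_lt_1 by auto
      obtain b0 where b0: "F b0 = p" using IVT_between_limits[OF F_cont F_at_bot F_at_top p] by blast
      have ne: "{s. F s \<le> p} \<noteq> {}" using b0 by auto
      have "eventually (\<lambda>x. p < F x) at_top" using F_at_top p by (intro order_tendstoD) auto
      then obtain r where r: "\<And>x. x \<ge> r \<Longrightarrow> p < F x" by (auto simp: eventually_at_top_linorder)
      have bdd: "bdd_above {s. F s \<le> p}"
        by (rule bdd_aboveI[of _ r]) (meson linear mem_Collect_eq not_le r)
      have cl: "closed {s. F s \<le> p}"
        using F_cont by (intro closed_Collect_le) (auto intro: continuous_at_imp_continuous_on)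
      \<comment> \<open>\<open>F\<close> may be constant on intervals where the density vanishes, so
        its sublevel set is described by the largest element; closedness and monotonicity then give
        \<open>F b = p\<close>.\<close>
      define b where "b = Sup {s. F s \<le> p}"
      have Fb: "F b \<le> p" using closed_contains_Sup[OF ne bdd cl] by (simp add: b_def)
      have set: "{s. F s \<le> p} = {..b}"
      proof (intro set_eqI iffI)
        fix s assume "s \<in> {s. F s \<le> p}" then show "s \<in> {..b}" unfolding b_def using bdd by (auto intro: cSup_upper)
      next
        fix s assume "s \<in> {..b}" then show "s \<in> {s. F s \<le> p}" using F_mono[of s b] Fb by auto
      qed
      have "b0 \<le> b" using set b0 by auto
      then have Fb: "F b = p" using F_mono[of b0 b] b0 Fb by simp
      have "cdf (distr M borel T) t = measure M (T -` {..t} \<inter> space M)"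
        by (simp add: cdf_def measure_distr)
      also have "\<dots> = measure M {s. F s \<le> p}"
      proof (rule M.finite_measure_eq_AE)
        show "AE x in M. (x \<in> T -` {..t} \<inter> space M) = (x \<in> {s. F s \<le> p})"
          using UM AE_space
          by eventually_elim (auto simp: T_def p_def std_normal_quantile_le_iff)
      qed (auto simp: sM set)
      also have "\<dots> = p" by (simp add: set mM Fb)
      also have "p = cdf N t"
      proof -
        have "emeasure N {..t} = (\<integral>\<^sup>+ s. ennreal (indicator {..t} s * std_normal_density s) \<partial>lborel)"
          unfolding N_def by (subst emeasure_density) (auto intro!: nn_integral_cong simp: indicator_def)
        also have "\<dots> = ennreal p"
          unfolding p_def antideriv_def
          by (intro nn_integral_eq_integral integrable_indicator_mult integrable_std_normal_density) auto
        finally show ?thesis using p by (simp add: cdf_def measure_def)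
      qed
      finally show "cdf (distr M borel T) t = cdf N t" .
    qed
  qed
  then have "(\<integral>\<^sup>+z. h z \<partial>N) = (\<integral>\<^sup>+z. h z \<partial>distr M borel T)" by simp
  also have "\<dots> = (\<integral>\<^sup>+s. h (T s) \<partial>M)" by (rule nn_integral_distr) auto
  also have "\<dots> = (\<integral>\<^sup>+s. ennreal (w s / c) * h (T s) \<partial>lborel)"
    unfolding M_def by (rule nn_integral_density) auto
  finally have "ennreal c * (\<integral>\<^sup>+z. h z \<partial>N) = (\<integral>\<^sup>+s. ennreal c * (ennreal (w s / c) * h (T s)) \<partial>lborel)"
    by (simp add: nn_integral_cmult)
  also have "\<dots> = (\<integral>\<^sup>+s. ennreal (w s) * h (T s) \<partial>lborel)"
    using c_pos w_nonneg by (intro nn_integral_cong) (simp add: mult.assoc[symmetric] ennreal_mult[symmetric])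
  finally show ?thesis unfolding N_def by (simp add: nn_integral_density)
qed

end

subsection \<open>Transport along fibres\<close>

text \<open>\<open>N\<close> carries the variables already treated and \<open>lborel\<close> the new
  one. Regularity is demanded in the new variable only; almost every fibre of nonzero mass is a
  \<open>line_density\<close>.\<close>

locale fibre_density = N: sigma_finite_measure N for N :: "'b measure" +
  fixes g D :: "'b \<times> real \<Rightarrow> real"
  assumes g_nonneg: "\<And>z. 0 \<le> g z"
    and g_int: "integrable (N \<Otimes>\<^sub>M lborel) g"
    and D_int: "integrable (N \<Otimes>\<^sub>M lborel) D"
    and g_eq: "AE z in N \<Otimes>\<^sub>M lborel. g z = antideriv (\<lambda>t. D (fst z, t)) (snd z)"
begin

sublocale NL: pair_sigma_finite N lborel ..

lemma meas [measurable]: "g \<in> borel_measurable (N \<Otimes>\<^sub>M borel)" "D \<in> borel_measurable (N \<Otimes>\<^sub>M borel)"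
  using borel_measurable_integrable[OF g_int] borel_measurable_integrable[OF D_int] by simp_all

definition gbar :: "'b \<Rightarrow> real" where "gbar x = (\<integral>s. g (x, s) \<partial>lborel)"

text \<open>The formula of \<open>line_density.T\<close> written out, so that the map is defined and
  jointly measurable on all fibres, including those of zero mass.\<close>

definition T :: "'b \<times> real \<Rightarrow> real" where
  "T z = std_normal_quantile (antideriv (\<lambda>t. g (fst z, t)) (snd z) / gbar (fst z))"

lemma gbar_measurable [measurable]: "gbar \<in> borel_measurable N"
  unfolding gbar_def[abs_def] by measurable

lemma gbar_nonneg: "0 \<le> gbar x"
  unfolding gbar_def by (intro Bochner_Integration.integral_nonneg g_nonneg)

lemma gbar_int: "integrable N gbar"
  unfolding gbar_def[abs_def] using NL.integrable_fst[of "\<lambda>x s. g (x, s)"] g_int by simp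

lemma T_measurable [measurable]: "T \<in> borel_measurable (N \<Otimes>\<^sub>M borel)"
proof -
  \<comment> \<open>Writing the indicator as a condition on \<open>t\<close> and
    \<open>snd z\<close> together displays the antiderivative as a jointly measurable parameter
    integral.\<close>
  have "(\<lambda>z. antideriv (\<lambda>t. g (fst z, t)) (snd z)) =
     (\<lambda>z. \<integral>t. (if t \<le> snd z then 1 else 0) * g (fst z, t) \<partial>lborel)"
    unfolding antideriv_def by (intro ext Bochner_Integration.integral_cong) (auto simp: indicator_def)
  moreover have "\<dots> \<in> borel_measurable (N \<Otimes>\<^sub>M borel)" by measurable
  ultimately have [measurable]: "(\<lambda>z. antideriv (\<lambda>t. g (fst z, t)) (snd z)) \<in> borel_measurable (N \<Otimes>\<^sub>M borel)"
    by simp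
  show ?thesis unfolding T_def[abs_def] by measurable
qed

lemma slices:
  "AE x in N. integrable lborel (\<lambda>s. g (x, s)) \<and> integrable lborel (\<lambda>s. D (x, s)) \<and>
     (AE s in lborel. g (x, s) = antideriv (\<lambda>t. D (x, t)) s)"
proof -
  have "AE x in N. integrable lborel (\<lambda>s. g (x, s))"
    using NL.AE_integrable_fst'[OF g_int] by simp
  moreover have "AE x in N. integrable lborel (\<lambda>s. D (x, s))"
    using NL.AE_integrable_fst'[OF D_int] by simp
  moreover have "AE x in N. AE s in lborel. g (x, s) = antideriv (\<lambda>t. D (x, t)) s"
    using NL.AE_pair[OF g_eq] by simp
  ultimately show ?thesis by eventually_elim simp
qed

lemma slices_zero: "AE x in N. AE s in lborel. g (x, s) = 0 \<longrightarrow> D (x, s) = 0"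
  using slices
proof eventually_elim
  case (elim x)
  show ?case using elim g_nonneg by (intro density_zero_imp_deriv_zero) auto
qed

lemma D_zero: "AE z in N \<Otimes>\<^sub>M lborel. g z = 0 \<longrightarrow> D z = 0"
proof (rule NL.AE_pair_measure)
  show "{z \<in> space (N \<Otimes>\<^sub>M lborel). g z = 0 \<longrightarrow> D z = 0} \<in> sets (N \<Otimes>\<^sub>M lborel)" by measurable
qed (rule slices_zero)

lemma slice_density:
  assumes "gbar x \<noteq> 0" "integrable lborel (\<lambda>s. g (x, s)) \<and> integrable lborel (\<lambda>s. D (x, s)) \<and>
     (AE s in lborel. g (x, s) = antideriv (\<lambda>t. D (x, t)) s)"
  shows "line_density (\<lambda>s. g (x, s)) (\<lambda>s. D (x, s)) (gbar x)"
    and "line_density.T (\<lambda>s. g (x, s)) (gbar x) = (\<lambda>s. T (x, s))"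
proof -
  show *: "line_density (\<lambda>s. g (x, s)) (\<lambda>s. D (x, s)) (gbar x)"
    using assms g_nonneg gbar_nonneg[of x] by unfold_locales (auto simp: gbar_def[symmetric])
  show "line_density.T (\<lambda>s. g (x, s)) (gbar x) = (\<lambda>s. T (x, s))"
    unfolding line_density.T_def[OF *] line_density.F_def[OF *] T_def by simp
qed

lemma slice_zero_AE:
  assumes "gbar x = 0" "integrable lborel (\<lambda>s. g (x, s))"
  shows "AE s in lborel. g (x, s) = 0"
  using assms g_nonneg by (subst (asm) (1) gbar_def, subst (asm) integral_nonneg_eq_0_iff_AE) auto

text \<open>Given the base point \<open>x\<close>, the transported coordinate is standard normal
  whatever \<open>x\<close> is. Integrating this over the base gives the product structure on which
  the induction over coordinates relies.\<close>

lemma law: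
  assumes [measurable]: "h \<in> borel_measurable (N \<Otimes>\<^sub>M borel)"
  shows "(\<integral>\<^sup>+z. ennreal (g z) * h (fst z, T z) \<partial>(N \<Otimes>\<^sub>M lborel)) =
    (\<integral>\<^sup>+x. ennreal (gbar x) * (\<integral>\<^sup>+u. ennreal (std_normal_density u) * h (x, u) \<partial>lborel) \<partial>N)"
proof -
  have "(\<integral>\<^sup>+z. ennreal (g z) * h (fst z, T z) \<partial>(N \<Otimes>\<^sub>M lborel)) =
     (\<integral>\<^sup>+x. (\<integral>\<^sup>+s. ennreal (g (x, s)) * h (x, T (x, s)) \<partial>lborel) \<partial>N)"
    by (subst lborel.nn_integral_fst[symmetric]) auto
  also have "\<dots> = (\<integral>\<^sup>+x. ennreal (gbar x) * (\<integral>\<^sup>+u. ennreal (std_normal_density u) * h (x, u) \<partial>lborel) \<partial>N)"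
  proof (rule nn_integral_cong_AE)
    show "AE x in N. (\<integral>\<^sup>+s. ennreal (g (x, s)) * h (x, T (x, s)) \<partial>lborel) = ennreal (gbar x) * (\<integral>\<^sup>+u. ennreal (std_normal_density u) * h (x, u) \<partial>lborel)"
      using slices AE_space
    proof eventually_elim
      case (elim x)
      have [measurable]: "(\<lambda>u. h (x, u)) \<in> borel_measurable borel" using elim(2) by measurable
      show ?case
      proof (cases "gbar x = 0")
        case True
        then have "AE s in lborel. ennreal (g (x, s)) * h (x, T (x, s)) = 0"
          using slice_zero_AE[of x] elim(1) by (auto elim!: AE_mp)
        then have "(\<integral>\<^sup>+s. ennreal (g (x, s)) * h (x, T (x, s)) \<partial>lborel) = (\<integral>\<^sup>+(s::real). 0 \<partial>lborel)"
          by (rule nn_integral_cong_AE)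
        then show ?thesis using True by simp
      next
        case False
        note sd = slice_density[OF False elim(1)]
        show ?thesis
          using line_density.law[OF sd(1), of "\<lambda>u. h (x, u)"] by (simp add: sd(2))
      qed
    qed
  qed
  finally show ?thesis .
qed

lemma by_parts_id:
  assumes int: "integrable (N \<Otimes>\<^sub>M lborel) (\<lambda>z. D z * snd z)"
  shows "(\<integral>z. D z * snd z \<partial>(N \<Otimes>\<^sub>M lborel)) = - (\<integral>z. g z \<partial>(N \<Otimes>\<^sub>M lborel))"
proof -
  have "(\<integral>z. D z * snd z \<partial>(N \<Otimes>\<^sub>M lborel)) = (\<integral>x. (\<integral>t. D (x, t) * t \<partial>lborel) \<partial>N)"
    using NL.integral_fst'[OF int] by simp
  also have "\<dots> = (\<integral>x. - gbar x \<partial>N)"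
  proof (rule integral_cong_AE)
    have "AE x in N. integrable lborel (\<lambda>t. D (x, t) * t)"
      using NL.AE_integrable_fst'[OF int] by simp
    then show "AE x in N. (\<integral>t. D (x, t) * t \<partial>lborel) = - gbar x"
      using slices slices_zero
    proof eventually_elim
      case (elim x)
      show ?case
      proof (cases "gbar x = 0")
        case True
        have "AE t in lborel. D (x, t) * t = 0"
          using slice_zero_AE[OF True] elim by auto
        then have "(\<integral>t. D (x, t) * t \<partial>lborel) = 0" by (rule integral_eq_zero_AE)
        then show ?thesis using True by simp
      next
        case False
        show ?thesis
          using line_density.by_parts_id[OF slice_density(1)[OF False elim(2)] elim(1)] .
      qed
    qed
  qed measurable
  also have "\<dots> = - (\<integral>x. gbar x \<partial>N)" by simp
  also have "(\<integral>x. gbar x \<partial>N) = (\<integral>z. g z \<partial>(N \<Otimes>\<^sub>M lborel))"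
    unfolding gbar_def using NL.integral_fst'[OF g_int] by simp
  finally show ?thesis .
qed

text \<open>The partial derivative of \<open>T\<close> in the new variable, defined through the
  Jacobian equation so that it is nonnegative and measurable everywhere.\<close>

definition dT :: "'b \<times> real \<Rightarrow> real" where
  "dT z = g z / (gbar (fst z) * std_normal_density (T z))"

lemma dT_measurable [measurable]: "dT \<in> borel_measurable (N \<Otimes>\<^sub>M borel)"
  unfolding dT_def[abs_def] by measurable

lemma dT_nonneg: "0 \<le> dT z"
  unfolding dT_def using g_nonneg gbar_nonneg by (intro divide_nonneg_nonneg mult_nonneg_nonneg) auto

text \<open>On almost every fibre the one-dimensional formula applies, or the fibre has mass zero
  and both integrals vanish. Since \<open>g * dT\<close> is nonnegative, its absolute fibre integral
  equals its integral, so integrability over the product is inherited from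
  \<open>D * T\<close>.\<close>

lemma by_parts:
  assumes int: "integrable (N \<Otimes>\<^sub>M lborel) (\<lambda>z. D z * T z)"
  shows "integrable (N \<Otimes>\<^sub>M lborel) (\<lambda>z. g z * dT z)"
    and "(\<integral>z. g z * dT z \<partial>(N \<Otimes>\<^sub>M lborel)) = - (\<integral>z. D z * T z \<partial>(N \<Otimes>\<^sub>M lborel))"
proof -
  have "AE x in N. integrable lborel (\<lambda>t. D (x, t) * T (x, t))"
    using NL.AE_integrable_fst'[OF int] by simp
  then have sl: "AE x in N. integrable lborel (\<lambda>s. g (x, s) * dT (x, s)) \<and>
     (\<integral>s. g (x, s) * dT (x, s) \<partial>lborel) = - (\<integral>t. D (x, t) * T (x, t) \<partial>lborel)"
    using slices slices_zero AE_space
  proof eventually_elim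
    case (elim x)
    have [measurable]: "(\<lambda>s. g (x, s) * dT (x, s)) \<in> borel_measurable lborel" using elim(4) by measurable
    show ?case
    proof (cases "gbar x = 0")
      case True
      have z: "AE s in lborel. g (x, s) = 0" using slice_zero_AE[OF True] elim by auto
      have "(\<integral>s. g (x, s) * dT (x, s) \<partial>lborel) = 0" by (rule integral_eq_zero_AE) (use z in auto)
      moreover have "(\<integral>t. D (x, t) * T (x, t) \<partial>lborel) = 0" by (rule integral_eq_zero_AE) (use z elim(3) in auto)
      moreover have "integrable lborel (\<lambda>s. g (x, s) * dT (x, s)) \<longleftrightarrow> integrable lborel (\<lambda>s::real. 0::real)"
        using z by (intro integrable_cong_AE) auto
      ultimately show ?thesis by simp
    next
      case False
      note sd = slice_density[OF False elim(2)]
      show ?thesis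
        using line_density.by_parts[OF sd(1)] elim(1) by (simp add: sd(2) dT_def)
    qed
  qed
  have m1[measurable]: "(\<lambda>x. \<integral>t. D (x, t) * T (x, t) \<partial>lborel) \<in> borel_measurable N"
    "(\<lambda>x. \<integral>s. g (x, s) * dT (x, s) \<partial>lborel) \<in> borel_measurable N" by measurable
  have i1: "integrable N (\<lambda>x. \<integral>t. D (x, t) * T (x, t) \<partial>lborel)"
    using NL.integrable_fst'[OF int] by simp
  show I: "integrable (N \<Otimes>\<^sub>M lborel) (\<lambda>z. g z * dT z)"
  proof (rule integrableI_bounded)
    have "(\<integral>\<^sup>+ z. ennreal (norm (g z * dT z)) \<partial>(N \<Otimes>\<^sub>M lborel)) = (\<integral>\<^sup>+x. (\<integral>\<^sup>+s. ennreal (norm (g (x, s) * dT (x, s))) \<partial>lborel) \<partial>N)"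
      by (subst lborel.nn_integral_fst[symmetric]) auto
    also have "\<dots> = (\<integral>\<^sup>+x. ennreal (norm (\<integral>t. D (x, t) * T (x, t) \<partial>lborel)) \<partial>N)"
    proof (rule nn_integral_cong_AE, use sl in eventually_elim)
      case (elim x)
      have nn: "0 \<le> g (x, s) * dT (x, s)" for s by (intro mult_nonneg_nonneg g_nonneg dT_nonneg)
      then have "(\<integral>\<^sup>+s. ennreal (norm (g (x, s) * dT (x, s))) \<partial>lborel) = (\<integral>\<^sup>+s. ennreal (g (x, s) * dT (x, s)) \<partial>lborel)"
        by simp
      also have "\<dots> = ennreal (\<integral>s. g (x, s) * dT (x, s) \<partial>lborel)"
        using elim nn by (intro nn_integral_eq_integral) auto
      also have "(\<integral>s. g (x, s) * dT (x, s) \<partial>lborel) = norm (\<integral>s. g (x, s) * dT (x, s) \<partial>lborel)"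
        using nn by simp
      also have "\<dots> = norm (\<integral>t. D (x, t) * T (x, t) \<partial>lborel)"
        using elim by simp
      finally show ?case .
    qed
    also have "\<dots> < \<infinity>" using i1 by (auto simp: integrable_iff_bounded)
    finally show "(\<integral>\<^sup>+ z. ennreal (norm (g z * dT z)) \<partial>(N \<Otimes>\<^sub>M lborel)) < \<infinity>" .
  qed measurable
  have "(\<integral>z. g z * dT z \<partial>(N \<Otimes>\<^sub>M lborel)) = (\<integral>x. (\<integral>s. g (x, s) * dT (x, s) \<partial>lborel) \<partial>N)"
    using NL.integral_fst'[OF I] by simp
  also have "\<dots> = (\<integral>x. - (\<integral>t. D (x, t) * T (x, t) \<partial>lborel) \<partial>N)"
    using sl by (intro integral_cong_AE) auto
  also have "\<dots> = - (\<integral>z. D z * T z \<partial>(N \<Otimes>\<^sub>M lborel))"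
    using NL.integral_fst'[OF int] by simp
  finally show "(\<integral>z. g z * dT z \<partial>(N \<Otimes>\<^sub>M lborel)) = - (\<integral>z. D z * T z \<partial>(N \<Otimes>\<^sub>M lborel))" .
qed

text \<open>Marginal density times conditional density, the latter rewritten by the Jacobian
  equation of the fibre.\<close>

lemma g_factor:
  assumes "gbar (fst z) \<noteq> 0"
  shows "g z = gbar (fst z) * (std_normal_density (T z) * dT z)"
  using assms normal_density_pos[of 1 0 "T z"] by (simp add: dT_def)

lemma gbar_zero_AE: "AE z in N \<Otimes>\<^sub>M lborel. gbar (fst z) = 0 \<longrightarrow> g z = 0"
proof (rule NL.AE_pair_measure)
  show "{z \<in> space (N \<Otimes>\<^sub>M lborel). gbar (fst z) = 0 \<longrightarrow> g z = 0} \<in> sets (N \<Otimes>\<^sub>M lborel)" by measurable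
  show "AE x in N. AE y in lborel. gbar (fst (x, y)) = 0 \<longrightarrow> g (x, y) = 0"
    using slices
  proof eventually_elim
    case (elim x)
    then show ?case using slice_zero_AE[of x] by (cases "gbar x = 0") auto
  qed
qed

end

subsection \<open>The Knothe map\<close>

abbreviation lborel_on :: "'i set \<Rightarrow> ('i \<Rightarrow> real) measure" where
  "lborel_on I \<equiv> PiM I (\<lambda>_. lborel)"

text \<open>Glues a point over \<open>I\<close> and a new coordinate. It preserves Lebesgue measure
  by \<open>distr_upd\<close>, and the transfer of Bochner integrals and null sets below rests on
  that.\<close>

definition upd :: "'i \<Rightarrow> ('i \<Rightarrow> real) \<times> real \<Rightarrow> 'i \<Rightarrow> real" where
  "upd i z = (fst z)(i := snd z)"

interpretation Leb: product_sigma_finite "\<lambda>_. lborel :: real measure" ..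

lemma upd_measurable [measurable]: "upd i \<in> measurable (lborel_on I \<Otimes>\<^sub>M borel) (lborel_on (insert i I))"
proof -
  have "(\<lambda>(f, y). f(i := y)) \<in> measurable (lborel_on I \<Otimes>\<^sub>M lborel) (lborel_on (insert i I))"
    by (rule measurable_add_dim)
  moreover have "upd i = (\<lambda>(f, y). f(i := y))" by (auto simp: upd_def)
  ultimately show ?thesis
    by (simp cong: measurable_cong_sets)
qed

lemma sigma_finite_lborel_on: "finite I \<Longrightarrow> sigma_finite_measure (lborel_on I)"
  by (rule Leb.sigma_finite)

lemma nn_integral_lborel_on_insert:
  assumes [simp]: "finite I" "i \<notin> I" and [measurable]: "f \<in> borel_measurable (lborel_on (insert i I))"
  shows "(\<integral>\<^sup>+y. f y \<partial>lborel_on (insert i I)) = (\<integral>\<^sup>+z. f (upd i z) \<partial>(lborel_on I \<Otimes>\<^sub>M lborel))"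
proof -
  have "(\<integral>\<^sup>+z. f (upd i z) \<partial>(lborel_on I \<Otimes>\<^sub>M lborel)) = (\<integral>\<^sup>+x. \<integral>\<^sup>+s. f (upd i (x, s)) \<partial>lborel \<partial>lborel_on I)"
    by (subst lborel.nn_integral_fst[symmetric]) auto
  also have "\<dots> = (\<integral>\<^sup>+y. f y \<partial>lborel_on (insert i I))"
    by (subst Leb.product_nn_integral_insert) (auto simp: upd_def)
  finally show ?thesis ..
qed

lemma distr_upd:
  assumes [simp]: "finite I" "i \<notin> I"
  shows "distr (lborel_on I \<Otimes>\<^sub>M lborel) (lborel_on (insert i I)) (upd i) = lborel_on (insert i I)"
proof (rule measure_eqI)
  fix A assume "A \<in> sets (distr (lborel_on I \<Otimes>\<^sub>M lborel) (lborel_on (insert i I)) (upd i))"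
  then have [measurable]: "A \<in> sets (lborel_on (insert i I))" by simp
  have "emeasure (lborel_on (insert i I)) A = (\<integral>\<^sup>+y. indicator A y \<partial>lborel_on (insert i I))" by simp
  also have "\<dots> = (\<integral>\<^sup>+z. indicator A (upd i z) \<partial>(lborel_on I \<Otimes>\<^sub>M lborel))"
    by (rule nn_integral_lborel_on_insert) auto
  also have "\<dots> = (\<integral>\<^sup>+y. indicator A y \<partial>distr (lborel_on I \<Otimes>\<^sub>M lborel) (lborel_on (insert i I)) (upd i))"
    by (subst nn_integral_distr) (auto cong: measurable_cong_sets)
  also have "\<dots> = emeasure (distr (lborel_on I \<Otimes>\<^sub>M lborel) (lborel_on (insert i I)) (upd i)) A" by simp
  finally show "emeasure (distr (lborel_on I \<Otimes>\<^sub>M lborel) (lborel_on (insert i I)) (upd i)) A =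
     emeasure (lborel_on (insert i I)) A" ..
qed simp

lemma upd_measurable': "upd i \<in> measurable (lborel_on I \<Otimes>\<^sub>M lborel) (lborel_on (insert i I))"
  using upd_measurable[of i I] by (simp cong: measurable_cong_sets)

lemma integrable_lborel_on_insert:
  fixes f :: "_ \<Rightarrow> real"
  assumes "finite I" "i \<notin> I" and [measurable]: "f \<in> borel_measurable (lborel_on (insert i I))"
  shows "integrable (lborel_on (insert i I)) f \<longleftrightarrow> integrable (lborel_on I \<Otimes>\<^sub>M lborel) (\<lambda>z. f (upd i z))"
  by (subst (1) distr_upd[OF assms(1,2), symmetric]) (rule integrable_distr_eq[OF upd_measurable'], simp)

lemma integral_lborel_on_insert:
  fixes f :: "_ \<Rightarrow> real"
  assumes "finite I" "i \<notin> I" and [measurable]: "f \<in> borel_measurable (lborel_on (insert i I))"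
  shows "integral\<^sup>L (lborel_on (insert i I)) f = (\<integral>z. f (upd i z) \<partial>(lborel_on I \<Otimes>\<^sub>M lborel))"
  by (subst (1) distr_upd[OF assms(1,2), symmetric]) (rule integral_distr[OF upd_measurable'], simp)

lemma AE_lborel_on_insertD:
  assumes "finite I" "i \<notin> I" "AE y in lborel_on (insert i I). P y"
  shows "AE z in lborel_on I \<Otimes>\<^sub>M lborel. P (upd i z)"
  by (rule AE_distrD[OF upd_measurable']) (subst distr_upd[OF assms(1,2)], rule assms(3))

lemma AE_lborel_on_insertI:
  assumes "finite I" "i \<notin> I" "{y \<in> space (lborel_on (insert i I)). P y} \<in> sets (lborel_on (insert i I))"
    and "AE z in lborel_on I \<Otimes>\<^sub>M lborel. P (upd i z)"
  shows "AE y in lborel_on (insert i I). P y"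
  using AE_distr_iff[OF upd_measurable' assms(3)] assms(4) unfolding distr_upd[OF assms(1,2)] by blast

section \<open>Sobolev densities and their marginals\<close>

text \<open>Cauchy-Schwarz for \<open>D = (D / sqrt g) * sqrt g\<close>, proved by expanding the
  nonnegative integral of \<open>(D - (b / c) * g)^2 / g\<close>. It expresses that Fisher
  information does not increase on passing to a marginal.\<close>

lemma square_div_integral_le:
  fixes D g :: "real \<Rightarrow> real"
  assumes D: "integrable lborel D" and g: "integrable lborel g" "\<And>s. 0 \<le> g s"
    and z: "AE s in lborel. g s = 0 \<longrightarrow> D s = 0"
    and Dg: "integrable lborel (\<lambda>s. (D s)\<^sup>2 / g s)"
  shows "(\<integral>s. D s \<partial>lborel)\<^sup>2 / (\<integral>s. g s \<partial>lborel) \<le> (\<integral>s. (D s)\<^sup>2 / g s \<partial>lborel)"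
proof (cases "(\<integral>s. g s \<partial>lborel) = 0")
  case True
  then show ?thesis using g(2) by simp
next
  case False
  define b c where "b = (\<integral>s. D s \<partial>lborel)" and "c = (\<integral>s. g s \<partial>lborel)"
  have "c \<noteq> 0" using False by (simp add: c_def)
  have "0 \<le> (\<integral>s. (D s)\<^sup>2 / g s - 2 * (b / c) * D s + (b / c)\<^sup>2 * g s \<partial>lborel)"
  proof (rule integral_nonneg_AE)
    show "AE s in lborel. 0 \<le> (D s)\<^sup>2 / g s - 2 * (b / c) * D s + (b / c)\<^sup>2 * g s"
      using z
    proof eventually_elim
      case (elim s)
      show ?case
      proof (cases "g s = 0")
        case False
        then have "(D s)\<^sup>2 / g s - 2 * (b / c) * D s + (b / c)\<^sup>2 * g s = (D s - b / c * g s)\<^sup>2 / g s"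
          using \<open>c \<noteq> 0\<close> by (simp add: power2_eq_square divide_simps) (simp add: algebra_simps)
        then show ?thesis using g(2)[of s] by simp
      qed (use elim in simp)
    qed
  qed
  also have "\<dots> = (\<integral>s. (D s)\<^sup>2 / g s \<partial>lborel) - 2 * (b / c) * b + (b / c)\<^sup>2 * c"
    using D g(1) Dg by (simp add: b_def c_def)
  also have "\<dots> = (\<integral>s. (D s)\<^sup>2 / g s \<partial>lborel) - b\<^sup>2 / c"
    using \<open>c \<noteq> 0\<close> by (simp add: power2_eq_square field_simps)
  finally show ?thesis by (simp add: b_def c_def)
qed

text \<open>Nonnegative Sobolev functions with finite Fisher information, the latter being the
  integrals of \<open>(D k)^2 / g\<close> with the convention \<open>x / 0 = 0\<close>. Derivatives
  are encoded by absolute continuity along lines parallel to the axes, a property that Fubini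
  carries over to marginals.\<close>

definition W11_density :: "'i set \<Rightarrow> (('i \<Rightarrow> real) \<Rightarrow> real) \<Rightarrow> ('i \<Rightarrow> ('i \<Rightarrow> real) \<Rightarrow> real) \<Rightarrow> bool" where
  "W11_density I g D \<longleftrightarrow> (\<forall>y. 0 \<le> g y) \<and> integrable (lborel_on I) g \<and>
     (\<forall>k\<in>I. integrable (lborel_on I) (D k) \<and> integrable (lborel_on I) (\<lambda>y. (D k y)\<^sup>2 / g y) \<and>
        (AE y in lborel_on I. g y = antideriv (\<lambda>t. D k (y(k := t))) (y k)))"

lemma fibre_density_upd:
  assumes fin: "finite I" "i \<notin> I" and nn: "\<And>y. 0 \<le> g y"
    and g: "integrable (lborel_on (insert i I)) g"
    and D: "integrable (lborel_on (insert i I)) D"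
    and eq: "AE y in lborel_on (insert i I). g y = antideriv (\<lambda>t. D (y(i := t))) (y i)"
  shows "fibre_density (lborel_on I) (\<lambda>z. g (upd i z)) (\<lambda>z. D (upd i z))"
proof -
  interpret N: sigma_finite_measure "lborel_on I" by (rule sigma_finite_lborel_on[OF fin(1)])
  show ?thesis
  proof
    show "integrable (lborel_on I \<Otimes>\<^sub>M lborel) (\<lambda>z. g (upd i z))"
      using g fin by (subst integrable_lborel_on_insert[symmetric]) auto
    show "integrable (lborel_on I \<Otimes>\<^sub>M lborel) (\<lambda>z. D (upd i z))"
      using D fin by (subst integrable_lborel_on_insert[symmetric]) auto
    have "AE z in lborel_on I \<Otimes>\<^sub>M lborel. g (upd i z) = antideriv (\<lambda>t. D ((upd i z)(i := t))) (upd i z i)"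
      using AE_lborel_on_insertD[OF fin eq] .
    then show "AE z in lborel_on I \<Otimes>\<^sub>M lborel. g (upd i z) = antideriv (\<lambda>t. D (upd i (fst z, t))) (snd z)"
      by (simp add: upd_def)
  qed (rule nn)
qed

text \<open>\<open>by_parts_id\<close> on the lines parallel to axis \<open>i\<close>. For the
  density of \<mu> it yields the correlation of position and score.\<close>

lemma integral_deriv_times_coordinate:
  assumes fin: "finite J" and i: "i \<in> J" and nn: "\<And>y. 0 \<le> g y"
    and g: "integrable (lborel_on J) g"
    and D: "integrable (lborel_on J) D"
    and eq: "AE y in lborel_on J. g y = antideriv (\<lambda>t. D (y(i := t))) (y i)"
    and int: "integrable (lborel_on J) (\<lambda>y. D y * y i)"
  shows "(\<integral>y. D y * y i \<partial>lborel_on J) = - (\<integral>y. g y \<partial>lborel_on J)"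
proof -
  define I where "I = J - {i}"
  have J: "J = insert i I" "finite I" "i \<notin> I" using i fin by (auto simp: I_def)
  interpret fibre_density "lborel_on I" "\<lambda>z. g (upd i z)" "\<lambda>z. D (upd i z)"
    using g D eq J(2,3) unfolding J(1) by (intro fibre_density_upd nn)
  have m [measurable]: "g \<in> borel_measurable (lborel_on (insert i I))" "D \<in> borel_measurable (lborel_on (insert i I))"
    "(\<lambda>y. D y * y i) \<in> borel_measurable (lborel_on (insert i I))"
    using g D int J(1) by (auto dest: borel_measurable_integrable)
  have "integrable (lborel_on I \<Otimes>\<^sub>M lborel) (\<lambda>z. D (upd i z) * upd i z i)"
    using int J by (subst integrable_lborel_on_insert[symmetric]) auto
  then have "integrable (lborel_on I \<Otimes>\<^sub>M lborel) (\<lambda>z. D (upd i z) * snd z)" by (simp add: upd_def)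
  from by_parts_id[OF this] show ?thesis
    unfolding J(1) using J by (simp add: integral_lborel_on_insert upd_def)
qed

lemma deriv_zero_on_density_zero:
  assumes fin: "finite J" and i: "i \<in> J" and nn: "\<And>y. 0 \<le> g y"
    and g: "integrable (lborel_on J) g"
    and D: "integrable (lborel_on J) D"
    and eq: "AE y in lborel_on J. g y = antideriv (\<lambda>t. D (y(i := t))) (y i)"
  shows "AE y in lborel_on J. g y = 0 \<longrightarrow> D y = 0"
proof -
  define I where "I = J - {i}"
  have J: "J = insert i I" "finite I" "i \<notin> I" using i fin by (auto simp: I_def)
  interpret fibre_density "lborel_on I" "\<lambda>z. g (upd i z)" "\<lambda>z. D (upd i z)"
    using g D eq J(2,3) unfolding J(1) by (intro fibre_density_upd nn)
  have m [measurable]: "g \<in> borel_measurable (lborel_on (insert i I))" "D \<in> borel_measurable (lborel_on (insert i I))"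
    using g D J(1) by (auto dest: borel_measurable_integrable)
  show ?thesis
    unfolding J(1) using J D_zero by (intro AE_lborel_on_insertI) auto
qed

text \<open>Fubini in the variables \<open>k\<close> and \<open>i\<close>, with the remaining variables fixed.\<close>

lemma marginal_antideriv:
  assumes fin: "finite I" and i: "i \<notin> I" and k: "k \<in> I"
    and D: "integrable (lborel_on (insert i I)) D"
    and g [measurable]: "g \<in> borel_measurable (lborel_on (insert i I))"
    and eq: "AE y in lborel_on (insert i I). g y = antideriv (\<lambda>t. D (y(k := t))) (y k)"
  shows "AE x in lborel_on I. (\<integral>s. g (upd i (x, s)) \<partial>lborel) =
           antideriv (\<lambda>t. \<integral>s. D (upd i (x(k := t), s)) \<partial>lborel) (x k)"
proof -
  define K where "K = I - {k}"
  have K: "I = insert k K" "finite K" "k \<notin> K" "k \<noteq> i" using fin i k by (auto simp: K_def)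
  interpret LI: sigma_finite_measure "lborel_on I" by (rule sigma_finite_lborel_on[OF fin])
  interpret LK: sigma_finite_measure "lborel_on K" by (rule sigma_finite_lborel_on[OF K(2)])
  interpret pI: pair_sigma_finite "lborel_on I" lborel ..
  interpret pK: pair_sigma_finite "lborel_on K" lborel ..
  have [measurable]: "D \<in> borel_measurable (lborel_on (insert i I))" using D by simp
  have uK [measurable]: "upd k \<in> measurable (lborel_on K \<Otimes>\<^sub>M borel) (lborel_on I)"
    using upd_measurable[of k K] by (simp add: K(1))
  have "upd k \<in> measurable (lborel_on I \<Otimes>\<^sub>M borel) (lborel_on (insert k I))" by (rule upd_measurable)
  then have uI [measurable]: "upd k \<in> measurable (lborel_on I \<Otimes>\<^sub>M borel) (lborel_on I)"
    using k by (simp add: insert_absorb)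
  have "AE z in lborel_on I \<Otimes>\<^sub>M lborel. g (upd i z) = antideriv (\<lambda>t. D ((upd i z)(k := t))) (upd i z k)"
    by (rule AE_lborel_on_insertD[OF fin i eq])
  then have "AE x in lborel_on I. AE s in lborel. g (upd i (x, s)) = antideriv (\<lambda>t. D ((upd i (x, s))(k := t))) (upd i (x, s) k)"
    by (rule pI.AE_pair)
  then have "AE z in lborel_on K \<Otimes>\<^sub>M lborel. AE s in lborel. g (upd i (upd k z, s)) =
      antideriv (\<lambda>t. D ((upd i (upd k z, s))(k := t))) (upd i (upd k z, s) k)"
    unfolding K(1) by (rule AE_lborel_on_insertD[OF K(2,3)])
  then have "AE z in lborel_on K \<Otimes>\<^sub>M lborel. AE s in lborel. g (upd i (upd k z, s)) =
      antideriv (\<lambda>t. D (upd i (upd k (fst z, t), s))) (snd z)"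
    using K(4) by (simp add: upd_def fun_upd_twist)
  then have slice: "AE z in lborel_on K. AE t in lborel. AE s in lborel. g (upd i (upd k (z, t), s)) =
      antideriv (\<lambda>t. D (upd i (upd k (z, t), s))) t"
    by (auto dest: pK.AE_pair)
  have "(\<integral>\<^sup>+z. (\<integral>\<^sup>+t. (\<integral>\<^sup>+s. norm (D (upd i (upd k (z, t), s))) \<partial>lborel) \<partial>lborel) \<partial>lborel_on K)
     = (\<integral>\<^sup>+y. norm (D y) \<partial>lborel_on (insert i I))"
  proof -
    have "(\<integral>\<^sup>+y. norm (D y) \<partial>lborel_on (insert i I)) = (\<integral>\<^sup>+x. (\<integral>\<^sup>+s. norm (D (upd i (x, s))) \<partial>lborel) \<partial>lborel_on I)"
      using fin i by (subst nn_integral_lborel_on_insert) (auto simp flip: lborel.nn_integral_fst)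
    also have "\<dots> = (\<integral>\<^sup>+z. (\<integral>\<^sup>+s. norm (D (upd i (upd k z, s))) \<partial>lborel) \<partial>(lborel_on K \<Otimes>\<^sub>M lborel))"
      unfolding K(1) by (rule nn_integral_lborel_on_insert[OF K(2,3)]) (simp flip: K(1))
    also have "\<dots> = (\<integral>\<^sup>+z. (\<integral>\<^sup>+t. (\<integral>\<^sup>+s. norm (D (upd i (upd k (z, t), s))) \<partial>lborel) \<partial>lborel) \<partial>lborel_on K)"
      by (subst lborel.nn_integral_fst[symmetric]) auto
    finally show ?thesis ..
  qed
  also have "\<dots> < \<infinity>" using D by (auto simp: integrable_iff_bounded)
  \<comment> \<open>Tonelli: for almost every choice of the remaining variables, \<open>D\<close> is
    integrable in the pair of coordinates \<open>k\<close> and \<open>i\<close>, as Fubini requires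
    below.\<close>
  finally have "AE z in lborel_on K. (\<integral>\<^sup>+t. (\<integral>\<^sup>+s. norm (D (upd i (upd k (z, t), s))) \<partial>lborel) \<partial>lborel) \<noteq> \<infinity>"
    by (intro nn_integral_PInf_AE) (auto simp: less_top)
  then have "AE z in lborel_on K. AE t in lborel. (\<integral>s. g (upd i (upd k (z, t), s)) \<partial>lborel) =
           antideriv (\<lambda>t. \<integral>s. D (upd i (upd k (z, t), s)) \<partial>lborel) t"
    using slice AE_space
  proof eventually_elim
    case (elim z)
    note [measurable] = elim(3)
    define E where "E = (\<lambda>(t, s). D (upd i (upd k (z, t), s)))"
    have E [measurable]: "E \<in> borel_measurable (borel \<Otimes>\<^sub>M borel)"
      unfolding E_def by measurable
    have Eint: "integrable (lborel \<Otimes>\<^sub>M lborel) E"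
    proof (rule integrableI_bounded)
      show "(\<integral>\<^sup>+ x. ennreal (norm (E x)) \<partial>(lborel \<Otimes>\<^sub>M lborel)) < \<infinity>"
        using elim(1) by (subst lborel.nn_integral_fst[symmetric]) (auto simp: E_def less_top)
    qed simp
    show ?case
      using elim(2)
    proof eventually_elim
      case (elim t)
      have Et: "integrable (lborel \<Otimes>\<^sub>M lborel) (\<lambda>(r, s). indicator {..t} r * E (r, s))"
        by (rule Bochner_Integration.integrable_bound[OF Eint]) (auto simp: indicator_def)
      have "(\<integral>s. g (upd i (upd k (z, t), s)) \<partial>lborel) = (\<integral>s. (\<integral>r. indicator {..t} r * E (r, s) \<partial>lborel) \<partial>lborel)"
      proof (rule integral_cong_AE)
        show "AE s in lborel. g (upd i (upd k (z, t), s)) = (\<integral>r. indicator {..t} r * E (r, s) \<partial>lborel)"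
          using elim by eventually_elim (simp add: antideriv_def E_def)
      qed measurable
      also have "\<dots> = (\<integral>r. (\<integral>s. indicator {..t} r * E (r, s) \<partial>lborel) \<partial>lborel)"
        using lborel_pair.Fubini_integral[OF Et] by simp
      also have "\<dots> = antideriv (\<lambda>t. \<integral>s. D (upd i (upd k (z, t), s)) \<partial>lborel) t"
        unfolding antideriv_def E_def by simp
      finally show ?case .
    qed
  qed
  then have *: "AE z in lborel_on K. AE t in lborel. (\<integral>s. g (upd i (upd k (z, t), s)) \<partial>lborel) =
           antideriv (\<lambda>r. \<integral>s. D (upd i ((upd k (z, t))(k := r), s)) \<partial>lborel) (upd k (z, t) k)"
    by (simp add: upd_def)
  \<comment> \<open>Again the indicator becomes a condition on \<open>x k\<close> and
    \<open>t\<close>, which makes the exceptional set measurable, so that the almost everywhere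
    statement can be carried across \<open>upd k\<close>.\<close>
  have "(\<lambda>x. antideriv (\<lambda>t. \<integral>s. D (upd i (x(k := t), s)) \<partial>lborel) (x k)) =
     (\<lambda>x. \<integral>t. (if t \<le> x k then 1 else 0) * (\<integral>s. D (upd i (upd k (x, t), s)) \<partial>lborel) \<partial>lborel)"
    unfolding antideriv_def by (intro ext Bochner_Integration.integral_cong) (auto simp: indicator_def upd_def)
  moreover have "(\<lambda>x. x k) \<in> borel_measurable (lborel_on I)" using k by simp
  then have "(\<lambda>x. \<integral>t. (if t \<le> x k then 1 else 0) * (\<integral>s. D (upd i (upd k (x, t), s)) \<partial>lborel) \<partial>lborel) \<in> borel_measurable (lborel_on I)"
    by measurable
  ultimately have [measurable]: "(\<lambda>x. antideriv (\<lambda>t. \<integral>s. D (upd i (x(k := t), s)) \<partial>lborel) (x k)) \<in> borel_measurable (lborel_on I)"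
    by simp
  have m: "{x \<in> space (lborel_on I). (\<integral>s. g (upd i (x, s)) \<partial>lborel) =
           antideriv (\<lambda>t. \<integral>s. D (upd i (x(k := t), s)) \<partial>lborel) (x k)} \<in> sets (lborel_on I)"
    by measurable
  have "AE x in lborel_on (insert k K). (\<integral>s. g (upd i (x, s)) \<partial>lborel) =
           antideriv (\<lambda>t. \<integral>s. D (upd i (x(k := t), s)) \<partial>lborel) (x k)"
  proof (rule AE_lborel_on_insertI[OF K(2,3)])
    show "{x \<in> space (lborel_on (insert k K)). (\<integral>s. g (upd i (x, s)) \<partial>lborel) =
           antideriv (\<lambda>t. \<integral>s. D (upd i (x(k := t), s)) \<partial>lborel) (x k)} \<in> sets (lborel_on (insert k K))"
      using m by (simp add: K(1))
    show "AE z in lborel_on K \<Otimes>\<^sub>M lborel. (\<integral>s. g (upd i (upd k z, s)) \<partial>lborel) =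
       antideriv (\<lambda>t. \<integral>s. D (upd i ((upd k z)(k := t), s)) \<partial>lborel) (upd k z k)"
    proof (rule pK.AE_pair_measure)
      show "{z \<in> space (lborel_on K \<Otimes>\<^sub>M lborel). (\<integral>s. g (upd i (upd k z, s)) \<partial>lborel) =
       antideriv (\<lambda>t. \<integral>s. D (upd i ((upd k z)(k := t), s)) \<partial>lborel) (upd k z k)} \<in> sets (lborel_on K \<Otimes>\<^sub>M lborel)"
      proof -
        have "{z \<in> space (lborel_on K \<Otimes>\<^sub>M lborel). (\<integral>s. g (upd i (upd k z, s)) \<partial>lborel) =
           antideriv (\<lambda>t. \<integral>s. D (upd i ((upd k z)(k := t), s)) \<partial>lborel) (upd k z k)} =
           upd k -` {x \<in> space (lborel_on I). (\<integral>s. g (upd i (x, s)) \<partial>lborel) =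
           antideriv (\<lambda>t. \<integral>s. D (upd i (x(k := t), s)) \<partial>lborel) (x k)} \<inter> space (lborel_on K \<Otimes>\<^sub>M lborel)"
          using measurable_space[OF uK] by (auto simp: space_pair_measure)
        also have "\<dots> \<in> sets (lborel_on K \<Otimes>\<^sub>M lborel)"
          by (rule measurable_sets[OF _ m]) simp
        finally show ?thesis .
      qed
    qed (rule *)
  qed
  then show ?thesis by (simp only: K(1)[symmetric])
qed

text \<open>Integrability and absolute continuity pass to the marginal by Fubini, finiteness of the
  Fisher information by \<open>square_div_integral_le\<close>.\<close>

lemma marginal_W11_density:
  assumes fin: "finite I" "i \<notin> I" and W: "W11_density (insert i I) g D"
  shows "W11_density I (\<lambda>x. \<integral>s. g (upd i (x, s)) \<partial>lborel) (\<lambda>k x. \<integral>s. D k (upd i (x, s)) \<partial>lborel)"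
proof -
  have nn: "0 \<le> g y" for y using W by (auto simp: W11_density_def)
  have g: "integrable (lborel_on (insert i I)) g" using W by (auto simp: W11_density_def)
  have D: "integrable (lborel_on (insert i I)) (D k)"
    "integrable (lborel_on (insert i I)) (\<lambda>y. (D k y)\<^sup>2 / g y)"
    "AE y in lborel_on (insert i I). g y = antideriv (\<lambda>t. D k (y(k := t))) (y k)" if "k \<in> insert i I" for k
    using W that by (auto simp: W11_density_def)
  have gm [measurable]: "g \<in> borel_measurable (lborel_on (insert i I))" using g by simp
  have Dm [measurable]: "D k \<in> borel_measurable (lborel_on (insert i I))" if "k \<in> insert i I" for k
    using D(1)[OF that] by simp
  interpret N: sigma_finite_measure "lborel_on I" by (rule sigma_finite_lborel_on[OF fin(1)])
  interpret NL: pair_sigma_finite "lborel_on I" lborel ..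
  have gz: "integrable (lborel_on I \<Otimes>\<^sub>M lborel) (\<lambda>z. g (upd i z))"
    using g fin by (subst integrable_lborel_on_insert[symmetric]) auto
  show ?thesis
    unfolding W11_density_def
  proof (intro conjI ballI allI)
    show "0 \<le> (\<integral>s. g (upd i (x, s)) \<partial>lborel)" for x by (simp add: nn)
    show "integrable (lborel_on I) (\<lambda>x. \<integral>s. g (upd i (x, s)) \<partial>lborel)"
      using NL.integrable_fst'[OF gz] .
  next
    fix k assume k: "k \<in> I"
    then have k': "k \<in> insert i I" by simp
    have Dz: "integrable (lborel_on I \<Otimes>\<^sub>M lborel) (\<lambda>z. D k (upd i z))"
      using D(1)[OF k'] fin k' by (subst integrable_lborel_on_insert[symmetric]) auto
    have D2z: "integrable (lborel_on I \<Otimes>\<^sub>M lborel) (\<lambda>z. (D k (upd i z))\<^sup>2 / g (upd i z))"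
      using D(2)[OF k'] fin k' by (subst (asm) integrable_lborel_on_insert) auto
    show "integrable (lborel_on I) (\<lambda>x. \<integral>s. D k (upd i (x, s)) \<partial>lborel)"
      using NL.integrable_fst'[OF Dz] .
    have R: "integrable (lborel_on I) (\<lambda>x. \<integral>s. (D k (upd i (x, s)))\<^sup>2 / g (upd i (x, s)) \<partial>lborel)"
      using NL.integrable_fst'[OF D2z] .
    show "integrable (lborel_on I) (\<lambda>x. (\<integral>s. D k (upd i (x, s)) \<partial>lborel)\<^sup>2 / (\<integral>s. g (upd i (x, s)) \<partial>lborel))"
    proof (rule Bochner_Integration.integrable_bound[OF R])
      have "(\<lambda>x. \<integral>s. D k (upd i (x, s)) \<partial>lborel) \<in> borel_measurable (lborel_on I)"
        using NL.integrable_fst'[OF Dz] by simp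
      moreover have "(\<lambda>x. \<integral>s. g (upd i (x, s)) \<partial>lborel) \<in> borel_measurable (lborel_on I)"
        using NL.integrable_fst'[OF gz] by simp
      ultimately show "(\<lambda>x. (\<integral>s. D k (upd i (x, s)) \<partial>lborel)\<^sup>2 / (\<integral>s. g (upd i (x, s)) \<partial>lborel)) \<in> borel_measurable (lborel_on I)"
        by measurable
      \<comment> \<open>As \<open>x / 0 = 0\<close>, the quotient \<open>(D k)^2 / g\<close> ignores
        \<open>D k\<close> on the zero set of \<open>g\<close>; the vanishing of \<open>D k\<close>
        there closes that gap.\<close>
      have "AE y in lborel_on (insert i I). g y = 0 \<longrightarrow> D k y = 0"
        using fin by (intro deriv_zero_on_density_zero[OF _ k' nn g D(1)[OF k'] D(3)[OF k']]) simp
      then have "AE z in lborel_on I \<Otimes>\<^sub>M lborel. g (upd i z) = 0 \<longrightarrow> D k (upd i z) = 0"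
        by (rule AE_lborel_on_insertD[OF fin])
      then have "AE x in lborel_on I. AE s in lborel. g (upd i (x, s)) = 0 \<longrightarrow> D k (upd i (x, s)) = 0"
        by (rule NL.AE_pair)
      then show "AE x in lborel_on I. norm ((\<integral>s. D k (upd i (x, s)) \<partial>lborel)\<^sup>2 / (\<integral>s. g (upd i (x, s)) \<partial>lborel))
          \<le> norm (\<integral>s. (D k (upd i (x, s)))\<^sup>2 / g (upd i (x, s)) \<partial>lborel)"
        using NL.AE_integrable_fst'[OF gz] NL.AE_integrable_fst'[OF Dz] NL.AE_integrable_fst'[OF D2z]
      proof eventually_elim
        case (elim x)
        have "(\<integral>s. D k (upd i (x, s)) \<partial>lborel)\<^sup>2 / (\<integral>s. g (upd i (x, s)) \<partial>lborel) \<le>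
           (\<integral>s. (D k (upd i (x, s)))\<^sup>2 / g (upd i (x, s)) \<partial>lborel)"
          using elim by (intro square_div_integral_le nn) auto
        moreover have "0 \<le> (\<integral>s. D k (upd i (x, s)) \<partial>lborel)\<^sup>2 / (\<integral>s. g (upd i (x, s)) \<partial>lborel)"
          by (intro divide_nonneg_nonneg zero_le_power2 Bochner_Integration.integral_nonneg nn)
        ultimately show ?case by simp
      qed
    qed
    show "AE x in lborel_on I. (\<integral>s. g (upd i (x, s)) \<partial>lborel) =
           antideriv (\<lambda>t. \<integral>s. D k (upd i (x(k := t), s)) \<partial>lborel) (x k)"
      by (rule marginal_antideriv[OF fin k D(1)[OF k'] gm D(3)[OF k']])
  qed
qed

section \<open>Construction of the Knothe map\<close>

text \<open>Where \<open>g\<close> is positive, twice the modulus of \<open>D * T\<close> is at most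
  \<open>D^2 / g + g * T^2\<close>; elsewhere \<open>D\<close> vanishes.\<close>

lemma integrable_deriv_times:
  fixes D g T :: "'b \<Rightarrow> real"
  assumes [measurable]: "D \<in> borel_measurable M" "T \<in> borel_measurable M" "g \<in> borel_measurable M"
    and nn: "\<And>y. 0 \<le> g y" and z: "AE y in M. g y = 0 \<longrightarrow> D y = 0"
    and D2: "integrable M (\<lambda>y. (D y)\<^sup>2 / g y)" and T2: "integrable M (\<lambda>y. g y * (T y)\<^sup>2)"
  shows "integrable M (\<lambda>y. D y * T y)"
proof (rule Bochner_Integration.integrable_bound)
  show "integrable M (\<lambda>y. (D y)\<^sup>2 / g y + g y * (T y)\<^sup>2)" using D2 T2 by simp
  show "AE y in M. norm (D y * T y) \<le> norm ((D y)\<^sup>2 / g y + g y * (T y)\<^sup>2)"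
    using z
  proof eventually_elim
    case (elim y)
    show ?case
    proof (cases "g y = 0")
      case False
      then have "0 < g y" using nn[of y] by simp
      define r where "r = sqrt (g y)"
      have r: "0 < r" "r\<^sup>2 = g y" using \<open>0 < g y\<close> by (auto simp: r_def)
      have "0 \<le> (\<bar>D y\<bar> / r - r * \<bar>T y\<bar>)\<^sup>2" by simp
      also have "\<dots> = (D y)\<^sup>2 / g y + g y * (T y)\<^sup>2 - 2 * \<bar>D y * T y\<bar>"
        unfolding r(2)[symmetric] using r(1)
        by (simp add: power2_diff power_divide power_mult_distrib abs_mult)
      finally show ?thesis using nn[of y] by simp
    qed (use elim in simp)
  qed
qed measurable

lemma sets_Collect_eq_if_nonzero:
  fixes f q :: "'b \<Rightarrow> real"
  assumes [measurable]: "f \<in> borel_measurable M" "q \<in> borel_measurable M"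
  shows "{y \<in> space M. f y \<noteq> 0 \<longrightarrow> f y = q y} \<in> sets M"
  by measurable

text \<open>\<open>d k\<close> is \<open>\<partial>\<^sub>k T\<^sub>k\<close>; the third clause is the change of variables formula.\<close>

definition Knothe_map ::
  "'i set \<Rightarrow> (('i \<Rightarrow> real) \<Rightarrow> real) \<Rightarrow> ('i \<Rightarrow> ('i \<Rightarrow> real) \<Rightarrow> real) \<Rightarrow>
    ('i \<Rightarrow> ('i \<Rightarrow> real) \<Rightarrow> real) \<Rightarrow> ('i \<Rightarrow> ('i \<Rightarrow> real) \<Rightarrow> real) \<Rightarrow> bool" where
  "Knothe_map I g D T d \<longleftrightarrow>
     (\<forall>k\<in>I. T k \<in> borel_measurable (lborel_on I) \<and> d k \<in> borel_measurable (lborel_on I) \<and> (\<forall>y. 0 \<le> d k y)) \<and>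
     (\<forall>h\<in>borel_measurable (lborel_on I).
        (\<integral>\<^sup>+y. ennreal (g y) * h (\<lambda>k\<in>I. T k y) \<partial>lborel_on I) =
        ennreal (\<integral>y. g y \<partial>lborel_on I) * (\<integral>\<^sup>+u. ennreal (\<Prod>k\<in>I. std_normal_density (u k)) * h u \<partial>lborel_on I)) \<and>
     (AE y in lborel_on I. g y \<noteq> 0 \<longrightarrow>
        g y = (\<integral>y. g y \<partial>lborel_on I) * (\<Prod>k\<in>I. std_normal_density (T k y) * d k y)) \<and>
     (\<forall>k\<in>I. integrable (lborel_on I) (\<lambda>y. g y * (T k y)\<^sup>2) \<and>
        (\<integral>y. g y * (T k y)\<^sup>2 \<partial>lborel_on I) = (\<integral>y. g y \<partial>lborel_on I) \<and>
        integrable (lborel_on I) (\<lambda>y. D k y * T k y) \<and>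
        integrable (lborel_on I) (\<lambda>y. g y * d k y) \<and>
        (\<integral>y. g y * d k y \<partial>lborel_on I) = - (\<integral>y. D k y * T k y \<partial>lborel_on I))"

text \<open>The new coordinate \<open>i\<close> is integrated out, the marginal has its map by
  induction, and the fibres over it are rearranged by \<open>fibre_density.T\<close>. The old
  components do not depend on the new coordinate: hence the diagonal derivatives multiply to the
  Jacobian determinant, and for \<open>k\<close> other than \<open>i\<close> every integral reduces
  to the marginal.\<close>

lemma Knothe_map_exists:
  assumes "finite I" "W11_density I g D"
  shows "\<exists>T d. Knothe_map I g D T d"
  using assms
proof (induction I arbitrary: g D rule: finite_induct)
  case empty
  \<comment> \<open>Over no coordinates the product is a one-point space, where all clauses hold by
    empty products and empty quantifiers.\<close>
  have e: "lborel_on {} = count_space {\<lambda>_. undefined :: real}" by (rule PiM_empty)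
  show ?case
    unfolding Knothe_map_def e
    by (intro exI) (auto simp: lebesgue_integral_count_space_finite
      nn_integral_count_space_finite AE_count_space restrict_def)
next
  case (insert i I)
  note fin = insert(1,2)
  define c where "c = (\<integral>y. g y \<partial>lborel_on (insert i I))"
  have W: "W11_density (insert i I) g D" by (rule insert.prems)
  have nn: "0 \<le> g y" for y using W by (auto simp: W11_density_def)
  have g: "integrable (lborel_on (insert i I)) g" using W by (auto simp: W11_density_def)
  have D: "integrable (lborel_on (insert i I)) (D k)"
    "integrable (lborel_on (insert i I)) (\<lambda>y. (D k y)\<^sup>2 / g y)"
    "AE y in lborel_on (insert i I). g y = antideriv (\<lambda>t. D k (y(k := t))) (y k)" if "k \<in> insert i I" for k
    using W that by (auto simp: W11_density_def)
  have Dzero: "AE y in lborel_on (insert i I). g y = 0 \<longrightarrow> D k y = 0" if "k \<in> insert i I" for k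
    using fin(1) by (intro deriv_zero_on_density_zero[OF _ that nn g D(1)[OF that] D(3)[OF that]]) simp
  have gm [measurable]: "g \<in> borel_measurable (lborel_on (insert i I))" using g by simp
  have Dm [measurable]: "D k \<in> borel_measurable (lborel_on (insert i I))" if "k \<in> insert i I" for k
    using D(1)[OF that] by simp
  interpret F: fibre_density "lborel_on I" "\<lambda>z. g (upd i z)" "\<lambda>z. D i (upd i z)"
    by (rule fibre_density_upd[OF fin nn g D(1)[OF insertI1] D(3)[OF insertI1]])
  define gb where "gb = (\<lambda>x. \<integral>s. g (upd i (x, s)) \<partial>lborel)"
  define Db where "Db = (\<lambda>k x. \<integral>s. D k (upd i (x, s)) \<partial>lborel)"
  have gb: "F.gbar = gb" by (auto simp: F.gbar_def gb_def)
  have Wb: "W11_density I gb Db"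
    unfolding gb_def Db_def by (rule marginal_W11_density[OF fin W])
  have cb: "(\<integral>x. gb x \<partial>lborel_on I) = c"
    unfolding c_def gb_def using F.NL.integral_fst'[OF F.g_int] fin by (simp add: integral_lborel_on_insert)
  obtain T d where IH: "Knothe_map I gb Db T d" using insert.IH[OF Wb] by blast
  have T [measurable]: "T k \<in> borel_measurable (lborel_on I)" and d [measurable]: "d k \<in> borel_measurable (lborel_on I)"
    and dnn: "0 \<le> d k y" if "k \<in> I" for k y
    using IH that by (auto simp: Knothe_map_def)
  have law: "(\<integral>\<^sup>+y. ennreal (gb y) * h (\<lambda>k\<in>I. T k y) \<partial>lborel_on I) =
        ennreal c * (\<integral>\<^sup>+u. ennreal (\<Prod>k\<in>I. std_normal_density (u k)) * h u \<partial>lborel_on I)" 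
    if "h \<in> borel_measurable (lborel_on I)" for h
    using IH that by (auto simp: Knothe_map_def cb)
  have factor: "AE y in lborel_on I. gb y \<noteq> 0 \<longrightarrow> gb y = c * (\<Prod>k\<in>I. std_normal_density (T k y) * d k y)"
    using IH by (auto simp: Knothe_map_def cb)
  have ints: "integrable (lborel_on I) (\<lambda>y. gb y * (T k y)\<^sup>2)"
        "(\<integral>y. gb y * (T k y)\<^sup>2 \<partial>lborel_on I) = c"
        "integrable (lborel_on I) (\<lambda>y. Db k y * T k y)"
        "integrable (lborel_on I) (\<lambda>y. gb y * d k y)"
        "(\<integral>y. gb y * d k y \<partial>lborel_on I) = - (\<integral>y. Db k y * T k y \<partial>lborel_on I)" if "k \<in> I" for k
    using IH that by (auto simp: Knothe_map_def cb)
  \<comment> \<open>The inverse of \<open>upd i\<close>. It undoes \<open>upd i\<close> on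
    extensional functions only, hence the recurring condition that \<open>fst z\<close> lies in the
    space of the product.\<close>
  define split where "split = (\<lambda>y::'a \<Rightarrow> real. (restrict y I, y i))"
  have split_m [measurable]: "split \<in> measurable (lborel_on (insert i I)) (lborel_on I \<Otimes>\<^sub>M borel)"
    unfolding split_def by (intro measurable_Pair measurable_restrict_subset) auto
  have split_upd: "split (upd i z) = z" if "fst z \<in> space (lborel_on I)" for z
    using that fin(2) by (cases z) (auto simp: split_def upd_def restrict_def space_PiM PiE_def extensional_def fun_eq_iff)
  define T' where "T' k y = (if k = i then F.T (split y) else T k (fst (split y)))" for k y
  define d' where "d' k y = (if k = i then F.dT (split y) else d k (fst (split y)))" for k y
  have T'm [measurable]: "T' k \<in> borel_measurable (lborel_on (insert i I))" if "k \<in> insert i I" for k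
    using that unfolding T'_def[abs_def] by (cases "k = i") (auto intro!: measurable_compose[OF split_m] measurable_compose[OF measurable_fst])
  have d'm [measurable]: "d' k \<in> borel_measurable (lborel_on (insert i I))" if "k \<in> insert i I" for k
    using that unfolding d'_def[abs_def] by (cases "k = i") (auto intro!: measurable_compose[OF split_m] measurable_compose[OF measurable_fst])
  have T'_upd: "T' k (upd i z) = (if k = i then F.T z else T k (fst z))"
    and d'_upd: "d' k (upd i z) = (if k = i then F.dT z else d k (fst z))" if "fst z \<in> space (lborel_on I)" for k z
    using split_upd[OF that] by (auto simp: T'_def d'_def)
  have sp: "fst z \<in> space (lborel_on I)" if "z \<in> space (lborel_on I \<Otimes>\<^sub>M (lborel :: real measure))" for z
    using that by (auto simp: space_pair_measure)
  have AEsp: "AE z in lborel_on I \<Otimes>\<^sub>M (lborel :: real measure). fst z \<in> space (lborel_on I)"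
    using AE_space by eventually_elim (rule sp)
  have gz: "integrable (lborel_on I \<Otimes>\<^sub>M lborel) (\<lambda>z. g (upd i z))" by (rule F.g_int)

  have law': "(\<integral>\<^sup>+y. ennreal (g y) * h (\<lambda>k\<in>insert i I. T' k y) \<partial>lborel_on (insert i I)) =
        ennreal c * (\<integral>\<^sup>+u. ennreal (\<Prod>k\<in>insert i I. std_normal_density (u k)) * h u \<partial>lborel_on (insert i I))"
    if [measurable]: "h \<in> borel_measurable (lborel_on (insert i I))" for h
  proof -
    have [measurable]: "(\<lambda>y. \<lambda>k\<in>insert i I. T' k y) \<in> measurable (lborel_on (insert i I)) (lborel_on (insert i I))"
      by (rule measurable_restrict) simp
    have [measurable]: "(\<lambda>x. \<lambda>k\<in>I. T k x) \<in> measurable (lborel_on I) (lborel_on I)"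
      by (rule measurable_restrict) simp
    have prod_h: "(\<lambda>y. ennreal (\<Prod>k\<in>insert i I. std_normal_density (y k)) * h y) \<in> borel_measurable (lborel_on (insert i I))"
      by measurable
    \<comment> \<open>The new Gaussian variable is integrated out of \<open>h\<close> first; what
      remains can be fed to the law of the old components.\<close>
    define H where "H v = (\<integral>\<^sup>+u. ennreal (std_normal_density u) * h (upd i (v, u)) \<partial>lborel)" for v
    have [measurable]: "H \<in> borel_measurable (lborel_on I)" unfolding H_def[abs_def] by measurable
    have "(\<integral>\<^sup>+y. ennreal (g y) * h (\<lambda>k\<in>insert i I. T' k y) \<partial>lborel_on (insert i I)) =
      (\<integral>\<^sup>+z. ennreal (g (upd i z)) * h (\<lambda>k\<in>insert i I. T' k (upd i z)) \<partial>(lborel_on I \<Otimes>\<^sub>M lborel))"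
      by (rule nn_integral_lborel_on_insert[OF fin]) measurable
    also have "\<dots> = (\<integral>\<^sup>+z. ennreal (g (upd i z)) * h (upd i (\<lambda>k\<in>I. T k (fst z), F.T z)) \<partial>(lborel_on I \<Otimes>\<^sub>M lborel))"
    proof (intro nn_integral_cong)
      fix z assume "z \<in> space (lborel_on I \<Otimes>\<^sub>M (lborel :: real measure))"
      then have "(\<lambda>k\<in>insert i I. T' k (upd i z)) = upd i (\<lambda>k\<in>I. T k (fst z), F.T z)"
        using fin(2) T'_upd[OF sp] by (auto simp: upd_def fun_eq_iff restrict_def)
      then show "ennreal (g (upd i z)) * h (\<lambda>k\<in>insert i I. T' k (upd i z)) =
        ennreal (g (upd i z)) * h (upd i (\<lambda>k\<in>I. T k (fst z), F.T z))" by simp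
    qed
    also have "\<dots> = (\<integral>\<^sup>+x. ennreal (gb x) * H (\<lambda>k\<in>I. T k x) \<partial>lborel_on I)"
    proof -
      have "(\<lambda>z. h (upd i (\<lambda>k\<in>I. T k (fst z), snd z))) \<in> borel_measurable (lborel_on I \<Otimes>\<^sub>M borel)"
        by measurable
      from F.law[OF this] show ?thesis by (simp add: gb H_def)
    qed
    also have "\<dots> = ennreal c * (\<integral>\<^sup>+v. ennreal (\<Prod>k\<in>I. std_normal_density (v k)) * H v \<partial>lborel_on I)"
      by (rule law) simp
    also have "(\<integral>\<^sup>+v. ennreal (\<Prod>k\<in>I. std_normal_density (v k)) * H v \<partial>lborel_on I) =
      (\<integral>\<^sup>+v. (\<integral>\<^sup>+u. ennreal (\<Prod>k\<in>insert i I. std_normal_density (upd i (v, u) k)) * h (upd i (v, u)) \<partial>lborel) \<partial>lborel_on I)"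
    proof (intro nn_integral_cong)
      fix v assume [measurable]: "v \<in> space (lborel_on I)"
      have "(\<Prod>k\<in>insert i I. std_normal_density (upd i (v, u) k)) = (\<Prod>k\<in>I. std_normal_density (v k)) * std_normal_density u" for u
      proof -
        have "(\<Prod>k\<in>I. std_normal_density (upd i (v, u) k)) = (\<Prod>k\<in>I. std_normal_density (v k))"
          using fin(2) by (intro prod.cong) (auto simp: upd_def)
        then show ?thesis using fin by (simp add: upd_def mult.commute)
      qed
      then show "ennreal (\<Prod>k\<in>I. std_normal_density (v k)) * H v =
        (\<integral>\<^sup>+u. ennreal (\<Prod>k\<in>insert i I. std_normal_density (upd i (v, u) k)) * h (upd i (v, u)) \<partial>lborel)"
        unfolding H_def
        by (subst nn_integral_cmult[symmetric]) (auto simp: ennreal_mult prod_nonneg mult_ac)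
    qed
    also have "\<dots> = (\<integral>\<^sup>+z. ennreal (\<Prod>k\<in>insert i I. std_normal_density (upd i z k)) * h (upd i z) \<partial>(lborel_on I \<Otimes>\<^sub>M lborel))"
      by (rule lborel.nn_integral_fst) (rule measurable_compose[OF upd_measurable' prod_h])
    also have "\<dots> = (\<integral>\<^sup>+y. ennreal (\<Prod>k\<in>insert i I. std_normal_density (y k)) * h y \<partial>lborel_on (insert i I))"
      by (rule nn_integral_lborel_on_insert[OF fin prod_h, symmetric])
    finally show ?thesis .
  qed

  have factor': "AE y in lborel_on (insert i I). g y \<noteq> 0 \<longrightarrow>
        g y = c * (\<Prod>k\<in>insert i I. std_normal_density (T' k y) * d' k y)"
  proof (rule AE_lborel_on_insertI[OF fin])
    have [measurable]: "(\<lambda>y. \<Prod>k\<in>insert i I. std_normal_density (T' k y) * d' k y) \<in> borel_measurable (lborel_on (insert i I))"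
      by (intro borel_measurable_prod borel_measurable_times measurable_compose[OF T'm] d'm) auto
    show "{y \<in> space (lborel_on (insert i I)). g y \<noteq> 0 \<longrightarrow>
        g y = c * (\<Prod>k\<in>insert i I. std_normal_density (T' k y) * d' k y)} \<in> sets (lborel_on (insert i I))"
      by (intro sets_Collect_eq_if_nonzero) measurable
    have "AE z in lborel_on I \<Otimes>\<^sub>M lborel. gb (fst z) \<noteq> 0 \<longrightarrow> gb (fst z) = c * (\<Prod>k\<in>I. std_normal_density (T k (fst z)) * d k (fst z))"
    proof (rule F.NL.AE_pair_measure)
      have gb_m [measurable]: "gb \<in> borel_measurable (lborel_on I)" using F.gbar_measurable by (simp add: gb)
      have "(\<lambda>x. \<Prod>k\<in>I. std_normal_density (T k x) * d k x) \<in> borel_measurable (lborel_on I)"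
        by (intro borel_measurable_prod borel_measurable_times measurable_compose[OF T] d) auto
      from measurable_compose[OF measurable_fst this]
      have [measurable]: "(\<lambda>z. \<Prod>k\<in>I. std_normal_density (T k (fst z)) * d k (fst z)) \<in> borel_measurable (lborel_on I \<Otimes>\<^sub>M borel)" .
      show "{z \<in> space (lborel_on I \<Otimes>\<^sub>M lborel). gb (fst z) \<noteq> 0 \<longrightarrow> gb (fst z) = c * (\<Prod>k\<in>I. std_normal_density (T k (fst z)) * d k (fst z))} \<in> sets (lborel_on I \<Otimes>\<^sub>M lborel)"
        by (intro sets_Collect_eq_if_nonzero) measurable
      show "AE x in lborel_on I. AE y in lborel. gb (fst (x, y)) \<noteq> 0 \<longrightarrow>
           gb (fst (x, y)) = c * (\<Prod>k\<in>I. std_normal_density (T k (fst (x, y))) * d k (fst (x, y)))"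
        using factor by eventually_elim simp
    qed
    then show "AE z in lborel_on I \<Otimes>\<^sub>M lborel. g (upd i z) \<noteq> 0 \<longrightarrow>
        g (upd i z) = c * (\<Prod>k\<in>insert i I. std_normal_density (T' k (upd i z)) * d' k (upd i z))"
      using F.gbar_zero_AE AEsp
    proof eventually_elim
      case (elim z)
      show ?case
      proof
        assume "g (upd i z) \<noteq> 0"
        \<comment> \<open>Almost everywhere the marginal is nonzero wherever the density is, so its
          factorisation from the induction hypothesis is available.\<close>
        then have nz: "gb (fst z) \<noteq> 0" using elim(2) by (auto simp: gb)
        have "(\<Prod>k\<in>I. std_normal_density (T' k (upd i z)) * d' k (upd i z)) = (\<Prod>k\<in>I. std_normal_density (T k (fst z)) * d k (fst z))"
          using fin(2) by (intro prod.cong refl) (auto simp: T'_upd[OF elim(3)] d'_upd[OF elim(3)])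
        then have A: "(\<Prod>k\<in>insert i I. std_normal_density (T' k (upd i z)) * d' k (upd i z)) =
            (std_normal_density (F.T z) * F.dT z) * (\<Prod>k\<in>I. std_normal_density (T k (fst z)) * d k (fst z))"
          using fin by (simp add: T'_upd[OF elim(3)] d'_upd[OF elim(3)])
        have B: "g (upd i z) = gb (fst z) * (std_normal_density (F.T z) * F.dT z)"
          using F.g_factor[of z] nz by (simp add: gb)
        have C: "gb (fst z) = c * (\<Prod>k\<in>I. std_normal_density (T k (fst z)) * d k (fst z))"
          using elim(1) nz by blast
        show "g (upd i z) = c * (\<Prod>k\<in>insert i I. std_normal_density (T' k (upd i z)) * d' k (upd i z))"
          unfolding A B by (subst C) (simp only: mult_ac)
      qed
    qed
  qed

  \<comment> \<open>Both cases use the law on fibres: the new component is standard normal and has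
    second moment 1; for an old component the new variable integrates to 1 and leaves the moment on
    the marginal.\<close>
  have T2: "integrable (lborel_on (insert i I)) (\<lambda>y. g y * (T' k y)\<^sup>2)"
    "(\<integral>y. g y * (T' k y)\<^sup>2 \<partial>lborel_on (insert i I)) = c" if k: "k \<in> insert i I" for k
  proof -
    have "(\<integral>\<^sup>+y. ennreal (g y * (T' k y)\<^sup>2) \<partial>lborel_on (insert i I)) = ennreal c"
    proof (cases "k = i")
      case True
      have "(\<integral>\<^sup>+y. ennreal (g y * (T' k y)\<^sup>2) \<partial>lborel_on (insert i I)) =
         (\<integral>\<^sup>+z. ennreal (g (upd i z)) * ennreal ((T' k (upd i z))\<^sup>2) \<partial>(lborel_on I \<Otimes>\<^sub>M lborel))"
        using k by (subst nn_integral_lborel_on_insert[OF fin]) (auto simp: ennreal_mult nn)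
      also have "\<dots> = (\<integral>\<^sup>+z. ennreal (g (upd i z)) * ennreal ((snd (fst z, F.T z))\<^sup>2) \<partial>(lborel_on I \<Otimes>\<^sub>M lborel))"
        using sp by (intro nn_integral_cong) (simp add: T'_upd True)
      also have "\<dots> = (\<integral>\<^sup>+x. ennreal (gb x) * (\<integral>\<^sup>+u. ennreal (std_normal_density u) * ennreal ((snd (x, u))\<^sup>2) \<partial>lborel) \<partial>lborel_on I)"
        unfolding gb[symmetric] by (rule F.law) measurable
      also have "(\<integral>\<^sup>+u. ennreal (std_normal_density u) * ennreal (u\<^sup>2) \<partial>lborel) = 1"
      proof -
        have "has_bochner_integral lborel (\<lambda>x. std_normal_density x * x ^ (2 * 1)) (fact (2 * 1) / (2 ^ 1 * fact 1))"
          by (rule std_normal_moment_even)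
        then have "has_bochner_integral lborel (\<lambda>x. std_normal_density x * x\<^sup>2) 1" by simp
        then have "(\<integral>\<^sup>+u. ennreal (std_normal_density u * u\<^sup>2) \<partial>lborel) = ennreal 1"
          by (subst nn_integral_eq_integral) (auto simp: has_bochner_integral_iff)
        then show ?thesis by (simp add: ennreal_mult)
      qed
      then have "(\<integral>\<^sup>+x. ennreal (gb x) * (\<integral>\<^sup>+u. ennreal (std_normal_density u) * ennreal ((snd (x, u))\<^sup>2) \<partial>lborel) \<partial>lborel_on I) = (\<integral>\<^sup>+x. ennreal (gb x) \<partial>lborel_on I)"
        by simp
      also have "\<dots> = ennreal c"
        using F.gbar_int F.gbar_nonneg cb unfolding gb by (subst nn_integral_eq_integral) auto
      finally show ?thesis .
    next
      case False
      then have kI: "k \<in> I" using k by simp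
      have "(\<integral>\<^sup>+y. ennreal (g y * (T' k y)\<^sup>2) \<partial>lborel_on (insert i I)) =
         (\<integral>\<^sup>+z. ennreal (g (upd i z)) * ennreal ((T' k (upd i z))\<^sup>2) \<partial>(lborel_on I \<Otimes>\<^sub>M lborel))"
        using k by (subst nn_integral_lborel_on_insert[OF fin]) (auto simp: ennreal_mult nn)
      also have "\<dots> = (\<integral>\<^sup>+z. ennreal (g (upd i z)) * ennreal ((T k (fst (fst z, F.T z)))\<^sup>2) \<partial>(lborel_on I \<Otimes>\<^sub>M lborel))"
        using sp False by (intro nn_integral_cong) (simp add: T'_upd)
      also have "\<dots> = (\<integral>\<^sup>+x. ennreal (gb x) * (\<integral>\<^sup>+u. ennreal (std_normal_density u) * ennreal ((T k (fst (x, u)))\<^sup>2) \<partial>lborel) \<partial>lborel_on I)"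
        unfolding gb[symmetric] using kI by (intro F.law) measurable
      also have "\<dots> = (\<integral>\<^sup>+x. ennreal (gb x * (T k x)\<^sup>2) \<partial>lborel_on I)"
      proof (intro nn_integral_cong)
        fix x
        have "(\<integral>\<^sup>+u. ennreal (std_normal_density u) \<partial>lborel) = 1"
          using integrable_std_normal_density by (subst nn_integral_eq_integral) (auto simp: integral_normal_density)
        then show "ennreal (gb x) * (\<integral>\<^sup>+u. ennreal (std_normal_density u) * ennreal ((T k (fst (x, u)))\<^sup>2) \<partial>lborel) = ennreal (gb x * (T k x)\<^sup>2)"
          using F.gbar_nonneg[of x] by (simp add: nn_integral_multc ennreal_mult gb)
      qed
      also have "\<dots> = ennreal c"
        using ints(1,2)[OF kI] F.gbar_nonneg by (subst nn_integral_eq_integral) (auto simp: gb)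
      finally show ?thesis .
    qed
    moreover have cnn: "0 \<le> c" unfolding c_def by (simp add: nn)
    ultimately have "has_bochner_integral (lborel_on (insert i I)) (\<lambda>y. g y * (T' k y)\<^sup>2) c"
      using k nn by (intro has_bochner_integral_nn_integral) auto
    then show "integrable (lborel_on (insert i I)) (\<lambda>y. g y * (T' k y)\<^sup>2)"
      "(\<integral>y. g y * (T' k y)\<^sup>2 \<partial>lborel_on (insert i I)) = c"
      by (auto simp: has_bochner_integral_iff)
  qed

  \<comment> \<open>Finite Fisher information paired with the second moment just computed.\<close>
  have DT: "integrable (lborel_on (insert i I)) (\<lambda>y. D k y * T' k y)" if k: "k \<in> insert i I" for k
    using k by (intro integrable_deriv_times[OF _ _ gm nn Dzero D(2) T2(1)]) auto

  have parts: "integrable (lborel_on (insert i I)) (\<lambda>y. g y * d' k y) \<and>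
        (\<integral>y. g y * d' k y \<partial>lborel_on (insert i I)) = - (\<integral>y. D k y * T' k y \<partial>lborel_on (insert i I))"
    if k: "k \<in> insert i I" for k
  proof (cases "k = i")
    case True
    have "integrable (lborel_on I \<Otimes>\<^sub>M lborel) (\<lambda>z. D i (upd i z) * T' i (upd i z))"
      by (rule iffD1[OF integrable_lborel_on_insert[OF fin borel_measurable_integrable[OF DT[OF insertI1]]] DT[OF insertI1]])
    then have DTz: "integrable (lborel_on I \<Otimes>\<^sub>M lborel) (\<lambda>z. D i (upd i z) * F.T z)"
      by (rule Bochner_Integration.integrable_cong[THEN iffD1, rotated 2]) (simp_all add: T'_upd sp)
    note P = F.by_parts[OF DTz]
    have "integrable (lborel_on I \<Otimes>\<^sub>M lborel) (\<lambda>z. g (upd i z) * d' i (upd i z))"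
      using P(1) by (rule Bochner_Integration.integrable_cong[THEN iffD1, rotated 2]) (simp_all add: d'_upd sp)
    then have 1: "integrable (lborel_on (insert i I)) (\<lambda>y. g y * d' i y)"
      by (subst integrable_lborel_on_insert[OF fin]) auto
    have "(\<integral>y. g y * d' i y \<partial>lborel_on (insert i I)) = (\<integral>z. g (upd i z) * d' i (upd i z) \<partial>(lborel_on I \<Otimes>\<^sub>M lborel))"
      by (rule integral_lborel_on_insert[OF fin]) simp
    also have "\<dots> = (\<integral>z. g (upd i z) * F.dT z \<partial>(lborel_on I \<Otimes>\<^sub>M lborel))"
      by (intro Bochner_Integration.integral_cong) (simp_all add: d'_upd sp)
    also have "\<dots> = - (\<integral>z. D i (upd i z) * F.T z \<partial>(lborel_on I \<Otimes>\<^sub>M lborel))" by (rule P(2))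
    also have "(\<integral>z. D i (upd i z) * F.T z \<partial>(lborel_on I \<Otimes>\<^sub>M lborel)) = (\<integral>z. D i (upd i z) * T' i (upd i z) \<partial>(lborel_on I \<Otimes>\<^sub>M lborel))"
      by (intro Bochner_Integration.integral_cong) (simp_all add: T'_upd sp)
    also have "\<dots> = (\<integral>y. D i y * T' i y \<partial>lborel_on (insert i I))"
      by (rule integral_lborel_on_insert[OF fin, symmetric]) simp
    finally show ?thesis using 1 True by simp
  next
    case False
    then have kI: "k \<in> I" using k by simp
    have "(\<integral>\<^sup>+y. ennreal (g y * d' k y) \<partial>lborel_on (insert i I)) = ennreal (\<integral>x. gb x * d k x \<partial>lborel_on I)"
    proof -
      have "(\<integral>\<^sup>+y. ennreal (g y * d' k y) \<partial>lborel_on (insert i I)) =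
         (\<integral>\<^sup>+z. ennreal (g (upd i z) * d' k (upd i z)) \<partial>(lborel_on I \<Otimes>\<^sub>M lborel))"
        using k by (intro nn_integral_lborel_on_insert[OF fin]) auto
      also have "\<dots> = (\<integral>\<^sup>+z. ennreal (g (upd i z)) * ennreal (d k (fst z)) \<partial>(lborel_on I \<Otimes>\<^sub>M lborel))"
        using sp False by (intro nn_integral_cong) (simp add: d'_upd ennreal_mult nn dnn kI)
      also have "\<dots> = (\<integral>\<^sup>+x. (\<integral>\<^sup>+s. ennreal (g (upd i (x, s))) \<partial>lborel) * ennreal (d k x) \<partial>lborel_on I)"
        using kI by (subst lborel.nn_integral_fst[symmetric]) (auto intro!: nn_integral_cong nn_integral_multc)
      also have "\<dots> = (\<integral>\<^sup>+x. ennreal (gb x * d k x) \<partial>lborel_on I)"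
      proof (rule nn_integral_cong_AE)
        show "AE x in lborel_on I. (\<integral>\<^sup>+s. ennreal (g (upd i (x, s))) \<partial>lborel) * ennreal (d k x) = ennreal (gb x * d k x)"
          using F.NL.AE_integrable_fst'[OF gz]
        proof eventually_elim
          case (elim x)
          then have "(\<integral>\<^sup>+s. ennreal (g (upd i (x, s))) \<partial>lborel) = ennreal (gb x)"
            unfolding gb_def by (intro nn_integral_eq_integral) (auto simp: nn)
          then show ?case using F.gbar_nonneg[of x] by (simp add: ennreal_mult dnn[OF kI] gb)
        qed
      qed
      also have "\<dots> = ennreal (\<integral>x. gb x * d k x \<partial>lborel_on I)"
        using ints(4)[OF kI] F.gbar_nonneg dnn[OF kI] by (intro nn_integral_eq_integral) (auto simp: gb)
      finally show ?thesis .
    qed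
    moreover have "0 \<le> (\<integral>x. gb x * d k x \<partial>lborel_on I)"
      using F.gbar_nonneg dnn[OF kI] by (auto simp: gb)
    moreover have "0 \<le> d' k y" for y using dnn[OF kI] False by (simp add: d'_def)
    ultimately have hb: "has_bochner_integral (lborel_on (insert i I)) (\<lambda>y. g y * d' k y) (\<integral>x. gb x * d k x \<partial>lborel_on I)"
      using k nn by (intro has_bochner_integral_nn_integral) auto
    have DTz: "integrable (lborel_on I \<Otimes>\<^sub>M lborel) (\<lambda>z. D k (upd i z) * T' k (upd i z))"
      by (rule iffD1[OF integrable_lborel_on_insert[OF fin borel_measurable_integrable[OF DT[OF k]]] DT[OF k]])
    have "(\<integral>y. D k y * T' k y \<partial>lborel_on (insert i I)) = (\<integral>z. D k (upd i z) * T' k (upd i z) \<partial>(lborel_on I \<Otimes>\<^sub>M lborel))"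
      using k by (intro integral_lborel_on_insert[OF fin]) simp
    also have "\<dots> = (\<integral>x. (\<integral>s. D k (upd i (x, s)) * T' k (upd i (x, s)) \<partial>lborel) \<partial>lborel_on I)"
      using F.NL.integral_fst'[OF DTz] by simp
    \<comment> \<open>\<open>T' k\<close> is constant along the fibre, so the inner integral falls
      on \<open>D k\<close> alone and produces the derivative \<open>Db k\<close> of the
      marginal.\<close>
    also have "\<dots> = (\<integral>x. Db k x * T k x \<partial>lborel_on I)"
      unfolding Db_def using False by (intro Bochner_Integration.integral_cong refl) (simp add: T'_upd)
    finally show ?thesis using hb ints(5)[OF kI] by (simp add: has_bochner_integral_iff)
  qed

  have "Knothe_map (insert i I) g D T' d'"
    unfolding Knothe_map_def c_def[symmetric]
  proof (intro conjI ballI allI)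
    fix k y assume k: "k \<in> insert i I"
    show "T' k \<in> borel_measurable (lborel_on (insert i I))" "d' k \<in> borel_measurable (lborel_on (insert i I))"
      using k by simp_all
    show "0 \<le> d' k y" using k dnn F.dT_nonneg by (auto simp: d'_def)
  next
    fix h :: "('a \<Rightarrow> real) \<Rightarrow> ennreal" assume "h \<in> borel_measurable (lborel_on (insert i I))"
    then show "(\<integral>\<^sup>+y. ennreal (g y) * h (\<lambda>k\<in>insert i I. T' k y) \<partial>lborel_on (insert i I)) =
        ennreal c * (\<integral>\<^sup>+u. ennreal (\<Prod>k\<in>insert i I. std_normal_density (u k)) * h u \<partial>lborel_on (insert i I))"
      by (rule law')
  next
    fix k assume k: "k \<in> insert i I"
    show "integrable (lborel_on (insert i I)) (\<lambda>y. g y * (T' k y)\<^sup>2)"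
      "(\<integral>y. g y * (T' k y)\<^sup>2 \<partial>lborel_on (insert i I)) = c"
      using T2[OF k] by auto
    show "integrable (lborel_on (insert i I)) (\<lambda>y. D k y * T' k y)" by (rule DT[OF k])
    show "integrable (lborel_on (insert i I)) (\<lambda>y. g y * d' k y)"
      "(\<integral>y. g y * d' k y \<partial>lborel_on (insert i I)) = - (\<integral>y. D k y * T' k y \<partial>lborel_on (insert i I))"
      using parts[OF k] by auto
  qed (rule factor')
  then show ?case by blast
qed

subsection \<open>Weak derivatives and absolute continuity on lines\<close>

text \<open>The smoothness half of \<open>test_function\<close>. A multiplier such as the Gaussian
  density has no compact support, but its product with a test function is a test function.\<close>

definition C1_fun :: "('a::euclidean_space \<Rightarrow> real) \<Rightarrow> bool" where
  "C1_fun \<phi> \<longleftrightarrow> (\<forall>x. \<phi> differentiable (at x)) \<and>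
     (\<forall>v. continuous_on UNIV (\<lambda>x. frechet_derivative \<phi> (at x) v))"

lemma test_function_iff: "test_function \<phi> \<longleftrightarrow> C1_fun \<phi> \<and> compact (closure {x. \<phi> x \<noteq> 0})"
  by (auto simp: test_function_def C1_fun_def)

lemma C1_funI:
  assumes "\<And>x. (\<phi> has_derivative \<phi>' x) (at x)" "\<And>v. continuous_on UNIV (\<lambda>x. \<phi>' x v)"
  shows "C1_fun \<phi>"
proof -
  have "frechet_derivative \<phi> (at x) = \<phi>' x" for x
    using frechet_derivative_at[OF assms(1)[of x]] by simp
  then show ?thesis using assms by (auto simp: C1_fun_def differentiable_def)
qed

lemma C1_fun_has_derivative:
  "C1_fun \<phi> \<Longrightarrow> (\<phi> has_derivative frechet_derivative \<phi> (at x)) (at x)"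
  by (simp add: C1_fun_def frechet_derivative_works[symmetric])

lemma C1_fun_continuous: "C1_fun \<phi> \<Longrightarrow> continuous_on UNIV \<phi>"
  by (meson C1_fun_has_derivative continuous_at_imp_continuous_on has_derivative_continuous)

lemma C1_fun_continuous_deriv: "C1_fun \<phi> \<Longrightarrow> continuous_on UNIV (\<lambda>x. frechet_derivative \<phi> (at x) v)"
  by (simp add: C1_fun_def)

lemma C1_fun_measurable:
  assumes "C1_fun \<phi>"
  shows "\<phi> \<in> borel_measurable borel" "(\<lambda>x. frechet_derivative \<phi> (at x) v) \<in> borel_measurable borel"
  using C1_fun_continuous[OF assms] C1_fun_continuous_deriv[OF assms]
  by (auto intro: borel_measurable_continuous_onI)

lemma frechet_derivative_mult:
  assumes "C1_fun \<phi>" "C1_fun \<eta>"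
  shows "frechet_derivative (\<lambda>x. \<eta> x * \<phi> x) (at x) v =
    \<eta> x * frechet_derivative \<phi> (at x) v + frechet_derivative \<eta> (at x) v * \<phi> x"
  using frechet_derivative_at[OF has_derivative_mult[OF C1_fun_has_derivative[OF assms(2)] C1_fun_has_derivative[OF assms(1)]], of x]
  by metis

lemma C1_fun_mult:
  assumes "C1_fun \<phi>" "C1_fun \<eta>"
  shows "C1_fun (\<lambda>x. \<eta> x * \<phi> x)"
  by (rule C1_funI[OF has_derivative_mult[OF C1_fun_has_derivative[OF assms(2)] C1_fun_has_derivative[OF assms(1)]]])
     (intro continuous_intros C1_fun_continuous C1_fun_continuous_deriv assms)

lemma C1_fun_const: "C1_fun (\<lambda>_. c)"
  by (rule C1_funI[of _ "\<lambda>_ _. 0"]) auto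

lemma C1_fun_prod: "finite I \<Longrightarrow> (\<And>i. i \<in> I \<Longrightarrow> C1_fun (\<phi> i)) \<Longrightarrow> C1_fun (\<lambda>x. \<Prod>i\<in>I. \<phi> i x)"
  by (induction rule: finite_induct) (auto intro: C1_fun_const C1_fun_mult)

lemma test_function_mult:
  assumes "test_function \<phi>" "C1_fun \<eta>"
  shows "test_function (\<lambda>x. \<eta> x * \<phi> x)"
proof -
  have "bounded {x. \<phi> x \<noteq> 0}"
    using assms(1) by (simp add: test_function_iff compact_closure)
  then have "bounded {x. \<eta> x * \<phi> x \<noteq> 0}" by (rule bounded_subset) auto
  then have "compact (closure {x. \<eta> x * \<phi> x \<noteq> 0})" by (simp only: compact_closure)
  then show ?thesis using assms by (auto simp: test_function_iff intro: C1_fun_mult)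
qed

lemma test_function_translate:
  assumes "test_function \<phi>"
  shows "test_function (\<lambda>x. \<phi> (x + c))"
    and "frechet_derivative (\<lambda>x. \<phi> (x + c)) (at x) = frechet_derivative \<phi> (at (x + c))"
proof -
  have C: "C1_fun \<phi>" using assms by (simp add: test_function_iff)
  have d: "((\<lambda>x. \<phi> (x + c)) has_derivative frechet_derivative \<phi> (at (x + c))) (at x)" for x
  proof -
    have "((\<lambda>x. x + c) has_derivative (\<lambda>h. h)) (at x)" by (auto intro!: derivative_eq_intros)
    from has_derivative_compose[OF this C1_fun_has_derivative[OF C]] show ?thesis .
  qed
  show "frechet_derivative (\<lambda>x. \<phi> (x + c)) (at x) = frechet_derivative \<phi> (at (x + c))"
    using frechet_derivative_at[OF d] by simp
  have "continuous_on UNIV (\<lambda>x. frechet_derivative \<phi> (at (x + c)) v)" for v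
    by (rule continuous_on_compose2[OF C1_fun_continuous_deriv[OF C, of v]])
      (simp_all add: continuous_on_add)
  then have "C1_fun (\<lambda>x. \<phi> (x + c))" by (rule C1_funI[OF d])
  moreover have "compact (closure {x. \<phi> (x + c) \<noteq> 0})"
  proof -
    have "{x. \<phi> (x + c) \<noteq> 0} = (\<lambda>x. - c + x) ` {x. \<phi> x \<noteq> 0}"
      by (auto simp: image_iff intro!: exI[of _ "_ + c"])
    then show ?thesis
      using assms by (simp add: test_function_iff bounded_translation_minus)
  qed
  ultimately show "test_function (\<lambda>x. \<phi> (x + c))" by (simp add: test_function_iff)
qed

lemma test_function_bounds:
  assumes "test_function \<phi>"
  obtains r B where "0 < r" "0 < B" "\<And>x. \<bar>\<phi> x\<bar> \<le> B" "\<And>x. \<bar>frechet_derivative \<phi> (at x) v\<bar> \<le> B"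
    "\<And>x. norm x > r \<Longrightarrow> \<phi> x = 0" "\<And>x. norm x > r \<Longrightarrow> frechet_derivative \<phi> (at x) v = 0"
proof -
  define K where "K = closure {x. \<phi> x \<noteq> 0}"
  have K: "compact K" using assms by (simp add: test_function_iff K_def)
  have C: "C1_fun \<phi>" using assms by (simp add: test_function_iff)
  have 0: "\<phi> x = 0" if "x \<notin> K" for x
    using that closure_subset[of "{x. \<phi> x \<noteq> 0}"] by (auto simp: K_def)
  \<comment> \<open>Off the closed support the function vanishes on a neighbourhood, hence so does
    its derivative.\<close>
  have 1: "frechet_derivative \<phi> (at x) v = 0" if "x \<notin> K" for x
  proof -
    have "open (- K)" using K by (simp add: compact_imp_closed open_Compl)
    have "((\<lambda>_. 0) has_derivative (\<lambda>_. 0)) (at x)" by simp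
    then have "(\<phi> has_derivative (\<lambda>_. 0)) (at x)"
      by (rule has_derivative_transform_within_open[OF _ \<open>open (- K)\<close>]) (use that 0 in auto)
    then have "(\<lambda>_. 0) = frechet_derivative \<phi> (at x)" by (rule frechet_derivative_at)
    then show ?thesis by metis
  qed
  obtain r0 where r0: "\<And>x. x \<in> K \<Longrightarrow> norm x \<le> r0"
    using compact_imp_bounded[OF K] by (auto simp: bounded_iff)
  have "bounded (\<phi> ` K)" 
    using K C1_fun_continuous[OF C] by (intro compact_imp_bounded compact_continuous_image) (auto intro: continuous_on_subset)
  then obtain B1 where B1: "\<And>x. x \<in> K \<Longrightarrow> \<bar>\<phi> x\<bar> \<le> B1" by (auto simp: bounded_iff)
  have "bounded ((\<lambda>x. frechet_derivative \<phi> (at x) v) ` K)" 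
    using K C1_fun_continuous_deriv[OF C] by (intro compact_imp_bounded compact_continuous_image) (auto intro: continuous_on_subset)
  then obtain B2 where B2: "\<And>x. x \<in> K \<Longrightarrow> \<bar>frechet_derivative \<phi> (at x) v\<bar> \<le> B2" by (auto simp: bounded_iff)
  show ?thesis
  proof (rule that[of "max r0 1" "max (max B1 B2) 1"])
    show "\<bar>\<phi> x\<bar> \<le> max (max B1 B2) 1" for x
      using B1[of x] 0[of x] by (cases "x \<in> K") auto
    show "\<bar>frechet_derivative \<phi> (at x) v\<bar> \<le> max (max B1 B2) 1" for x
      using B2[of x] 1[of x] by (cases "x \<in> K") auto
    show "\<phi> x = 0" if "max r0 1 < norm x" for x using that r0[of x] 0[of x] by (cases "x \<in> K") auto
    show "frechet_derivative \<phi> (at x) v = 0" if "max r0 1 < norm x" for x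
      using that r0[of x] 1[of x] by (cases "x \<in> K") auto
  qed auto
qed

section \<open>Continuously differentiable approximations of box indicators\<close>

text \<open>A stand-in for the indicator of the positive half-line: the square makes it flat to
  first order at 0, the quotient keeps it below 1, and \<open>ramp (k * t)\<close> tends to 1 for
  each positive \<open>t\<close> as \<open>k\<close> grows.\<close>

definition ramp :: "real \<Rightarrow> real" where
  "ramp t = (max 0 t)\<^sup>2 / (1 + (max 0 t)\<^sup>2)"

lemma ramp_has_derivative:
  "(ramp has_real_derivative 2 * max 0 t / (1 + (max 0 t)\<^sup>2)\<^sup>2) (at t)"
proof -
  have sq: "((\<lambda>t. (max 0 t)\<^sup>2) has_real_derivative 2 * max 0 t) (at t)"
  proof (cases t "0::real" rule: linorder_cases)
    case less
    have "((\<lambda>_. 0) has_real_derivative 0) (at t)" by simp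
    then have "((\<lambda>t. (max 0 t)\<^sup>2) has_real_derivative 0) (at t)"
      by (rule has_field_derivative_transform_within_open[of _ _ _ "{..<0}"]) (use less in auto)
    then show ?thesis using less by simp
  next
    case greater
    have "((\<lambda>t. t\<^sup>2) has_real_derivative 2 * t) (at t)" by (auto intro!: derivative_eq_intros)
    then have "((\<lambda>t. (max 0 t)\<^sup>2) has_real_derivative 2 * t) (at t)"
      by (rule has_field_derivative_transform_within_open[of _ _ _ "{0<..}"]) (use greater in auto)
    then show ?thesis using greater by simp
  next
    case equal
    have "((\<lambda>h. ((max 0 (0 + h))\<^sup>2 - (max 0 0)\<^sup>2) / h) \<longlongrightarrow> (0::real)) (at 0)"
    proof (rule Lim_null_comparison)
      show "((\<lambda>h::real. \<bar>h\<bar>) \<longlongrightarrow> 0) (at 0)" by (auto intro!: tendsto_eq_intros)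
      show "\<forall>\<^sub>F h in at 0. norm (((max 0 (0 + h))\<^sup>2 - (max 0 0)\<^sup>2) / h) \<le> \<bar>h::real\<bar>"
        by (intro always_eventually) (auto simp: max_def power2_eq_square abs_mult)
    qed
    then show ?thesis using equal by (simp add: DERIV_def)
  qed
  have d2: "((\<lambda>t. 1 + (max 0 t)\<^sup>2) has_real_derivative 2 * max 0 t) (at t)"
    using DERIV_add[OF DERIV_const sq] by simp
  have pos: "1 + (max 0 t)\<^sup>2 \<noteq> 0" by (smt (verit) zero_le_power2)
  have "((\<lambda>t. (max 0 t)\<^sup>2 / (1 + (max 0 t)\<^sup>2)) has_real_derivative
     (2 * max 0 t * (1 + (max 0 t)\<^sup>2) - (max 0 t)\<^sup>2 * (2 * max 0 t)) / ((1 + (max 0 t)\<^sup>2) * (1 + (max 0 t)\<^sup>2))) (at t)"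
    using DERIV_divide[OF sq d2 pos] .
  then show ?thesis
    unfolding ramp_def[abs_def] by (simp add: power2_eq_square algebra_simps)
qed

lemma ramp_bounds: "0 \<le> ramp t" "ramp t \<le> 1"
  unfolding ramp_def by (auto simp: divide_le_eq_1 intro!: divide_nonneg_pos add_pos_nonneg)

lemma ramp_nonpos: "t \<le> 0 \<Longrightarrow> ramp t = 0"
  by (simp add: ramp_def)

lemma ramp_pos: "0 < t \<Longrightarrow> 0 < ramp t"
  by (simp add: ramp_def add_pos_pos)

lemma ramp_limit: "0 < t \<Longrightarrow> (\<lambda>k. ramp (real k * t)) \<longlonglongrightarrow> 1"
  unfolding ramp_def by real_asymp

lemma C1_fun_ramp: "C1_fun (\<lambda>x. ramp (c + x \<bullet> v))"
proof (rule C1_funI)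
  show "((\<lambda>x. ramp (c + x \<bullet> v)) has_derivative
     (\<lambda>h. (2 * max 0 (c + x \<bullet> v) / (1 + (max 0 (c + x \<bullet> v))\<^sup>2)\<^sup>2) * (h \<bullet> v))) (at x)" for x
  proof -
    have "((\<lambda>x. c + x \<bullet> v) has_derivative (\<lambda>h. h \<bullet> v)) (at x)"
      by (auto intro!: derivative_eq_intros)
    from has_derivative_compose[OF this ramp_has_derivative[THEN has_field_derivative_imp_has_derivative]]
    show ?thesis by (simp add: mult.commute)
  qed
  show "continuous_on UNIV (\<lambda>x. (2 * max 0 (c + x \<bullet> v) / (1 + (max 0 (c + x \<bullet> v))\<^sup>2)\<^sup>2) * (w \<bullet> v))" for w
    by (intro continuous_intros) (smt (verit) zero_le_power2 power_eq_0_iff)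
qed

text \<open>Test functions that converge at every point to the indicator of the open box.
  \<open>k\<close> is the steepness; already \<open>k = 1\<close> is positive throughout the box,
  which serves to localise.\<close>

definition box_bump :: "nat \<Rightarrow> 'a::euclidean_space \<Rightarrow> 'a \<Rightarrow> 'a \<Rightarrow> real" where
  "box_bump k a b x = (\<Prod>i\<in>Basis. ramp (real k * (x \<bullet> i - a \<bullet> i)) * ramp (real k * (b \<bullet> i - x \<bullet> i)))"

lemma box_bump_bounds: "0 \<le> box_bump k a b x" "box_bump k a b x \<le> 1"
  unfolding box_bump_def using ramp_bounds
  by (auto intro!: prod_nonneg prod_le_1 mult_le_one mult_nonneg_nonneg)

lemma box_bump_eq_0: "x \<notin> box a b \<Longrightarrow> box_bump k a b x = 0"
  unfolding box_bump_def mem_box by (auto simp: ramp_nonpos mult_nonneg_nonpos intro!: bexI)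

lemma box_bump_pos: "x \<in> box a b \<Longrightarrow> 0 < box_bump 1 a b x"
  unfolding box_bump_def mem_box by (auto intro!: prod_pos mult_pos_pos ramp_pos)

lemma box_bump_limit: "(\<lambda>k. box_bump k a b x) \<longlonglongrightarrow> indicator (box a b) x"
proof (cases "x \<in> box a b")
  case True
  have "(\<lambda>k. box_bump k a b x) \<longlonglongrightarrow> (\<Prod>i\<in>(Basis::'a set). 1 * 1)"
    unfolding box_bump_def using True
    by (intro tendsto_prod tendsto_mult ramp_limit) (auto simp: mem_box)
  then show ?thesis using True by simp
qed (simp add: box_bump_eq_0)

lemma C1_fun_box_bump: "C1_fun (box_bump k a b)"
proof -
  have "C1_fun (\<lambda>x. ramp (real k * (x \<bullet> i - a \<bullet> i)) * ramp (real k * (b \<bullet> i - x \<bullet> i)))" for i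
  proof -
    have "C1_fun (\<lambda>x. ramp (- (real k * (a \<bullet> i)) + x \<bullet> (real k *\<^sub>R i)) * ramp (real k * (b \<bullet> i) + x \<bullet> (- real k *\<^sub>R i)))"
      by (intro C1_fun_mult C1_fun_ramp)
    then show ?thesis by (simp add: algebra_simps)
  qed
  then show ?thesis unfolding box_bump_def[abs_def] by (intro C1_fun_prod) auto
qed

lemma test_function_box_bump: "test_function (box_bump k a b)"
proof -
  have "closure {x. box_bump k a b x \<noteq> 0} \<subseteq> cbox a b"
  proof (rule closure_minimal)
    show "{x. box_bump k a b x \<noteq> 0} \<subseteq> cbox a b"
      using box_bump_eq_0[of _ a b k] box_subset_cbox[of a b] by blast
  qed (rule closed_cbox)
  then have "compact (closure {x. box_bump k a b x \<noteq> 0})"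
    by (meson bounded_cbox bounded_subset closed_closure compact_eq_bounded_closed)
  then show ?thesis by (simp add: test_function_iff C1_fun_box_bump)
qed

section \<open>From weak partial derivatives to absolute continuity on lines\<close>

text \<open>One direction of \<open>weak_gradient\<close>, split off because it is real-valued and
  stable under multiplication by \<open>C1_fun\<close> functions.\<close>

definition weak_partial :: "'a::euclidean_space \<Rightarrow> ('a \<Rightarrow> real) \<Rightarrow> ('a \<Rightarrow> real) \<Rightarrow> bool" where
  "weak_partial i g h \<longleftrightarrow> locally_integrable g \<and> locally_integrable h \<and>
     (\<forall>\<phi>. test_function \<phi> \<longrightarrow>
        (\<integral>x. g x * frechet_derivative \<phi> (at x) i \<partial>lborel) = - (\<integral>x. h x * \<phi> x \<partial>lborel))"

lemma locally_integrable_measurable: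
  fixes g :: "'a::euclidean_space \<Rightarrow> 'b::{banach,second_countable_topology}"
  assumes "locally_integrable g" shows "g \<in> borel_measurable borel"
proof (rule borel_measurable_LIMSEQ_metric)
  show "(\<lambda>x. indicator (cball 0 (real n)) x *\<^sub>R g x) \<in> borel_measurable borel" for n
  proof -
    have "integrable lborel (\<lambda>x. indicator (cball 0 (real n)) x *\<^sub>R g x)"
      using assms compact_cball[of 0 "real n"] by (simp add: locally_integrable_def set_integrable_def)
    from borel_measurable_integrable[OF this] show ?thesis by simp
  qed
  show "(\<lambda>n. indicator (cball 0 (real n)) x *\<^sub>R g x) \<longlonglongrightarrow> g x" for x :: 'a
  proof -
    obtain N :: nat where N: "norm x < N" using reals_Archimedean2 by blast
    then have "eventually (\<lambda>n. indicator (cball 0 (real n)) x *\<^sub>R g x = g x) sequentially"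
      by (intro eventually_sequentiallyI[of N]) (auto simp: indicator_def)
    then show ?thesis by (rule tendsto_eventually)
  qed
qed

lemma integrable_mult_compact_support:
  fixes g \<psi> :: "'a::euclidean_space \<Rightarrow> real"
  assumes g: "locally_integrable g" and [measurable]: "\<psi> \<in> borel_measurable borel"
    and B: "\<And>x. \<bar>\<psi> x\<bar> \<le> B" and r: "\<And>x. norm x > r \<Longrightarrow> \<psi> x = 0"
  shows "integrable lborel (\<lambda>x. g x * \<psi> x)"
proof -
  have [measurable]: "g \<in> borel_measurable borel" by (rule locally_integrable_measurable[OF g])
  have "integrable lborel (\<lambda>x. indicator (cball 0 r) x * g x)"
    using g by (auto simp: locally_integrable_def set_integrable_def)
  then have "integrable lborel (\<lambda>x. B * (indicator (cball 0 r) x * g x))" by simp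
  then show ?thesis
  proof (rule Bochner_Integration.integrable_bound)
    show "AE x in lborel. norm (g x * \<psi> x) \<le> norm (B * (indicator (cball 0 r) x * g x))"
    proof (rule AE_I2)
      fix x
      have "0 \<le> B" using B[of x] by linarith
      then show "norm (g x * \<psi> x) \<le> norm (B * (indicator (cball 0 r) x * g x))"
        using B[of x] r[of x] by (cases "norm x \<le> r") (auto simp: abs_mult mult.commute intro: mult_right_mono)
    qed
  qed simp
qed

lemma integrable_mult_test:
  assumes "locally_integrable g" "test_function \<phi>"
  shows "integrable lborel (\<lambda>x. g x * \<phi> x)" "integrable lborel (\<lambda>x. g x * frechet_derivative \<phi> (at x) v)"
proof -
  obtain r B where b: "0 < r" "0 < B" "\<And>x. \<bar>\<phi> x\<bar> \<le> B" "\<And>x. \<bar>frechet_derivative \<phi> (at x) v\<bar> \<le> B"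
    "\<And>x. norm x > r \<Longrightarrow> \<phi> x = 0" "\<And>x. norm x > r \<Longrightarrow> frechet_derivative \<phi> (at x) v = 0"
    using test_function_bounds[OF assms(2), of v] by metis
  have C: "C1_fun \<phi>" using assms by (simp add: test_function_iff)
  show "integrable lborel (\<lambda>x. g x * \<phi> x)" "integrable lborel (\<lambda>x. g x * frechet_derivative \<phi> (at x) v)"
    using integrable_mult_compact_support[OF assms(1) C1_fun_measurable(1)[OF C] b(3,5)]
      integrable_mult_compact_support[OF assms(1) C1_fun_measurable(2)[OF C] b(4,6)] by auto
qed

lemma locally_integrable_mult:
  fixes g :: "'a::euclidean_space \<Rightarrow> real"
  assumes g: "locally_integrable g" and c: "continuous_on UNIV \<eta>"
  shows "locally_integrable (\<lambda>x. \<eta> x * g x)"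
  unfolding locally_integrable_def
proof (intro allI impI)
  fix K :: "'a set" assume K: "compact K"
  have [measurable]: "g \<in> borel_measurable borel" by (rule locally_integrable_measurable[OF g])
  have [measurable]: "\<eta> \<in> borel_measurable borel" using c by (rule borel_measurable_continuous_onI)
  have "bounded (\<eta> ` K)"
    using K c by (intro compact_imp_bounded compact_continuous_image) (auto intro: continuous_on_subset)
  then obtain B where B: "\<And>x. x \<in> K \<Longrightarrow> \<bar>\<eta> x\<bar> \<le> B" by (auto simp: bounded_iff)
  have "integrable lborel (\<lambda>x. B * (indicator K x * g x))"
    using g K by (auto simp: locally_integrable_def set_integrable_def)
  then show "set_integrable lborel K (\<lambda>x. \<eta> x * g x)"
    unfolding set_integrable_def
  proof (rule Bochner_Integration.integrable_bound)
    have [measurable]: "K \<in> sets borel" using K by (simp add: compact_imp_closed borel_closed)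
    show "(\<lambda>x. indicator K x *\<^sub>R (\<eta> x * g x)) \<in> borel_measurable lborel" by simp
    show "AE x in lborel. norm (indicator K x *\<^sub>R (\<eta> x * g x)) \<le> norm (B * (indicator K x * g x))"
    proof (rule AE_I2)
      fix x
      show "norm (indicator K x *\<^sub>R (\<eta> x * g x)) \<le> norm (B * (indicator K x * g x))"
      proof (cases "x \<in> K")
        case True
        then have "\<bar>\<eta> x\<bar> \<le> \<bar>B\<bar>" using B[of x] by linarith
        then show ?thesis using True by (auto simp: abs_mult intro: mult_right_mono)
      qed simp
    qed
  qed
qed

lemma locally_integrable_add:
  fixes g h :: "'a::euclidean_space \<Rightarrow> real"
  shows "locally_integrable g \<Longrightarrow> locally_integrable h \<Longrightarrow> locally_integrable (\<lambda>x. g x + h x)"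
  by (auto simp: locally_integrable_def intro: set_integral_add)

text \<open>For a test function \<phi>, the product of \<eta> and \<phi> is a test function too;
  testing with it and expanding its derivative gives the product rule.\<close>

lemma weak_partial_mult:
  assumes W: "weak_partial i g h" and C: "C1_fun \<eta>"
  shows "weak_partial i (\<lambda>x. \<eta> x * g x) (\<lambda>x. \<eta> x * h x + frechet_derivative \<eta> (at x) i * g x)"
  unfolding weak_partial_def
proof (intro conjI allI impI)
  have g: "locally_integrable g" and h: "locally_integrable h" using W by (auto simp: weak_partial_def)
  show l1: "locally_integrable (\<lambda>x. \<eta> x * g x)"
    by (rule locally_integrable_mult[OF g C1_fun_continuous[OF C]])
  have l2: "locally_integrable (\<lambda>x. \<eta> x * h x)"
    by (rule locally_integrable_mult[OF h C1_fun_continuous[OF C]])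
  have l3: "locally_integrable (\<lambda>x. frechet_derivative \<eta> (at x) i * g x)"
    by (rule locally_integrable_mult[OF g C1_fun_continuous_deriv[OF C]])
  show "locally_integrable (\<lambda>x. \<eta> x * h x + frechet_derivative \<eta> (at x) i * g x)"
    by (rule locally_integrable_add[OF l2 l3])
  fix \<phi> :: "'a \<Rightarrow> real" assume \<phi>: "test_function \<phi>"
  then have C': "C1_fun \<phi>" by (simp add: test_function_iff)
  note I = integrable_mult_test[OF l1 \<phi>] integrable_mult_test[OF l2 \<phi>] integrable_mult_test[OF l3 \<phi>]
  have "(\<integral>x. g x * frechet_derivative (\<lambda>x. \<eta> x * \<phi> x) (at x) i \<partial>lborel) = - (\<integral>x. h x * (\<eta> x * \<phi> x) \<partial>lborel)"
    using W test_function_mult[OF \<phi> C] by (simp add: weak_partial_def)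
  moreover have "(\<integral>x. g x * frechet_derivative (\<lambda>x. \<eta> x * \<phi> x) (at x) i \<partial>lborel) =
    (\<integral>x. \<eta> x * g x * frechet_derivative \<phi> (at x) i + frechet_derivative \<eta> (at x) i * g x * \<phi> x \<partial>lborel)"
    by (intro Bochner_Integration.integral_cong) (auto simp: frechet_derivative_mult[OF C' C] algebra_simps)
  moreover have "\<dots> = (\<integral>x. \<eta> x * g x * frechet_derivative \<phi> (at x) i \<partial>lborel) + (\<integral>x. frechet_derivative \<eta> (at x) i * g x * \<phi> x \<partial>lborel)"
    using I by (intro Bochner_Integration.integral_add) auto
  moreover have "(\<integral>x. (\<eta> x * h x + frechet_derivative \<eta> (at x) i * g x) * \<phi> x \<partial>lborel) =
    (\<integral>x. \<eta> x * h x * \<phi> x \<partial>lborel) + (\<integral>x. frechet_derivative \<eta> (at x) i * g x * \<phi> x \<partial>lborel)"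
    using I by (simp add: distrib_right)
  moreover have "(\<integral>x. h x * (\<eta> x * \<phi> x) \<partial>lborel) = (\<integral>x. \<eta> x * h x * \<phi> x \<partial>lborel)"
    by (simp add: mult_ac)
  ultimately show "(\<integral>x. \<eta> x * g x * frechet_derivative \<phi> (at x) i \<partial>lborel) =
    - (\<integral>x. (\<eta> x * h x + frechet_derivative \<eta> (at x) i * g x) * \<phi> x \<partial>lborel)" by linarith
qed

lemma nn_integral_lborel_shift:
  fixes c :: "'a::euclidean_space"
  assumes [measurable]: "f \<in> borel_measurable borel"
  shows "(\<integral>\<^sup>+x. f (x + c) \<partial>lborel) = (\<integral>\<^sup>+x. f x \<partial>lborel)"
proof -
  have "(\<integral>\<^sup>+x. f x \<partial>lborel) = (\<integral>\<^sup>+x. f x \<partial>distr lborel borel ((+) c))"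
    by (simp add: lborel_distr_plus)
  also have "\<dots> = (\<integral>\<^sup>+x. f (x + c) \<partial>lborel)" by (subst nn_integral_distr) (auto simp: add.commute)
  finally show ?thesis ..
qed

lemma integral_lborel_shift:
  fixes c :: "'a::euclidean_space" and f :: "'a \<Rightarrow> real"
  assumes [measurable]: "f \<in> borel_measurable borel"
  shows "(\<integral>x. f (x + c) \<partial>lborel) = (\<integral>x. f x \<partial>lborel)"
proof -
  have "(\<integral>x. f x \<partial>lborel) = (\<integral>x. f x \<partial>distr lborel borel ((+) c))"
    by (simp add: lborel_distr_plus)
  also have "\<dots> = (\<integral>x. f (x + c) \<partial>lborel)" by (subst integral_distr) (auto simp: add.commute)
  finally show ?thesis ..
qed

text \<open>The test function is slid along \<open>i\<close> to infinity. By weak differentiability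
  the pairing of \<open>g\<close> with the translate of \<phi> by \<open>t * i\<close> changes at
  the rate of minus the pairing of \<open>h\<close> with that translate, and it tends to 0 as
  \<open>t\<close> grows. Integrating the rate over all \<open>t\<close> and shifting back leaves
  the integral of \<open>h\<close> along a ray.\<close>

lemma weak_partial_test_eq:
  fixes g h :: "'a::euclidean_space \<Rightarrow> real"
  assumes W: "weak_partial i g h" and g: "integrable lborel g" and h: "integrable lborel h"
    and i: "i \<in> Basis" and \<phi>: "test_function \<phi>"
  shows "integrable lborel (\<lambda>x. \<phi> x * (\<integral>s. indicator {0..} s * h (x - s *\<^sub>R i) \<partial>lborel))"
    and "(\<integral>x. \<phi> x * g x \<partial>lborel) = (\<integral>x. \<phi> x * (\<integral>s. indicator {0..} s * h (x - s *\<^sub>R i) \<partial>lborel) \<partial>lborel)"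
proof -
  have [measurable]: "g \<in> borel_measurable borel" "h \<in> borel_measurable borel" using g h by auto
  have C: "C1_fun \<phi>" using \<phi> by (simp add: test_function_iff)
  note [measurable] = C1_fun_measurable[OF C]
  obtain r B where r: "0 < r" "0 < B" "\<And>x. \<bar>\<phi> x\<bar> \<le> B" "\<And>x. \<bar>frechet_derivative \<phi> (at x) i\<bar> \<le> B"
    "\<And>x. norm x > r \<Longrightarrow> \<phi> x = 0"
    using test_function_bounds[OF \<phi>, of i] by metis
  have supp: "\<phi> (x + s *\<^sub>R i) = 0" if "r < \<bar>x \<bullet> i + s\<bar>" for x s
  proof -
    have "\<bar>(x + s *\<^sub>R i) \<bullet> i\<bar> \<le> norm (x + s *\<^sub>R i)" using i by (rule Basis_le_norm)
    moreover have "(x + s *\<^sub>R i) \<bullet> i = x \<bullet> i + s" using i by (simp add: inner_add_left)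
    ultimately show ?thesis using that by (intro r(5)) simp
  qed
  \<comment> \<open>Every line parallel to \<open>i\<close> meets the support of \<phi> in length at
    most \<open>2 * r\<close>; this uniform bound gives integrability over the unbounded range of
    shifts.\<close>
  have bound: "(\<integral>\<^sup>+s. ennreal \<bar>\<phi> (x + s *\<^sub>R i)\<bar> \<partial>lborel) \<le> ennreal (2 * r * B)" for x
  proof -
    have "(\<integral>\<^sup>+s. ennreal \<bar>\<phi> (x + s *\<^sub>R i)\<bar> \<partial>lborel) \<le> (\<integral>\<^sup>+s. ennreal B * indicator {- r - x \<bullet> i .. r - x \<bullet> i} s \<partial>lborel)"
    proof (rule nn_integral_mono)
      fix s
      show "ennreal \<bar>\<phi> (x + s *\<^sub>R i)\<bar> \<le> ennreal B * indicator {- r - x \<bullet> i .. r - x \<bullet> i} s"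
        using r(3)[of "x + s *\<^sub>R i"] supp[of x s] by (auto simp: indicator_def intro!: ennreal_leI)
    qed
    also have "\<dots> = ennreal (2 * r * B)"
      using r(1,2) by (simp add: nn_integral_cmult_indicator ennreal_mult mult.commute)
    finally show ?thesis .
  qed
  \<comment> \<open>The two kernels correspond under the shear taking \<open>(s, x)\<close> to
    \<open>(s, x + s *\<^sub>R i)\<close>, which for each \<open>s\<close> is a translation in
    \<open>x\<close>.\<close>
  define K1 where "K1 = (\<lambda>(s, x). indicator {0..} s * (h x * \<phi> (x + s *\<^sub>R i)))"
  define K2 where "K2 = (\<lambda>(s, x). indicator {0..} s * (h (x - s *\<^sub>R i) * \<phi> x))"
  have [measurable]: "K1 \<in> borel_measurable (borel \<Otimes>\<^sub>M borel)" "K2 \<in> borel_measurable (borel \<Otimes>\<^sub>M borel)"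
    unfolding K1_def K2_def by measurable
  have fin1: "(\<integral>\<^sup>+z. norm (K1 z) \<partial>(lborel \<Otimes>\<^sub>M lborel)) < \<infinity>"
  proof -
    have "(\<integral>\<^sup>+z. norm (K1 z) \<partial>(lborel \<Otimes>\<^sub>M lborel)) = (\<integral>\<^sup>+x. (\<integral>\<^sup>+s. norm (K1 (s, x)) \<partial>lborel) \<partial>lborel)"
      by (subst lborel_pair.nn_integral_snd[symmetric]) auto
    also have "\<dots> \<le> (\<integral>\<^sup>+x. ennreal \<bar>h x\<bar> * ennreal (2 * r * B) \<partial>lborel)"
    proof (rule nn_integral_mono)
      fix x
      have "(\<integral>\<^sup>+s. norm (K1 (s, x)) \<partial>lborel) \<le> (\<integral>\<^sup>+s. ennreal \<bar>h x\<bar> * ennreal \<bar>\<phi> (x + s *\<^sub>R i)\<bar> \<partial>lborel)"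
        by (intro nn_integral_mono) (auto simp: K1_def indicator_def abs_mult ennreal_mult)
      also have "\<dots> = ennreal \<bar>h x\<bar> * (\<integral>\<^sup>+s. ennreal \<bar>\<phi> (x + s *\<^sub>R i)\<bar> \<partial>lborel)"
        by (rule nn_integral_cmult) measurable
      also have "\<dots> \<le> ennreal \<bar>h x\<bar> * ennreal (2 * r * B)" by (intro mult_left_mono bound) simp
      finally show "(\<integral>\<^sup>+s. norm (K1 (s, x)) \<partial>lborel) \<le> ennreal \<bar>h x\<bar> * ennreal (2 * r * B)" .
    qed
    also have "\<dots> = (\<integral>\<^sup>+x. ennreal \<bar>h x\<bar> \<partial>lborel) * ennreal (2 * r * B)" by (rule nn_integral_multc) simp
    also have "\<dots> < \<infinity>" using h by (auto simp: integrable_iff_bounded ennreal_mult_less_top)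
    finally show ?thesis .
  qed
  have K1: "integrable (lborel \<Otimes>\<^sub>M lborel) K1"
    using fin1 by (intro integrableI_bounded) auto
  have shift: "K2 (s, x + s *\<^sub>R i) = K1 (s, x)" for s x
    by (simp add: K1_def K2_def)
  have K2: "integrable (lborel \<Otimes>\<^sub>M lborel) K2"
  proof (rule integrableI_bounded)
    have "(\<integral>\<^sup>+z. norm (K2 z) \<partial>(lborel \<Otimes>\<^sub>M lborel)) = (\<integral>\<^sup>+s. (\<integral>\<^sup>+x. norm (K2 (s, x)) \<partial>lborel) \<partial>lborel)"
      by (subst lborel.nn_integral_fst[symmetric]) auto
    also have "\<dots> = (\<integral>\<^sup>+s. (\<integral>\<^sup>+x. norm (K1 (s, x)) \<partial>lborel) \<partial>lborel)"
    proof (rule nn_integral_cong)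
      fix s :: real
      have "(\<integral>\<^sup>+x. norm (K2 (s, x)) \<partial>lborel) = (\<integral>\<^sup>+x. norm (K2 (s, x + s *\<^sub>R i)) \<partial>lborel)"
        by (rule nn_integral_lborel_shift[symmetric]) measurable
      then show "(\<integral>\<^sup>+x. norm (K2 (s, x)) \<partial>lborel) = (\<integral>\<^sup>+x. norm (K1 (s, x)) \<partial>lborel)"
        by (simp only: shift)
    qed
    also have "\<dots> = (\<integral>\<^sup>+z. norm (K1 z) \<partial>(lborel \<Otimes>\<^sub>M lborel))"
      by (subst lborel.nn_integral_fst[symmetric]) auto
    finally show "(\<integral>\<^sup>+z. norm (K2 z) \<partial>(lborel \<Otimes>\<^sub>M lborel)) < \<infinity>" using fin1 by simp
  qed simp
  define H where "H x = (\<integral>s. indicator {0..} s * h (x - s *\<^sub>R i) \<partial>lborel)" for x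
  have inner2: "(\<integral>s. K2 (s, x) \<partial>lborel) = \<phi> x * H x" for x
  proof -
    have "(\<integral>s. K2 (s, x) \<partial>lborel) = (\<integral>s. \<phi> x * (indicator {0..} s * h (x - s *\<^sub>R i)) \<partial>lborel)"
      by (intro Bochner_Integration.integral_cong) (auto simp: K2_def)
    then show ?thesis by (simp add: H_def)
  qed
  define b where "b s = (\<integral>x. h x * \<phi> (x + s *\<^sub>R i) \<partial>lborel)" for s
  have inner1: "(\<integral>x. K1 (s, x) \<partial>lborel) = indicator {0..} s * b s" for s
    by (simp add: K1_def b_def)
  have bint: "integrable lborel (\<lambda>s. indicator {0..} s * b s)"
    using lborel_pair.integrable_fst'[OF K1] by (simp add: inner1)
  show "integrable lborel (\<lambda>x. \<phi> x * (\<integral>s. indicator {0..} s * h (x - s *\<^sub>R i) \<partial>lborel))"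
    using lborel_pair.integrable_snd[of "\<lambda>s x. K2 (s, x)"] K2 by (simp add: inner2 H_def[symmetric])
  have R: "(\<integral>s. indicator {0..} s * b s \<partial>lborel) = (\<integral>x. \<phi> x * H x \<partial>lborel)"
  proof -
    have "(\<integral>s. indicator {0..} s * b s \<partial>lborel) = (\<integral>s. (\<integral>x. K1 (s, x) \<partial>lborel) \<partial>lborel)" by (simp add: inner1)
    also have "\<dots> = (\<integral>s. (\<integral>x. K2 (s, x) \<partial>lborel) \<partial>lborel)"
    proof (rule Bochner_Integration.integral_cong[OF refl])
      fix s :: real
      have "(\<integral>x. K2 (s, x) \<partial>lborel) = (\<integral>x. K2 (s, x + s *\<^sub>R i) \<partial>lborel)"
        by (rule integral_lborel_shift[symmetric]) measurable
      then show "(\<integral>x. K1 (s, x) \<partial>lborel) = (\<integral>x. K2 (s, x) \<partial>lborel)" by (simp only: shift)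
    qed
    also have "\<dots> = (\<integral>x. (\<integral>s. K2 (s, x) \<partial>lborel) \<partial>lborel)"
      using lborel_pair.Fubini_integral[of "\<lambda>s x. K2 (s, x)"] K2 by simp
    finally show ?thesis by (simp add: inner2)
  qed
  \<comment> \<open>The fundamental theorem along the shift: for each \<open>s\<close> the weak
    derivative is applied to the translated test function, and the two integrals are
    exchanged.\<close>
  have step: "(\<integral>x. g x * \<phi> (x + t *\<^sub>R i) \<partial>lborel) - (\<integral>x. g x * \<phi> x \<partial>lborel) = - (\<integral>s. indicator {0..t} s * b s \<partial>lborel)"
    if t: "0 \<le> t" for t
  proof -
    define K where "K = (\<lambda>(s, x). indicator {0..t} s * (g x * frechet_derivative \<phi> (at (x + s *\<^sub>R i)) i))"
    have [measurable]: "K \<in> borel_measurable (borel \<Otimes>\<^sub>M borel)"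
      unfolding K_def using C1_fun_measurable(2)[OF C, of i] by measurable
    have Kint: "integrable (lborel \<Otimes>\<^sub>M lborel) K"
    proof (rule integrableI_bounded)
      have "(\<integral>\<^sup>+z. norm (K z) \<partial>(lborel \<Otimes>\<^sub>M lborel)) = (\<integral>\<^sup>+s. (\<integral>\<^sup>+x. norm (K (s, x)) \<partial>lborel) \<partial>lborel)"
        by (subst lborel.nn_integral_fst[symmetric]) auto
      also have "\<dots> \<le> (\<integral>\<^sup>+s. (\<integral>\<^sup>+x. ennreal \<bar>g x\<bar> * ennreal B \<partial>lborel) * indicator {0..t} s \<partial>lborel)"
      proof (rule nn_integral_mono)
        fix s
        have "(\<integral>\<^sup>+x. norm (K (s, x)) \<partial>lborel) \<le> (\<integral>\<^sup>+x. ennreal \<bar>g x\<bar> * ennreal B \<partial>lborel)" 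
          using r(4) r(2) by (intro nn_integral_mono)
            (auto simp: K_def indicator_def abs_mult ennreal_mult[symmetric] intro!: ennreal_leI mult_left_mono)
        then show "(\<integral>\<^sup>+x. norm (K (s, x)) \<partial>lborel) \<le> (\<integral>\<^sup>+x. ennreal \<bar>g x\<bar> * ennreal B \<partial>lborel) * indicator {0..t} s"
          by (cases "s \<in> {0..t}") (auto simp: K_def)
      qed
      also have "\<dots> = (\<integral>\<^sup>+x. ennreal \<bar>g x\<bar> * ennreal B \<partial>lborel) * ennreal t"
        using t by (simp add: nn_integral_cmult_indicator)
      also have "\<dots> < \<infinity>"
        using g by (auto simp: integrable_iff_bounded ennreal_mult_less_top nn_integral_multc)
      finally show "(\<integral>\<^sup>+z. norm (K z) \<partial>(lborel \<Otimes>\<^sub>M lborel)) < \<infinity>" .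
    qed simp
    have k1: "(\<integral>x. K (s, x) \<partial>lborel) = - (indicator {0..t} s * b s)" for s
    proof -
      have "(\<integral>x. g x * frechet_derivative (\<lambda>x. \<phi> (x + s *\<^sub>R i)) (at x) i \<partial>lborel) = - (\<integral>x. h x * \<phi> (x + s *\<^sub>R i) \<partial>lborel)"
        using W test_function_translate(1)[OF \<phi>] by (simp add: weak_partial_def)
      then show ?thesis by (simp add: K_def b_def test_function_translate(2)[OF \<phi>])
    qed
    have k2: "(\<integral>s. K (s, x) \<partial>lborel) = g x * (\<phi> (x + t *\<^sub>R i) - \<phi> x)" for x
    proof -
      have der: "((\<lambda>s. \<phi> (x + s *\<^sub>R i)) has_real_derivative frechet_derivative \<phi> (at (x + s *\<^sub>R i)) i) (at s)" for s
      proof -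
        have "((\<lambda>s. x + s *\<^sub>R i) has_derivative (\<lambda>s. s *\<^sub>R i)) (at s)" by (auto intro!: derivative_eq_intros)
        from has_derivative_compose[OF this C1_fun_has_derivative[OF C]]
        have "((\<lambda>s. \<phi> (x + s *\<^sub>R i)) has_derivative (\<lambda>r. frechet_derivative \<phi> (at (x + s *\<^sub>R i)) (r *\<^sub>R i))) (at s)" .
        moreover have "frechet_derivative \<phi> (at (x + s *\<^sub>R i)) (r *\<^sub>R i) = frechet_derivative \<phi> (at (x + s *\<^sub>R i)) i * r" for r
          using linear_scale[OF has_derivative_linear[OF C1_fun_has_derivative[OF C]]] by (simp add: mult.commute)
        ultimately show ?thesis by (simp add: has_field_derivative_def)
      qed
      have "continuous_on UNIV (\<lambda>s. frechet_derivative \<phi> (at (x + s *\<^sub>R i)) i)"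
        by (rule continuous_on_compose2[OF C1_fun_continuous_deriv[OF C, of i]]) (auto intro!: continuous_intros)
      then have "(\<integral>s. frechet_derivative \<phi> (at (x + s *\<^sub>R i)) i * indicator {0..t} s \<partial>lborel) = \<phi> (x + t *\<^sub>R i) - \<phi> (x + 0 *\<^sub>R i)"
        using t der by (intro integral_FTC_Icc_real) (auto simp: continuous_on_eq_continuous_at)
      moreover have "(\<integral>s. K (s, x) \<partial>lborel) = (\<integral>s. g x * (frechet_derivative \<phi> (at (x + s *\<^sub>R i)) i * indicator {0..t} s) \<partial>lborel)"
        by (intro Bochner_Integration.integral_cong) (auto simp: K_def)
      ultimately show ?thesis by simp
    qed
    have "(\<integral>x. g x * (\<phi> (x + t *\<^sub>R i) - \<phi> x) \<partial>lborel) = (\<integral>s. - (indicator {0..t} s * b s) \<partial>lborel)"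
      using lborel_pair.Fubini_integral[of "\<lambda>s x. K (s, x)"] Kint by (simp add: k1 k2)
    moreover have "integrable lborel (\<lambda>x. g x * \<phi> (x + c))" for c
    proof (rule Bochner_Integration.integrable_bound)
      show "integrable lborel (\<lambda>x. g x * B)" using g by simp
      show "AE x in lborel. norm (g x * \<phi> (x + c)) \<le> norm (g x * B)"
        using r(2,3) by (auto simp: abs_mult intro!: mult_left_mono)
    qed simp
    from this[of "t *\<^sub>R i"] this[of 0]
    have "(\<integral>x. g x * (\<phi> (x + t *\<^sub>R i) - \<phi> x) \<partial>lborel) = (\<integral>x. g x * \<phi> (x + t *\<^sub>R i) \<partial>lborel) - (\<integral>x. g x * \<phi> x \<partial>lborel)"
      by (simp add: right_diff_distrib)
    ultimately show ?thesis by simp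
  qed
  \<comment> \<open>For each \<open>x\<close> the shifted point leaves the support of \<phi> once
    \<open>n\<close> is large.\<close>
  have lim1: "(\<lambda>n. (\<integral>x. g x * \<phi> (x + real n *\<^sub>R i) \<partial>lborel)) \<longlonglongrightarrow> (\<integral>x. 0 \<partial>(lborel :: 'a measure))"
  proof (rule integral_dominated_convergence[where w="\<lambda>x. \<bar>g x\<bar> * B"])
    show "AE x in lborel. (\<lambda>n. g x * \<phi> (x + real n *\<^sub>R i)) \<longlonglongrightarrow> 0"
    proof (rule AE_I2)
      fix x
      obtain N :: nat where N: "r - x \<bullet> i < N" using reals_Archimedean2 by blast
      have "g x * \<phi> (x + real n *\<^sub>R i) = 0" if "n \<ge> N" for n
        using N that supp[of x "real n"] by auto
      then show "(\<lambda>n. g x * \<phi> (x + real n *\<^sub>R i)) \<longlonglongrightarrow> 0"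
        by (intro tendsto_eventually eventually_sequentiallyI)
    qed
    show "AE x in lborel. norm (g x * \<phi> (x + real n *\<^sub>R i)) \<le> \<bar>g x\<bar> * B" for n
      using r(3) by (auto simp: abs_mult intro!: mult_left_mono)
  qed (use g in auto)
  have lim2: "(\<lambda>n. (\<integral>s. indicator {0..real n} s * b s \<partial>lborel)) \<longlonglongrightarrow> (\<integral>s. indicator {0..} s * b s \<partial>lborel)"
  proof (rule integral_dominated_convergence[where w="\<lambda>s. norm (indicator {0..} s * b s)"])
    have m: "(\<lambda>s. indicator {0..} s * b s) \<in> borel_measurable borel" using bint by simp
    then show "(\<lambda>s. indicator {0..} s * b s) \<in> borel_measurable lborel" by simp
    have "(\<lambda>s. indicator {0..real n} s * b s) = (\<lambda>s. indicator {0..real n} s * (indicator {0..} s * b s))" for n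
      by (auto simp: indicator_def)
    then show "(\<lambda>s. indicator {0..real n} s * b s) \<in> borel_measurable lborel" for n
      using m by simp
    show "integrable lborel (\<lambda>s. norm (indicator {0..} s * b s))" using bint by (rule integrable_norm)
    show "AE s in lborel. (\<lambda>n. indicator {0..real n} s * b s) \<longlonglongrightarrow> indicator {0..} s * b s"
    proof (rule AE_I2)
      fix s :: real
      obtain N :: nat where N: "s < N" using reals_Archimedean2 by blast
      then show "(\<lambda>n. indicator {0..real n} s * b s) \<longlonglongrightarrow> indicator {0..} s * b s"
        by (intro tendsto_eventually eventually_sequentiallyI[of N]) (auto simp: indicator_def)
    qed
    show "AE s in lborel. norm (indicator {0..real n} s * b s) \<le> norm (indicator {0..} s * b s)" for n
      by (auto simp: indicator_def)
  qed
  have "(\<lambda>n. (\<integral>x. g x * \<phi> (x + real n *\<^sub>R i) \<partial>lborel) - (\<integral>x. g x * \<phi> x \<partial>lborel)) \<longlonglongrightarrow> 0 - (\<integral>x. g x * \<phi> x \<partial>lborel)"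
    using lim1 by (intro tendsto_diff tendsto_const) simp
  moreover have "(\<lambda>n. (\<integral>x. g x * \<phi> (x + real n *\<^sub>R i) \<partial>lborel) - (\<integral>x. g x * \<phi> x \<partial>lborel)) \<longlonglongrightarrow> - (\<integral>s. indicator {0..} s * b s \<partial>lborel)"
    using tendsto_minus[OF lim2] by (simp add: step)
  ultimately have "0 - (\<integral>x. g x * \<phi> x \<partial>lborel) = - (\<integral>s. indicator {0..} s * b s \<partial>lborel)"
    by (rule LIMSEQ_unique)
  then show "(\<integral>x. \<phi> x * g x \<partial>lborel) = (\<integral>x. \<phi> x * (\<integral>s. indicator {0..} s * h (x - s *\<^sub>R i) \<partial>lborel) \<partial>lborel)"
    using R by (simp add: H_def mult.commute)
qed

text \<open>\<open>e\<close> is integrable only after multiplication by a test function. The product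
  has zero integral over every box, by approximating the box with bumps; then bumps that are
  positive on growing boxes are divided off.\<close>

lemma AE_eq_0_if_test_integrals_eq_0:
  fixes e :: "'a::euclidean_space \<Rightarrow> real"
  assumes [measurable]: "e \<in> borel_measurable borel"
    and int: "\<And>\<phi>. test_function \<phi> \<Longrightarrow> integrable lborel (\<lambda>x. \<phi> x * e x)"
    and zero: "\<And>\<phi>. test_function \<phi> \<Longrightarrow> (\<integral>x. \<phi> x * e x \<partial>lborel) = 0"
  shows "AE x in lborel. e x = 0"
proof -
  have *: "AE x in lborel. \<phi> x * e x = 0" if \<phi>: "test_function \<phi>" for \<phi>
  proof (rule AE_eq_0_if_box_integrals_eq_0[OF int[OF \<phi>]])
    fix a b :: 'a
    have [measurable]: "\<phi> \<in> borel_measurable borel"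
      using \<phi> by (auto simp: test_function_iff intro: C1_fun_measurable)
    have [measurable]: "box_bump k a b \<in> borel_measurable borel" for k
      by (rule C1_fun_measurable(1)[OF C1_fun_box_bump])
    have "(\<lambda>k. \<integral>x. box_bump k a b x * (\<phi> x * e x) \<partial>lborel) \<longlonglongrightarrow> (\<integral>x. indicator (box a b) x * (\<phi> x * e x) \<partial>lborel)"
    proof (rule integral_dominated_convergence[where w="\<lambda>x. norm (\<phi> x * e x)"])
      show "AE x in lborel. (\<lambda>k. box_bump k a b x * (\<phi> x * e x)) \<longlonglongrightarrow> indicator (box a b) x * (\<phi> x * e x)"
        by (intro AE_I2 tendsto_mult box_bump_limit tendsto_const)
      show "AE x in lborel. norm (box_bump k a b x * (\<phi> x * e x)) \<le> norm (\<phi> x * e x)" for k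
        using box_bump_bounds[of k a b] by (intro AE_I2) (simp add: abs_mult mult_left_le_one_le)
      show "integrable lborel (\<lambda>x. norm (\<phi> x * e x))" using int[OF \<phi>] by (rule integrable_norm)
    qed simp_all
    moreover have "(\<integral>x. box_bump k a b x * (\<phi> x * e x) \<partial>lborel) = 0" for k
      using zero[OF test_function_mult[OF \<phi> C1_fun_box_bump[of k a b]]] by (simp add: mult.assoc)
    ultimately show "(\<integral>x. indicator (box a b) x * (\<phi> x * e x) \<partial>lborel) = 0"
      by (simp add: LIMSEQ_const_iff)
  qed
  have "AE x in lborel. \<forall>n::nat. box_bump 1 (- real n *\<^sub>R One) (real n *\<^sub>R One) x * e x = 0"
    unfolding AE_all_countable by (intro allI * test_function_box_bump)
  then show ?thesis
  proof eventually_elim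
    case (elim x)
    obtain n :: nat where n: "norm x < n" using reals_Archimedean2 by blast
    have "x \<in> box (- real n *\<^sub>R One) (real n *\<^sub>R One)" using n by (rule mem_box_One)
    then show ?case using elim box_bump_pos[of x "- real n *\<^sub>R One" "real n *\<^sub>R One"]
      by (metis less_irrefl mult_eq_0_iff)
  qed
qed

text \<open>By \<open>weak_partial_test_eq\<close> both sides have the same integral against every
  test function.\<close>

lemma weak_partial_AE:
  fixes g h :: "'a::euclidean_space \<Rightarrow> real"
  assumes W: "weak_partial i g h" and g: "integrable lborel g" and h: "integrable lborel h"
    and i: "i \<in> Basis"
  shows "AE x in lborel. g x = (\<integral>s. indicator {0..} s * h (x - s *\<^sub>R i) \<partial>lborel)"
proof -
  have [measurable]: "g \<in> borel_measurable borel" "h \<in> borel_measurable borel" using g h by auto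
  have gl: "locally_integrable g" using W by (simp add: weak_partial_def)
  define H where "H x = (\<integral>s. indicator {0..} s * h (x - s *\<^sub>R i) \<partial>lborel)" for x
  have [measurable]: "H \<in> borel_measurable borel" unfolding H_def[abs_def] by measurable
  note R = weak_partial_test_eq[OF W g h i, folded H_def]
  have "AE x in lborel. g x - H x = 0"
  proof (rule AE_eq_0_if_test_integrals_eq_0)
    fix \<phi> :: "'a \<Rightarrow> real" assume \<phi>: "test_function \<phi>"
    have I: "integrable lborel (\<lambda>x. \<phi> x * g x)"
      using integrable_mult_test(1)[OF gl \<phi>] by (simp add: mult.commute)
    show "integrable lborel (\<lambda>x. \<phi> x * (g x - H x))"
      using I R(1)[OF \<phi>] by (simp add: right_diff_distrib)
    show "(\<integral>x. \<phi> x * (g x - H x) \<partial>lborel) = 0"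
      using I R[OF \<phi>] by (simp add: right_diff_distrib)
  qed simp
  then show ?thesis by eventually_elim (simp add: H_def)
qed

section \<open>Passage between Euclidean space and coordinate functions\<close>

definition of_coords :: "('a \<Rightarrow> real) \<Rightarrow> 'a::euclidean_space" where
  "of_coords u = (\<Sum>b\<in>Basis. u b *\<^sub>R b)"

lemma of_coords_measurable [measurable]: "of_coords \<in> measurable (lborel_on Basis) borel"
  unfolding of_coords_def[abs_def] by measurable

lemma lborel_eq_distr_of_coords: "(lborel :: 'a::euclidean_space measure) = distr (lborel_on Basis) borel of_coords"
  unfolding lborel_def[where 'a='a] of_coords_def[abs_def] lborel_eq_real ..

lemma inner_of_coords [simp]: "i \<in> Basis \<Longrightarrow> of_coords u \<bullet> i = u i"
  by (simp add: of_coords_def)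

lemma of_coords_upd:
  assumes "i \<in> Basis"
  shows "of_coords (u(i := t)) = of_coords u + (t - u i) *\<^sub>R i"
proof (rule euclidean_eqI)
  fix b :: 'a assume b: "b \<in> Basis"
  show "of_coords (u(i := t)) \<bullet> b = (of_coords u + (t - u i) *\<^sub>R i) \<bullet> b"
    using assms b by (cases "b = i") (simp_all add: inner_add_left inner_Basis)
qed

lemma AE_of_coords: "AE x in lborel. P x \<Longrightarrow> AE u in lborel_on Basis. P (of_coords u)"
  by (subst (asm) lborel_eq_distr_of_coords) (rule AE_distrD[OF of_coords_measurable])

lemma AE_of_coordsD:
  assumes "{x. P x} \<in> sets borel" "AE u in lborel_on Basis. P (of_coords u)"
  shows "AE x in lborel. P x"
  by (subst lborel_eq_distr_of_coords) (use assms in \<open>simp add: AE_distr_iff\<close>)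

lemma integrable_of_coords:
  fixes f :: "'a::euclidean_space \<Rightarrow> real"
  assumes "f \<in> borel_measurable borel"
  shows "integrable (lborel_on Basis) (\<lambda>u. f (of_coords u)) \<longleftrightarrow> integrable lborel f"
  by (subst lborel_eq_distr_of_coords) (use assms in \<open>simp add: integrable_distr_eq\<close>)

lemma integral_of_coords:
  fixes f :: "'a::euclidean_space \<Rightarrow> real"
  assumes "f \<in> borel_measurable borel"
  shows "(\<integral>u. f (of_coords u) \<partial>lborel_on Basis) = (\<integral>x. f x \<partial>lborel)"
  by (subst lborel_eq_distr_of_coords) (use assms in \<open>simp add: integral_distr\<close>)

lemma nn_integral_of_coords:
  assumes "f \<in> borel_measurable borel"
  shows "(\<integral>\<^sup>+u. f (of_coords u) \<partial>lborel_on Basis) = (\<integral>\<^sup>+x. f x \<partial>lborel)"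
  by (subst lborel_eq_distr_of_coords) (use assms in \<open>simp add: nn_integral_distr\<close>)

text \<open>The substitution \<open>t = u i - s\<close> turns the integral along the ray into an
  antiderivative in the coordinate \<open>i\<close>.\<close>

lemma weak_partial_coords:
  fixes g h :: "'a::euclidean_space \<Rightarrow> real"
  assumes W: "weak_partial i g h" and g: "integrable lborel g" and h: "integrable lborel h"
    and i: "i \<in> Basis"
  shows "AE u in lborel_on Basis. g (of_coords u) = antideriv (\<lambda>t. h (of_coords (u(i := t)))) (u i)"
  using AE_of_coords[OF weak_partial_AE[OF assms]]
proof eventually_elim
  case (elim u)
  have "antideriv (\<lambda>t. h (of_coords (u(i := t)))) (u i) =
    (\<integral>t. indicator {..u i} t * h (of_coords u + (t - u i) *\<^sub>R i) \<partial>lborel)"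
    by (simp add: antideriv_def of_coords_upd[OF i])
  also have "\<dots> = (\<integral>s. indicator {..u i} (u i + (- 1) * s) * h (of_coords u + ((u i + (- 1) * s) - u i) *\<^sub>R i) \<partial>lborel)"
    by (subst lborel_integral_real_affine[where c="-1" and t="u i"]) auto
  also have "\<dots> = (\<integral>s. indicator {0..} s * h (of_coords u - s *\<^sub>R i) \<partial>lborel)"
    by (intro Bochner_Integration.integral_cong) (auto simp: indicator_def)
  finally show ?case using elim by simp
qed

subsection \<open>Orthogonal decompositions from a coupling\<close>

lemma gauss_density_nonneg: "0 \<le> gauss_density x"
  by (simp add: gauss_density_def)

lemma gauss_density_pos: "0 < gauss_density x"
  by (simp add: gauss_density_def)

lemma gauss_density_measurable [measurable]: "gauss_density \<in> borel_measurable borel"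
  unfolding gauss_density_def[abs_def] by measurable

lemma sets_gaussian [simp, measurable_cong]: "sets gaussian = sets borel"
  by (simp add: gaussian_def)

text \<open>The density is even and Lebesgue measure is invariant under reflection. This symmetry is
  what keeps a random change of sign from altering the Gaussian law.\<close>

lemma distr_uminus_gaussian: "distr gaussian borel uminus = (gaussian :: 'a::euclidean_space measure)"
proof (rule measure_eqI)
  fix A :: "'a set" assume "A \<in> sets (distr gaussian borel uminus)"
  then have [measurable]: "A \<in> sets borel" by simp
  have lb: "(lborel :: 'a measure) = distr lborel borel uminus"
    using lborel_affine[of "-1" "0 :: 'a"] by (simp add: density_1)
  have "emeasure (distr gaussian borel uminus) A = (\<integral>\<^sup>+x. indicator A x \<partial>distr gaussian borel uminus)" by simp
  also have "\<dots> = (\<integral>\<^sup>+x. indicator A (- x) \<partial>gaussian)" by (subst nn_integral_distr) auto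
  also have "\<dots> = (\<integral>\<^sup>+x. ennreal (gauss_density x) * indicator A (- x) \<partial>lborel)"
    unfolding gaussian_def by (subst nn_integral_density) auto
  also have "\<dots> = (\<integral>\<^sup>+x. ennreal (gauss_density x) * indicator A (- x) \<partial>distr lborel borel uminus)"
    by (simp flip: lb)
  also have "\<dots> = (\<integral>\<^sup>+x. ennreal (gauss_density x) * indicator A x \<partial>lborel)"
    by (subst nn_integral_distr) (auto simp: gauss_density_def)
  also have "\<dots> = emeasure gaussian A"
    unfolding gaussian_def by (subst emeasure_density) auto
  finally show "emeasure (distr gaussian borel uminus) A = emeasure gaussian A" .
qed simp

lemma W2sq_le_coupling:
  fixes \<xi> \<zeta> :: "'b \<Rightarrow> 'a::euclidean_space"
  assumes P: "prob_space P" and [measurable]: "\<xi> \<in> borel_measurable P" "\<zeta> \<in> borel_measurable P"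
    and int: "integrable P (\<lambda>\<omega>. (dist (\<xi> \<omega>) (\<zeta> \<omega>))\<^sup>2)"
  shows "W2sq (distr P borel \<xi>) (distr P borel \<zeta>) \<le> ennreal (\<integral>\<omega>. (dist (\<xi> \<omega>) (\<zeta> \<omega>))\<^sup>2 \<partial>P)"
proof -
  interpret P: prob_space P by fact
  define \<pi> where "\<pi> = distr P borel (\<lambda>\<omega>. (\<xi> \<omega>, \<zeta> \<omega>))"
  have [measurable]: "(\<lambda>\<omega>. (\<xi> \<omega>, \<zeta> \<omega>)) \<in> borel_measurable P"
    unfolding borel_prod[symmetric] by measurable
  have [measurable]: "fst \<in> borel_measurable (borel :: ('a \<times> 'a) measure)" "snd \<in> borel_measurable (borel :: ('a \<times> 'a) measure)"
    unfolding borel_prod[symmetric] by measurable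
  have "\<pi> \<in> couplings (distr P borel \<xi>) (distr P borel \<zeta>)"
    unfolding couplings_def \<pi>_def by (auto simp: distr_distr comp_def intro: P.prob_space_distr)
  then have "W2sq (distr P borel \<xi>) (distr P borel \<zeta>) \<le> (\<integral>\<^sup>+ z. ennreal ((dist (fst z) (snd z))\<^sup>2) \<partial>\<pi>)"
    unfolding W2sq_def by (rule INF_lower)
  also have "\<dots> = (\<integral>\<^sup>+ \<omega>. ennreal ((dist (\<xi> \<omega>) (\<zeta> \<omega>))\<^sup>2) \<partial>P)"
    unfolding \<pi>_def by (subst nn_integral_distr) auto
  also have "\<dots> = ennreal (\<integral>\<omega>. (dist (\<xi> \<omega>) (\<zeta> \<omega>))\<^sup>2 \<partial>P)"
    using int by (intro nn_integral_eq_integral) auto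
  finally show ?thesis .
qed

lemma integrable_inner_L2:
  fixes \<xi> \<zeta> :: "'b \<Rightarrow> 'a::euclidean_space"
  assumes [measurable]: "\<xi> \<in> borel_measurable P" "\<zeta> \<in> borel_measurable P"
    and int: "integrable P (\<lambda>\<omega>. (norm (\<xi> \<omega>))\<^sup>2)" "integrable P (\<lambda>\<omega>. (norm (\<zeta> \<omega>))\<^sup>2)"
  shows "integrable P (\<lambda>\<omega>. \<xi> \<omega> \<bullet> \<zeta> \<omega>)"
proof (rule Bochner_Integration.integrable_bound)
  show "integrable P (\<lambda>\<omega>. (norm (\<xi> \<omega>))\<^sup>2 + (norm (\<zeta> \<omega>))\<^sup>2)" using int by simp
  have "\<bar>a \<bullet> b\<bar> \<le> (norm a)\<^sup>2 + (norm b)\<^sup>2" for a b :: 'a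
  proof -
    have "0 \<le> (norm a - norm b)\<^sup>2" by simp
    then have "2 * (norm a * norm b) \<le> (norm a)\<^sup>2 + (norm b)\<^sup>2" by (simp add: power2_diff)
    moreover have "0 \<le> norm a * norm b" by simp
    ultimately show ?thesis using Cauchy_Schwarz_ineq2[of a b] by linarith
  qed
  then show "AE \<omega> in P. norm (\<xi> \<omega> \<bullet> \<zeta> \<omega>) \<le> norm ((norm (\<xi> \<omega>))\<^sup>2 + (norm (\<zeta> \<omega>))\<^sup>2)" by simp
qed measurable

lemma has_integral_norm_sq_combination:
  fixes \<xi> \<zeta> :: "'b \<Rightarrow> 'a::euclidean_space"
  assumes [measurable]: "\<xi> \<in> borel_measurable P" "\<zeta> \<in> borel_measurable P"
    and int: "integrable P (\<lambda>\<omega>. (norm (\<xi> \<omega>))\<^sup>2)" "integrable P (\<lambda>\<omega>. (norm (\<zeta> \<omega>))\<^sup>2)"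
  shows "integrable P (\<lambda>\<omega>. (norm (s *\<^sub>R \<xi> \<omega> + t *\<^sub>R \<zeta> \<omega>))\<^sup>2)"
    and "(\<integral>\<omega>. (norm (s *\<^sub>R \<xi> \<omega> + t *\<^sub>R \<zeta> \<omega>))\<^sup>2 \<partial>P) =
      s\<^sup>2 * (\<integral>\<omega>. (norm (\<xi> \<omega>))\<^sup>2 \<partial>P) + 2 * s * t * (\<integral>\<omega>. \<xi> \<omega> \<bullet> \<zeta> \<omega> \<partial>P) + t\<^sup>2 * (\<integral>\<omega>. (norm (\<zeta> \<omega>))\<^sup>2 \<partial>P)"
proof -
  have eq: "(norm (s *\<^sub>R a + t *\<^sub>R b))\<^sup>2 = s\<^sup>2 * (norm a)\<^sup>2 + 2 * s * t * (a \<bullet> b) + t\<^sup>2 * (norm b)\<^sup>2" for a b :: 'a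
    unfolding power2_norm_eq_inner
    by (simp add: inner_add_left inner_add_right inner_commute power2_eq_square algebra_simps)
  note I = int integrable_inner_L2[OF assms(1,2) int]
  show "integrable P (\<lambda>\<omega>. (norm (s *\<^sub>R \<xi> \<omega> + t *\<^sub>R \<zeta> \<omega>))\<^sup>2)" unfolding eq using I by simp
  show "(\<integral>\<omega>. (norm (s *\<^sub>R \<xi> \<omega> + t *\<^sub>R \<zeta> \<omega>))\<^sup>2 \<partial>P) =
      s\<^sup>2 * (\<integral>\<omega>. (norm (\<xi> \<omega>))\<^sup>2 \<partial>P) + 2 * s * t * (\<integral>\<omega>. \<xi> \<omega> \<bullet> \<zeta> \<omega> \<partial>P) + t\<^sup>2 * (\<integral>\<omega>. (norm (\<zeta> \<omega>))\<^sup>2 \<partial>P)"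
    unfolding eq using I by simp
qed

lemma Cauchy_Schwarz_L2:
  fixes \<xi> \<zeta> :: "'b \<Rightarrow> 'a::euclidean_space"
  assumes [measurable]: "\<xi> \<in> borel_measurable P" "\<zeta> \<in> borel_measurable P"
    and int: "integrable P (\<lambda>\<omega>. (norm (\<xi> \<omega>))\<^sup>2)" "integrable P (\<lambda>\<omega>. (norm (\<zeta> \<omega>))\<^sup>2)"
  shows "(\<integral>\<omega>. \<xi> \<omega> \<bullet> \<zeta> \<omega> \<partial>P) \<le> sqrt ((\<integral>\<omega>. (norm (\<xi> \<omega>))\<^sup>2 \<partial>P) * (\<integral>\<omega>. (norm (\<zeta> \<omega>))\<^sup>2 \<partial>P))"
proof (rule real_le_rsqrt)
  define a b c where "a = (\<integral>\<omega>. (norm (\<xi> \<omega>))\<^sup>2 \<partial>P)" and "b = (\<integral>\<omega>. \<xi> \<omega> \<bullet> \<zeta> \<omega> \<partial>P)"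
    and "c = (\<integral>\<omega>. (norm (\<zeta> \<omega>))\<^sup>2 \<partial>P)"
  have q: "0 \<le> s\<^sup>2 * a + 2 * s * t * b + t\<^sup>2 * c" for s t
  proof -
    have "0 \<le> (\<integral>\<omega>. (norm (s *\<^sub>R \<xi> \<omega> + t *\<^sub>R \<zeta> \<omega>))\<^sup>2 \<partial>P)" by simp
    then show ?thesis unfolding has_integral_norm_sq_combination(2)[OF assms] a_def b_def c_def .
  qed
  have "0 \<le> c" unfolding c_def by simp
  have "b\<^sup>2 \<le> a * c"
  proof (cases "c = 0")
    case True
    show ?thesis
    proof (rule ccontr)
      assume "\<not> b\<^sup>2 \<le> a * c"
      then have "b \<noteq> 0" using True by auto
      \<comment> \<open>For \<open>c = 0\<close> the quadratic form is affine in \<open>t\<close>,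
        and this choice of \<open>t\<close> brings it to -1.\<close>
      have "0 \<le> a + 2 * (- (a + 1) / (2 * b)) * b" using q[of 1 "- (a + 1) / (2 * b)"] True by simp
      also have "\<dots> = -1" using \<open>b \<noteq> 0\<close> by (simp add: field_simps)
      finally show False by simp
    qed
  next
    case False
    then have c: "0 < c" using \<open>0 \<le> c\<close> by simp
    \<comment> \<open>For \<open>s = c\<close> the quadratic form is smallest at
      \<open>t = - b\<close>.\<close>
    have "0 \<le> c\<^sup>2 * a + 2 * c * (- b) * b + (- b)\<^sup>2 * c" by (rule q)
    also have "\<dots> = c * (a * c - b\<^sup>2)" by (simp add: power2_eq_square algebra_simps)
    finally show ?thesis using c by (simp add: zero_le_mult_iff)
  qed
  then show "(\<integral>\<omega>. \<xi> \<omega> \<bullet> \<zeta> \<omega> \<partial>P)\<^sup>2 \<le> (\<integral>\<omega>. (norm (\<xi> \<omega>))\<^sup>2 \<partial>P) * (\<integral>\<omega>. (norm (\<zeta> \<omega>))\<^sup>2 \<partial>P)"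
    by (simp add: a_def b_def c_def)
qed

lemma enn2real_le: "x \<le> ennreal r \<Longrightarrow> 0 \<le> r \<Longrightarrow> enn2real x \<le> r"
  using enn2real_mono[of x "ennreal r"] by simp

section \<open>Decompositions obtained from a Gaussian partner\<close>

text \<open>The conclusion of the theorem for an arbitrary \<delta>, so that both constructions can
  be made without reference to the deficit. The clause on finiteness keeps \<open>enn2real\<close>
  from turning an infinite distance into 0.\<close>

definition W2_decomposition :: "'a::euclidean_space measure \<Rightarrow> real \<Rightarrow> bool" where
  "W2_decomposition \<mu> \<delta> \<longleftrightarrow> (\<exists>(P :: ('a \<times> 'a) measure) Y W.
           prob_space P \<and>
           Y \<in> borel_measurable P \<and> W \<in> borel_measurable P \<and>
           integrable P (\<lambda>\<omega>. (norm (Y \<omega>))\<^sup>2) \<and> integrable P (\<lambda>\<omega>. (norm (W \<omega>))\<^sup>2) \<and>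
           distr P borel (\<lambda>\<omega>. Y \<omega> + W \<omega>) = \<mu> \<and>
           (\<integral>\<omega>. Y \<omega> \<bullet> W \<omega> \<partial>P) = 0 \<and>
           W2sq (distr P borel Y) gaussian < \<infinity> \<and>
           \<delta> \<ge> (1/2) * enn2real (W2sq (distr P borel Y) gaussian))"

text \<open>In \<open>L\<^sup>2\<close>, \<open>\<langle>Y, X - Y\<rangle> = 0\<close> says that \<open>Y\<close> lies on the sphere with diameter \<open>[0, X]\<close>;
  \<open>Y\<close> is the radial projection of \<open>Z\<close> onto that sphere.\<close>

lemma W2_decomposition_project:
  fixes \<mu> :: "'a::euclidean_space measure" and Z :: "'a \<Rightarrow> 'a"
  assumes P: "prob_space \<mu>" and sets [measurable_cong]: "sets \<mu> = sets borel"
    and intX: "integrable \<mu> (\<lambda>x. (norm x)\<^sup>2)"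
    and Z [measurable]: "Z \<in> borel_measurable borel" and law: "distr \<mu> borel Z = gaussian"
    and intZ: "integrable \<mu> (\<lambda>x. (norm (Z x))\<^sup>2)"
    and \<delta>: "0 \<le> \<delta>"
    and m: "m = (\<integral>x. (norm x)\<^sup>2 \<partial>\<mu>)" and n: "n = (\<integral>x. (norm (Z x))\<^sup>2 \<partial>\<mu>)" and c: "c = (\<integral>x. x \<bullet> Z x \<partial>\<mu>)"
    and bound: "n - c \<le> sqrt (2 * \<delta> * m)" and cn: "c \<le> n"
  shows "W2_decomposition \<mu> \<delta>"
proof -
  interpret mu: prob_space \<mu> by fact
  have m0: "0 \<le> m" unfolding m by simp
  \<comment> \<open>The position of \<open>Z\<close> relative to the centre \<open>X / 2\<close> of
    the sphere, whose squared radius is \<open>m / 4\<close>.\<close>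
  define U where "U x = Z x - (1/2) *\<^sub>R x" for x
  have [measurable]: "U \<in> borel_measurable borel" unfolding U_def[abs_def] by measurable
  have id [measurable]: "(\<lambda>x. x) \<in> borel_measurable \<mu>" by measurable
  have Zm [measurable]: "Z \<in> borel_measurable \<mu>" by measurable
  have Um [measurable]: "U \<in> borel_measurable \<mu>" by measurable
  have Ueq: "U = (\<lambda>x. (- (1/2)) *\<^sub>R x + 1 *\<^sub>R Z x)" by (auto simp: U_def)
  have Uint: "integrable \<mu> (\<lambda>x. (norm (U x))\<^sup>2)" and EU: "(\<integral>x. (norm (U x))\<^sup>2 \<partial>\<mu>) = m / 4 - c + n"
    unfolding Ueq using has_integral_norm_sq_combination[OF id Zm intX intZ, of "-(1/2)" 1]
    by (auto simp: m n c power2_eq_square)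
  define q where "q = m / 4 - c + n"
  \<comment> \<open>Here c \<le> n enters: it places \<open>Z\<close> on or outside the sphere, so
    that the squared distance \<open>q\<close> from the centre is at least
    \<open>m / 4\<close>.\<close>
  have q0: "0 \<le> q" using cn m0 by (simp add: q_def)
  \<comment> \<open>Radius over distance from the centre, the factor of the radial projection. If
    \<open>q = 0\<close> then \<open>m = 0\<close> as well, and the value \<open>l = 0\<close> from
    division by zero is consistent.\<close>
  define l where "l = sqrt (m / 4) / sqrt q"
  have lq: "l\<^sup>2 * q = m / 4"
  proof (cases "q = 0")
    case True
    then have "m = 0" using cn m0 by (simp add: q_def)
    then show ?thesis using True by simp
  next
    case False
    then show ?thesis using q0 m0 by (simp add: l_def power_divide)
  qed
  \<comment> \<open>The squared distance from \<open>Z\<close> to its projection, as a difference of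
    distances from the centre.\<close>
  have lq1: "(l - 1)\<^sup>2 * q = (sqrt q - sqrt (m / 4))\<^sup>2"
  proof (cases "q = 0")
    case True
    then have "m = 0" using cn m0 by (simp add: q_def)
    then show ?thesis using True by simp
  next
    case False
    then have "sqrt q \<noteq> 0" using q0 by simp
    have "(l - 1)\<^sup>2 * q = ((l - 1) * sqrt q)\<^sup>2" using q0 by (simp add: power_mult_distrib)
    also have "(l - 1) * sqrt q = sqrt (m / 4) - sqrt q" using \<open>sqrt q \<noteq> 0\<close> by (simp add: l_def left_diff_distrib)
    finally show ?thesis by (simp add: power2_commute)
  qed
  have small: "(sqrt q - sqrt (m / 4))\<^sup>2 \<le> 2 * \<delta>"
  proof -
    \<comment> \<open>As \<open>q = m / 4 + (n - c)\<close>, the bound on \<open>n - c\<close>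
      supplies exactly the cross term of the square on the right.\<close>
    have "q \<le> (sqrt (2 * \<delta>) + sqrt (m / 4))\<^sup>2"
    proof -
      have "(sqrt (2 * \<delta>) + sqrt (m / 4))\<^sup>2 = 2 * \<delta> + m / 4 + 2 * (sqrt (2 * \<delta>) * sqrt (m / 4))"
        using \<delta> m0 by (simp add: power2_sum)
      also have "2 * (sqrt (2 * \<delta>) * sqrt (m / 4)) = sqrt (2 * \<delta> * m)"
        by (simp add: real_sqrt_mult real_sqrt_divide)
      finally show ?thesis using bound \<delta> by (simp add: q_def)
    qed
    then have "sqrt q \<le> sqrt (2 * \<delta>) + sqrt (m / 4)"
      using \<delta> m0 by (intro real_le_lsqrt q0) auto
    moreover have "sqrt (m / 4) \<le> sqrt q" using cn by (intro real_sqrt_le_mono) (simp add: q_def)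
    ultimately have "(sqrt q - sqrt (m / 4))\<^sup>2 \<le> (sqrt (2 * \<delta>))\<^sup>2" by (intro power_mono) auto
    then show ?thesis using \<delta> by simp
  qed
  \<comment> \<open>The joint law of X and Z. Both \<open>Y\<close> and \<open>W\<close> are
    functions of the first component; the second keeps the Gaussian partner for the
    coupling.\<close>
  define P where "P = distr \<mu> borel (\<lambda>x. (x, Z x))"
  define Y where "Y z = (1/2) *\<^sub>R fst z + l *\<^sub>R U (fst z)" for z :: "'a \<times> 'a"
  define W where "W z = (1/2) *\<^sub>R fst z + (- l) *\<^sub>R U (fst z)" for z :: "'a \<times> 'a"
  have pm [measurable]: "(\<lambda>x. (x, Z x)) \<in> borel_measurable \<mu>"
    unfolding borel_prod[symmetric] by measurable
  have fm [measurable]: "fst \<in> borel_measurable (borel :: ('a \<times> 'a) measure)" "snd \<in> borel_measurable (borel :: ('a \<times> 'a) measure)"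
    unfolding borel_prod[symmetric] by measurable
  have Ym [measurable]: "Y \<in> borel_measurable borel" unfolding Y_def[abs_def] by measurable
  have Wm [measurable]: "W \<in> borel_measurable borel" unfolding W_def[abs_def] by measurable
  have sP: "sets P = sets borel" by (simp add: P_def)
  have PP: "prob_space P" unfolding P_def by (rule mu.prob_space_distr) measurable
  note IY = has_integral_norm_sq_combination[OF id Um intX Uint]
  have I1: "integrable P (\<lambda>z. (norm (Y z))\<^sup>2)"
    unfolding P_def using IY(1)[of "1/2" l] by (subst integrable_distr_eq) (auto simp: Y_def)
  have I2: "integrable P (\<lambda>z. (norm (W z))\<^sup>2)"
    unfolding P_def using IY(1)[of "1/2" "- l"] by (subst integrable_distr_eq) (auto simp: W_def)
  have "distr P borel (\<lambda>z. Y z + W z) = distr \<mu> borel (\<lambda>x. x)"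
    unfolding P_def by (subst distr_distr) (auto simp: comp_def Y_def W_def scaleR_left_distrib[symmetric] intro!: distr_cong)
  also have "\<dots> = \<mu>" by (rule distr_id2) (simp add: sets)
  finally have lawP: "distr P borel (\<lambda>z. Y z + W z) = \<mu>" .
  \<comment> \<open>\<open>Y\<close> and \<open>W\<close> are \<open>X / 2\<close> plus and minus
    the same vector, so their inner product is a difference of squares.\<close>
  have dot: "Y z \<bullet> W z = (1/4) * (norm (fst z))\<^sup>2 - l\<^sup>2 * (norm (U (fst z)))\<^sup>2" for z
    unfolding power2_norm_eq_inner Y_def W_def
    by (simp add: inner_add_left inner_add_right inner_commute power2_eq_square algebra_simps)
  have "(\<integral>z. Y z \<bullet> W z \<partial>P) = (\<integral>x. (1/4) * (norm x)\<^sup>2 - l\<^sup>2 * (norm (U x))\<^sup>2 \<partial>\<mu>)"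
    unfolding P_def by (subst integral_distr) (simp_all add: dot)
  also have "\<dots> = (1/4) * m - l\<^sup>2 * q" using intX Uint by (simp add: m[symmetric] EU q_def)
  also have "\<dots> = 0" using lq by simp
  finally have orth: "(\<integral>z. Y z \<bullet> W z \<partial>P) = 0" .
  have snd_law: "distr P borel snd = gaussian"
    unfolding P_def by (subst distr_distr) (auto simp: comp_def law)
  have dst: "(dist (Y (x, Z x)) (Z x))\<^sup>2 = (l - 1)\<^sup>2 * (norm (U x))\<^sup>2" for x
  proof -
    have "Z x = U x + (1/2) *\<^sub>R x" by (simp add: U_def)
    then have "Y (x, Z x) - Z x = (l - 1) *\<^sub>R U x" by (simp add: Y_def scaleR_left_diff_distrib)
    then show ?thesis by (simp add: dist_norm power_mult_distrib)
  qed
  have dm: "(\<lambda>z. (dist (Y z) (snd z))\<^sup>2) \<in> borel_measurable borel"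
    by (intro borel_measurable_power borel_measurable_dist Ym fm)
  have Id: "integrable P (\<lambda>z. (dist (Y z) (snd z))\<^sup>2)"
    unfolding P_def integrable_distr_eq[OF pm dm] snd_conv dst using Uint by simp
  have "(\<integral>z. (dist (Y z) (snd z))\<^sup>2 \<partial>P) = (l - 1)\<^sup>2 * q"
    unfolding P_def integral_distr[OF pm dm] snd_conv dst by (simp add: EU q_def)
  then have le: "(\<integral>z. (dist (Y z) (snd z))\<^sup>2 \<partial>P) \<le> 2 * \<delta>" using lq1 small by simp
  have mP: "Y \<in> borel_measurable P" "W \<in> borel_measurable P" "snd \<in> borel_measurable P"
    unfolding measurable_cong_sets[OF sP refl] by (rule Ym Wm fm)+
  have "W2sq (distr P borel Y) (distr P borel snd) \<le> ennreal (\<integral>z. (dist (Y z) (snd z))\<^sup>2 \<partial>P)"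
    by (rule W2sq_le_coupling[OF PP mP(1,3) Id])
  also have "\<dots> \<le> ennreal (2 * \<delta>)" using le by (rule ennreal_leI)
  finally have W2: "W2sq (distr P borel Y) gaussian \<le> ennreal (2 * \<delta>)" by (simp only: snd_law)
  have "(1/2) * enn2real (W2sq (distr P borel Y) gaussian) \<le> \<delta>"
    using enn2real_le[OF W2] \<delta> by simp
  moreover have "W2sq (distr P borel Y) gaussian < \<infinity>" using W2 by (auto simp: less_top[symmetric] top_unique)
  moreover note mP(1,2)
  ultimately show ?thesis unfolding W2_decomposition_def using PP I1 I2 lawP orth by blast
qed

text \<open>If \<open>Z\<close> is too strongly correlated with \<open>X\<close>, flipping its sign independently with a suitable
  probability lowers the correlation to the value making \<open>Z\<close> itself admissible.\<close>

lemma W2_decomposition_flip: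
  fixes \<mu> :: "'a::euclidean_space measure" and Z :: "'a \<Rightarrow> 'a"
  assumes P: "prob_space \<mu>" and sets [measurable_cong]: "sets \<mu> = sets borel"
    and intX: "integrable \<mu> (\<lambda>x. (norm x)\<^sup>2)"
    and Z [measurable]: "Z \<in> borel_measurable borel" and law: "distr \<mu> borel Z = gaussian"
    and intZ: "integrable \<mu> (\<lambda>x. (norm (Z x))\<^sup>2)"
    and \<delta>: "0 \<le> \<delta>"
    and n: "n = (\<integral>x. (norm (Z x))\<^sup>2 \<partial>\<mu>)" and c: "c = (\<integral>x. x \<bullet> Z x \<partial>\<mu>)"
    and cn: "n < c"
  shows "W2_decomposition \<mu> \<delta>"
proof -
  interpret mu: prob_space \<mu> by fact
  have n0: "0 \<le> n" unfolding n by simp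
  then have c0: "0 < c" using cn by simp
  \<comment> \<open>After the flip the correlation with X is \<open>(2 * p - 1) * c\<close>.
    Equating it to \<open>n\<close> determines \<open>p\<close>, a probability because 0 \<le> n <
    c.\<close>
  define p where "p = (1 + n / c) / 2"
  have p: "0 \<le> p" "p \<le> 1" using n0 c0 cn by (auto simp: p_def divide_simps)
  have pc: "(2 * p - 1) * c = n" using c0 by (simp add: p_def field_simps)
  define B where "B = measure_pmf (bernoulli_pmf p)"
  interpret B: prob_space B unfolding B_def by (rule prob_space_measure_pmf)
  interpret MB: pair_prob_space \<mu> B ..
  have sB [measurable_cong]: "sets B = sets (count_space UNIV)" by (simp add: B_def)
  define Z' where "Z' z = (if snd z then Z (fst z) else - Z (fst z))" for z :: "'a \<times> bool"
  have Z'm [measurable]: "Z' \<in> borel_measurable (\<mu> \<Otimes>\<^sub>M B)" unfolding Z'_def[abs_def] by measurable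
  have X'm [measurable]: "fst \<in> borel_measurable (\<mu> \<Otimes>\<^sub>M B)" by measurable
  have fst_int: "integrable (\<mu> \<Otimes>\<^sub>M B) (\<lambda>z. h (fst z))" "(\<integral>z. h (fst z) \<partial>(\<mu> \<Otimes>\<^sub>M B)) = (\<integral>x. h x \<partial>\<mu>)"
    if "integrable \<mu> h" for h :: "'a \<Rightarrow> real"
  proof -
    have d: "distr (\<mu> \<Otimes>\<^sub>M B) \<mu> fst = \<mu>" by (rule B.distr_pair_fst)
    have hm: "h \<in> borel_measurable \<mu>" using that by simp
    show "integrable (\<mu> \<Otimes>\<^sub>M B) (\<lambda>z. h (fst z))"
      using integrable_distr_eq[of fst "\<mu> \<Otimes>\<^sub>M B" \<mu> h] hm that by (simp add: d)
    show "(\<integral>z. h (fst z) \<partial>(\<mu> \<Otimes>\<^sub>M B)) = (\<integral>x. h x \<partial>\<mu>)"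
      using integral_distr[of fst "\<mu> \<Otimes>\<^sub>M B" \<mu> h] hm by (simp add: d)
  qed
  have nZ': "norm (Z' z) = norm (Z (fst z))" for z by (simp add: Z'_def)
  have IX: "integrable (\<mu> \<Otimes>\<^sub>M B) (\<lambda>z. (norm (fst z))\<^sup>2)" using fst_int(1)[OF intX] .
  have IZ: "integrable (\<mu> \<Otimes>\<^sub>M B) (\<lambda>z. (norm (Z' z))\<^sup>2)" unfolding nZ' using fst_int(1)[OF intZ] .
  have EZ: "(\<integral>z. (norm (Z' z))\<^sup>2 \<partial>(\<mu> \<Otimes>\<^sub>M B)) = n" unfolding nZ' using fst_int(2)[OF intZ] by (simp add: n)
  have IXZ: "integrable (\<mu> \<Otimes>\<^sub>M B) (\<lambda>z. fst z \<bullet> Z' z)"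
    by (rule integrable_inner_L2[OF X'm Z'm IX IZ])
  have EXZ: "(\<integral>z. fst z \<bullet> Z' z \<partial>(\<mu> \<Otimes>\<^sub>M B)) = n"
  proof -
    have "(\<integral>z. fst z \<bullet> Z' z \<partial>(\<mu> \<Otimes>\<^sub>M B)) = (\<integral>x. (\<integral>b. x \<bullet> Z' (x, b) \<partial>B) \<partial>\<mu>)"
      using MB.integral_fst'[OF IXZ] by simp
    also have "\<dots> = (\<integral>x. (2 * p - 1) * (x \<bullet> Z x) \<partial>\<mu>)"
      unfolding B_def using p by (simp add: Z'_def algebra_simps)
    also have "\<dots> = n" using pc by (simp add: c)
    finally show ?thesis .
  qed
  have lawZ': "distr (\<mu> \<Otimes>\<^sub>M B) borel Z' = gaussian"
  proof (rule measure_eqI)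
    fix A assume "A \<in> sets (distr (\<mu> \<Otimes>\<^sub>M B) borel Z')"
    then have [measurable]: "A \<in> sets borel" by simp
    have "emeasure (distr (\<mu> \<Otimes>\<^sub>M B) borel Z') A = (\<integral>\<^sup>+y. indicator A y \<partial>distr (\<mu> \<Otimes>\<^sub>M B) borel Z')" by simp
    also have "\<dots> = (\<integral>\<^sup>+z. indicator A (Z' z) \<partial>(\<mu> \<Otimes>\<^sub>M B))" by (subst nn_integral_distr) auto
    also have "\<dots> = (\<integral>\<^sup>+x. (\<integral>\<^sup>+b. indicator A (Z' (x, b)) \<partial>B) \<partial>\<mu>)"
      by (subst B.nn_integral_fst[symmetric]) auto
    also have "\<dots> = (\<integral>\<^sup>+x. ennreal p * indicator A (Z x) + ennreal (1 - p) * indicator A (- Z x) \<partial>\<mu>)"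
      unfolding B_def using p by (simp add: Z'_def mult.commute)
    also have "\<dots> = ennreal p * (\<integral>\<^sup>+x. indicator A (Z x) \<partial>\<mu>) + ennreal (1 - p) * (\<integral>\<^sup>+x. indicator A (- Z x) \<partial>\<mu>)"
      by (subst nn_integral_add) (auto simp: nn_integral_cmult)
    also have "(\<integral>\<^sup>+x. indicator A (Z x) \<partial>\<mu>) = (\<integral>\<^sup>+y. indicator A y \<partial>distr \<mu> borel Z)"
      by (subst nn_integral_distr) auto
    also have "\<dots> = emeasure gaussian A" by (simp add: law)
    also have "(\<integral>\<^sup>+x. indicator A (- Z x) \<partial>\<mu>) = (\<integral>\<^sup>+y. indicator A (- y) \<partial>distr \<mu> borel Z)"
      by (subst nn_integral_distr) auto
    also have "\<dots> = (\<integral>\<^sup>+y. indicator A y \<partial>distr gaussian borel uminus)"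
      unfolding law by (subst nn_integral_distr) auto
    also have "\<dots> = emeasure gaussian A" by (simp add: distr_uminus_gaussian)
    also have "ennreal p * emeasure gaussian A + ennreal (1 - p) * emeasure gaussian A = emeasure gaussian A"
      using p by (simp flip: distrib_right ennreal_plus)
    finally show "emeasure (distr (\<mu> \<Otimes>\<^sub>M B) borel Z') A = emeasure gaussian A" .
  qed simp
  \<comment> \<open>The sign is randomness beyond X. Taking the joint law of X and the flipped
    variable returns to a measure on pairs, whose second component is the vector Y.\<close>
  define P where "P = distr (\<mu> \<Otimes>\<^sub>M B) borel (\<lambda>z. (fst z, Z' z))"
  have pm [measurable]: "(\<lambda>z. (fst z, Z' z)) \<in> borel_measurable (\<mu> \<Otimes>\<^sub>M B)"
    unfolding borel_prod[symmetric] by measurable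
  have fm [measurable]: "fst \<in> borel_measurable (borel :: ('a \<times> 'a) measure)" "snd \<in> borel_measurable (borel :: ('a \<times> 'a) measure)"
    unfolding borel_prod[symmetric] by measurable
  have Wm [measurable]: "(\<lambda>z. fst z - snd z) \<in> borel_measurable (borel :: ('a \<times> 'a) measure)" by measurable
  have sP: "sets P = sets borel" by (simp add: P_def)
  have PP: "prob_space P" unfolding P_def by (rule MB.P.prob_space_distr) measurable
  have I1: "integrable P (\<lambda>z. (norm (snd z))\<^sup>2)"
    unfolding P_def using IZ by (subst integrable_distr_eq) auto
  have "integrable (\<mu> \<Otimes>\<^sub>M B) (\<lambda>z. (norm (1 *\<^sub>R fst z + (- 1) *\<^sub>R Z' z))\<^sup>2)"
    by (rule has_integral_norm_sq_combination(1)[OF X'm Z'm IX IZ])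
  then have I2: "integrable P (\<lambda>z. (norm (fst z - snd z))\<^sup>2)"
    unfolding P_def by (subst integrable_distr_eq) auto
  have "distr P borel (\<lambda>z. snd z + (fst z - snd z)) = distr (\<mu> \<Otimes>\<^sub>M B) borel fst"
    unfolding P_def by (subst distr_distr) (auto simp: comp_def)
  also have "\<dots> = distr (\<mu> \<Otimes>\<^sub>M B) \<mu> fst" by (rule distr_cong) (auto simp: sets)
  also have "\<dots> = \<mu>" by (rule B.distr_pair_fst)
  finally have lawP: "distr P borel (\<lambda>z. snd z + (fst z - snd z)) = \<mu>" .
  have "(\<integral>z. snd z \<bullet> (fst z - snd z) \<partial>P) = (\<integral>z. fst z \<bullet> Z' z - (norm (Z' z))\<^sup>2 \<partial>(\<mu> \<Otimes>\<^sub>M B))"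
    unfolding P_def by (subst integral_distr)
      (auto simp: inner_diff_right power2_norm_eq_inner inner_commute intro!: Bochner_Integration.integral_cong)
  also have "\<dots> = 0" using IXZ IZ EXZ EZ by simp
  finally have orth: "(\<integral>z. snd z \<bullet> (fst z - snd z) \<partial>P) = 0" .
  have snd_law: "distr P borel snd = gaussian"
    unfolding P_def by (subst distr_distr) (auto simp: comp_def lawZ')
  have sm: "snd \<in> borel_measurable P" "(\<lambda>z. fst z - snd z) \<in> borel_measurable P"
    unfolding measurable_cong_sets[OF sP refl] by (rule fm Wm)+
  \<comment> \<open>The second component is exactly Gaussian, so coupling it with itself gives
    distance 0, and every nonnegative \<delta> is admissible.\<close>
  have "W2sq (distr P borel snd) (distr P borel snd) \<le> ennreal (\<integral>z. (dist (snd z) (snd z))\<^sup>2 \<partial>P)"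
    by (rule W2sq_le_coupling[OF PP sm(1) sm(1)]) simp
  then have W2: "W2sq (distr P borel snd) gaussian = 0" by (simp add: snd_law)
  show ?thesis
    unfolding W2_decomposition_def
    by (rule exI[of _ P], rule exI[of _ snd], rule exI[of _ "\<lambda>z. fst z - snd z"])
      (use PP sm I1 I2 lawP orth W2 \<delta> in simp)
qed

subsection \<open>The log-Sobolev deficit\<close>

lemma gauss_density_eq_prod: "gauss_density (x :: 'a::euclidean_space) = (\<Prod>b\<in>Basis. std_normal_density (x \<bullet> b))"
proof -
  have "1 / sqrt (2 * pi) = inverse ((2 * pi) powr (1 / 2))"
    using powr_half_sqrt[of "2 * pi"] by (simp only: divide_inverse mult_1_left) simp
  also have "\<dots> = (2 * pi) powr - (1 / 2)" by (rule powr_minus[symmetric])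
  finally have "(1 / sqrt (2 * pi)) ^ DIM('a) = ((2 * pi) powr - (1 / 2)) ^ DIM('a)" by (rule arg_cong)
  also have "\<dots> = (2 * pi) powr (real DIM('a) * - (1 / 2))" by (rule powr_power) simp
  also have "real DIM('a) * - (1 / 2) = - real DIM('a) / 2" by simp
  finally have "(1 / sqrt (2 * pi)) ^ DIM('a) = (2 * pi) powr (- real DIM('a) / 2)" .
  moreover have "(\<Sum>b\<in>Basis. - (x \<bullet> b)\<^sup>2 / 2) = - (norm x)\<^sup>2 / 2"
  proof -
    have "(norm x)\<^sup>2 = (\<Sum>b\<in>Basis. (x \<bullet> b)\<^sup>2)"
      unfolding power2_norm_eq_inner by (subst euclidean_inner) (simp only: power2_eq_square)
    then show ?thesis by (simp only: sum_divide_distrib[symmetric] sum_negf)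
  qed
  moreover have "(\<Prod>b\<in>Basis. std_normal_density (x \<bullet> b)) =
      (1 / sqrt (2 * pi)) ^ DIM('a) * exp (\<Sum>b\<in>Basis. - (x \<bullet> b)\<^sup>2 / 2)"
    unfolding std_normal_density_def prod.distrib exp_sum[OF finite_Basis] by simp
  ultimately show ?thesis by (simp only: gauss_density_def)
qed

lemma gauss_density_has_derivative:
  "(gauss_density has_derivative (\<lambda>v. - (x \<bullet> v) * gauss_density x)) (at (x :: 'a::euclidean_space))"
proof -
  have "((\<lambda>x. (2 * pi) powr (- real DIM('a) / 2) * exp (- (x \<bullet> x) / 2)) has_derivative
     (\<lambda>v. - (x \<bullet> v) * ((2 * pi) powr (- real DIM('a) / 2) * exp (- (x \<bullet> x) / 2)))) (at (x::'a))"
    by (auto intro!: derivative_eq_intros simp: inner_commute algebra_simps)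
  then show ?thesis unfolding gauss_density_def[abs_def] power2_norm_eq_inner .
qed

lemma C1_fun_gauss_density: "C1_fun gauss_density"
proof (rule C1_funI[OF gauss_density_has_derivative])
  have "continuous_on UNIV (gauss_density :: 'a \<Rightarrow> real)"
    by (meson gauss_density_has_derivative continuous_at_imp_continuous_on has_derivative_continuous)
  then show "continuous_on UNIV (\<lambda>x::'a. - (x \<bullet> v) * gauss_density x)" for v
    by (intro continuous_intros)
qed

lemma frechet_derivative_gauss_density:
  "frechet_derivative gauss_density (at x) v = - (x \<bullet> v) * gauss_density x"
  using frechet_derivative_at[OF gauss_density_has_derivative[of x]] by metis

definition coords :: "'a::euclidean_space \<Rightarrow> 'a \<Rightarrow> real" where
  "coords x = (\<lambda>b\<in>Basis. x \<bullet> b)"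

lemma coords_measurable [measurable]: "coords \<in> measurable borel (lborel_on Basis)"
  unfolding coords_def[abs_def] by (rule measurable_restrict) simp

lemma coords_of_coords: "u \<in> space (lborel_on Basis) \<Longrightarrow> coords (of_coords u) = u"
  by (auto simp: coords_def space_PiM PiE_def extensional_def fun_eq_iff)

text \<open>Agreement is asked on the space only, because \<open>coords\<close> inverts
  \<open>of_coords\<close> on extensional functions.\<close>

lemma transfer_of_coords:
  fixes F :: "'a::euclidean_space \<Rightarrow> real"
  assumes "F \<in> borel_measurable borel" "\<And>u. u \<in> space (lborel_on Basis) \<Longrightarrow> F (of_coords u) = Q u"
  shows "integrable lborel F \<longleftrightarrow> integrable (lborel_on Basis) Q"
    and "(\<integral>x. F x \<partial>lborel) = (\<integral>u. Q u \<partial>lborel_on Basis)"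
proof -
  have "integrable (lborel_on Basis) (\<lambda>u. F (of_coords u)) \<longleftrightarrow> integrable (lborel_on Basis) Q"
    by (rule Bochner_Integration.integrable_cong) (simp_all add: assms(2))
  then show "integrable lborel F \<longleftrightarrow> integrable (lborel_on Basis) Q"
    using integrable_of_coords[OF assms(1)] by simp
  have "(\<integral>u. F (of_coords u) \<partial>lborel_on Basis) = (\<integral>u. Q u \<partial>lborel_on Basis)"
    by (rule Bochner_Integration.integral_cong) (simp_all add: assms(2))
  then show "(\<integral>x. F x \<partial>lborel) = (\<integral>u. Q u \<partial>lborel_on Basis)"
    using integral_of_coords[OF assms(1)] by simp
qed

lemma weak_gradient_imp_weak_partial:
  assumes "weak_gradient f G" shows "weak_partial i f (\<lambda>x. G x \<bullet> i)"
proof -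
  have G: "locally_integrable G" using assms by (simp add: weak_gradient_def)
  have "locally_integrable (\<lambda>x. G x \<bullet> i)"
    unfolding locally_integrable_def
  proof (intro allI impI)
    fix K :: "'a set" assume "compact K"
    then have "integrable lborel (\<lambda>x. indicator K x *\<^sub>R G x)" using G by (simp add: locally_integrable_def set_integrable_def)
    then have "integrable lborel (\<lambda>x. (indicator K x *\<^sub>R G x) \<bullet> i)" by (rule integrable_inner_left)
    then show "set_integrable lborel K (\<lambda>x. G x \<bullet> i)" by (simp add: set_integrable_def)
  qed
  then show ?thesis using assms by (simp add: weak_gradient_def weak_partial_def)
qed

text \<open>\<open>f\<close> is only locally integrable. Multiplied by bumps that are positive on
  growing boxes it becomes integrable, with derivative given by the product rule; at a zero of
  \<open>f\<close> the extra term drops out and the bump can be divided off.\<close>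

lemma weak_partial_zero:
  fixes f :: "'a::euclidean_space \<Rightarrow> real"
  assumes W: "weak_partial i f h" and nn: "\<And>x. 0 \<le> f x" and i: "i \<in> Basis"
  shows "AE x in lborel. f x = 0 \<longrightarrow> h x = 0"
proof -
  have f: "locally_integrable f" and h: "locally_integrable h" using W by (auto simp: weak_partial_def)
  have [measurable]: "f \<in> borel_measurable borel" "h \<in> borel_measurable borel"
    using f h by (auto intro: locally_integrable_measurable)
  define \<eta> :: "nat \<Rightarrow> 'a \<Rightarrow> real" where "\<eta> n = box_bump 1 (- real n *\<^sub>R One) (real n *\<^sub>R One)" for n
  have T: "test_function (\<eta> n)" for n unfolding \<eta>_def by (rule test_function_box_bump)
  then have C: "C1_fun (\<eta> n)" for n by (simp add: test_function_iff)
  note [measurable] = C1_fun_measurable[OF C]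
  have "AE x in lborel. \<eta> n x * f x = 0 \<longrightarrow> \<eta> n x * h x + frechet_derivative (\<eta> n) (at x) i * f x = 0" for n
  proof -
    define g D where "g x = \<eta> n x * f x" and "D x = \<eta> n x * h x + frechet_derivative (\<eta> n) (at x) i * f x" for x
    have [measurable]: "g \<in> borel_measurable borel" "D \<in> borel_measurable borel"
      unfolding g_def[abs_def] D_def[abs_def] by measurable
    have W': "weak_partial i g D"
      using weak_partial_mult[OF W C[of n]] by (simp add: g_def[abs_def] D_def[abs_def])
    have gi: "integrable lborel g" unfolding g_def[abs_def]
      using integrable_mult_test(1)[OF f T[of n]] by (simp add: mult.commute)
    have Di: "integrable lborel D" unfolding D_def[abs_def]
      using integrable_mult_test(1)[OF h T[of n]] integrable_mult_test(2)[OF f T[of n], of i]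
      by (intro Bochner_Integration.integrable_add) (simp_all add: mult.commute)
    have gn: "0 \<le> g x" for x unfolding g_def \<eta>_def by (intro mult_nonneg_nonneg box_bump_bounds(1) nn)
    have "AE u in lborel_on Basis. g (of_coords u) = 0 \<longrightarrow> D (of_coords u) = 0"
    proof (rule deriv_zero_on_density_zero[OF finite_Basis i])
      show "0 \<le> g (of_coords u)" for u by (rule gn)
      show "integrable (lborel_on Basis) (\<lambda>u. g (of_coords u))" "integrable (lborel_on Basis) (\<lambda>u. D (of_coords u))"
        using gi Di by (simp_all add: integrable_of_coords)
      show "AE y in lborel_on Basis. g (of_coords y) = antideriv (\<lambda>t. D (of_coords (y(i := t)))) (y i)"
        by (rule weak_partial_coords[OF W' gi Di i])
    qed
    then have "AE x in lborel. g x = 0 \<longrightarrow> D x = 0"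
      by (rule AE_of_coordsD[rotated]) measurable
    then show ?thesis by (simp add: g_def D_def)
  qed
  then have "AE x in lborel. \<forall>n. \<eta> n x * f x = 0 \<longrightarrow> \<eta> n x * h x + frechet_derivative (\<eta> n) (at x) i * f x = 0"
    unfolding AE_all_countable by blast
  then show ?thesis
  proof eventually_elim
    case (elim x)
    show ?case
    proof
      assume "f x = 0"
      obtain n :: nat where n: "norm x < n" using reals_Archimedean2 by blast
      have "x \<in> box (- real n *\<^sub>R One) (real n *\<^sub>R One)" using n by (rule mem_box_One)
      then have "\<eta> n x > 0" unfolding \<eta>_def by (rule box_bump_pos)
      moreover have "\<eta> n x * h x = 0" using elim[THEN spec, of n] \<open>f x = 0\<close> by simp
      ultimately show "h x = 0" by simp
    qed
  qed
qed

section \<open>The score of the measure and its integration by parts\<close>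

locale log_sobolev =
  fixes \<mu> :: "'a::euclidean_space measure" and f :: "'a \<Rightarrow> real" and G :: "'a \<Rightarrow> 'a"
  assumes prob: "prob_space \<mu>" and sets_mu: "sets \<mu> = sets borel"
    and mom: "integrable \<mu> (\<lambda>x. (norm x)\<^sup>2)"
    and f_meas [measurable]: "f \<in> borel_measurable borel" and f_nonneg: "\<And>x. f x \<ge> 0"
    and mu_eq: "\<mu> = density gaussian (\<lambda>x. ennreal (f x))"
    and grad: "weak_gradient f G"
    and fisher: "fisher_info \<mu> f G < \<infinity>"
begin

declare sets_mu [measurable_cong]

sublocale prob_space \<mu> by (rule prob)

lemma G_meas [measurable]: "G \<in> borel_measurable borel"
  using grad by (auto simp: weak_gradient_def intro: locally_integrable_measurable)

text \<open>The Knothe map is built over Lebesgue measure, so the Gaussian weight is absorbed: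
  \<open>g\<close> is the Lebesgue density of \<mu>, \<open>v\<close> the score relative to the
  Gaussian, equal to 0 where \<open>f\<close> vanishes, and \<open>D i\<close> the weak partial
  derivative of \<open>g\<close> by the product rule.\<close>

definition g :: "'a \<Rightarrow> real" where "g x = gauss_density x * f x"
definition v :: "'a \<Rightarrow> 'a" where "v x = G x /\<^sub>R f x"
definition D :: "'a \<Rightarrow> 'a \<Rightarrow> real" where
  "D i x = gauss_density x * (G x \<bullet> i) + frechet_derivative gauss_density (at x) i * f x"

lemma g_meas [measurable]: "g \<in> borel_measurable borel"
  unfolding g_def[abs_def] by measurable

lemma v_meas [measurable]: "v \<in> borel_measurable borel"
  unfolding v_def[abs_def] by measurable

lemma D_meas [measurable]: "D i \<in> borel_measurable borel"
  unfolding D_def[abs_def] frechet_derivative_gauss_density by measurable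

lemma g_nonneg: "0 \<le> g x"
  by (simp add: g_def gauss_density_nonneg f_nonneg)

lemma g_eq_0_iff: "g x = 0 \<longleftrightarrow> f x = 0"
  using gauss_density_pos[of x] by (simp add: g_def)

lemma mu_lborel: "\<mu> = density lborel (\<lambda>x. ennreal (g x))"
  unfolding mu_eq gaussian_def g_def
  by (subst density_density_eq) (auto simp: ennreal_mult gauss_density_nonneg f_nonneg)

lemma integrable_mu: "h \<in> borel_measurable borel \<Longrightarrow> integrable \<mu> h \<longleftrightarrow> integrable lborel (\<lambda>x. g x * h x)" for h :: "'a \<Rightarrow> real"
  unfolding mu_lborel by (subst integrable_density) (auto simp: g_nonneg)

lemma integral_mu: "h \<in> borel_measurable borel \<Longrightarrow> (\<integral>x. h x \<partial>\<mu>) = (\<integral>x. g x * h x \<partial>lborel)" for h :: "'a \<Rightarrow> real"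
  unfolding mu_lborel by (subst integral_density) (auto simp: g_nonneg)

lemma AE_mu_iff: "(AE x in \<mu>. P x) \<longleftrightarrow> (AE x in lborel. g x \<noteq> 0 \<longrightarrow> P x)"
proof -
  have "0 < ennreal (g x) \<longleftrightarrow> g x \<noteq> 0" for x using g_nonneg[of x] by (auto simp: less_le)
  then show ?thesis unfolding mu_lborel by (subst AE_density) simp_all
qed

lemma g_int: "integrable lborel g" and g_total: "(\<integral>x. g x \<partial>lborel) = 1"
  using integrable_mu[of "\<lambda>_. 1"] integral_mu[of "\<lambda>_. 1"] prob_space by auto

lemma v_sq_int: "integrable \<mu> (\<lambda>x. (norm (v x))\<^sup>2)"
  using fisher unfolding fisher_info_def v_def[symmetric] by (intro integrableI_bounded) auto

lemma v_comp_int: "integrable \<mu> (\<lambda>x. (v x \<bullet> i - x \<bullet> i)\<^sup>2)" if "i \<in> Basis"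
proof (rule Bochner_Integration.integrable_bound)
  have "integrable \<mu> (\<lambda>x. (norm (1 *\<^sub>R v x + (- 1) *\<^sub>R x))\<^sup>2)"
    by (rule has_integral_norm_sq_combination(1)[OF _ _ v_sq_int mom]) measurable
  then show "integrable \<mu> (\<lambda>x. (norm (v x - x))\<^sup>2)" by simp
  show "AE x in \<mu>. norm ((v x \<bullet> i - x \<bullet> i)\<^sup>2) \<le> norm ((norm (v x - x))\<^sup>2)"
  proof (rule AE_I2)
    fix x
    have "\<bar>(v x - x) \<bullet> i\<bar> \<le> norm (v x - x)" using that by (rule Basis_le_norm)
    then have "\<bar>(v x - x) \<bullet> i\<bar>\<^sup>2 \<le> (norm (v x - x))\<^sup>2" by (intro power_mono) auto
    then show "norm ((v x \<bullet> i - x \<bullet> i)\<^sup>2) \<le> norm ((norm (v x - x))\<^sup>2)" by (simp add: inner_diff_left)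
  qed
qed measurable

text \<open>The Gaussian factor contributes its logarithmic derivative, minus the coordinate. Where
  \<open>f\<close> vanishes the right side is 0, and \<open>weak_partial_zero\<close> makes the left
  side vanish too.\<close>

lemma D_eq: 
  assumes "i \<in> Basis"
  shows "AE x in lborel. D i x = g x * (v x \<bullet> i - x \<bullet> i)"
  using weak_partial_zero[OF weak_gradient_imp_weak_partial[OF grad] f_nonneg assms]
proof eventually_elim
  case (elim x)
  then show ?case
    by (cases "f x = 0") (auto simp: D_def g_def v_def frechet_derivative_gauss_density field_simps)
qed

text \<open>\<open>weak_gradient\<close> provides local integrability only. Global integrability
  comes from the Fisher information and the second moment, which put the difference of score and
  position in \<open>L^2\<close> of the probability measure \<mu>, hence in
  \<open>L^1\<close>.\<close>

lemma D_int: 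
  assumes i: "i \<in> Basis"
  shows "integrable lborel (D i)"
proof -
  have "integrable \<mu> (\<lambda>x. v x \<bullet> i - x \<bullet> i)"
  proof (rule square_integrable_imp_integrable)
    show "integrable \<mu> (\<lambda>x. (v x \<bullet> i - x \<bullet> i)\<^sup>2)" by (rule v_comp_int[OF i])
  qed measurable
  then have "integrable lborel (\<lambda>x. g x * (v x \<bullet> i - x \<bullet> i))" by (subst (asm) integrable_mu) auto
  then show ?thesis
    using D_eq[OF i] by (subst integrable_cong_AE[where g="\<lambda>x. g x * (v x \<bullet> i - x \<bullet> i)"]) auto
qed

lemma D_sq_int:
  assumes i: "i \<in> Basis"
  shows "integrable lborel (\<lambda>x. (D i x)\<^sup>2 / g x)"
proof -
  have 1: "integrable lborel (\<lambda>x. g x * (v x \<bullet> i - x \<bullet> i)\<^sup>2)"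
    using v_comp_int[OF i] by (subst (asm) integrable_mu) auto
  have "AE x in lborel. (D i x)\<^sup>2 / g x = g x * (v x \<bullet> i - x \<bullet> i)\<^sup>2"
    using D_eq[OF i]
  proof eventually_elim
    case (elim x)
    then show ?case by (cases "g x = 0") (simp_all add: power2_eq_square)
  qed
  then show ?thesis
    using 1 by (subst integrable_cong_AE[where g="\<lambda>x. g x * (v x \<bullet> i - x \<bullet> i)\<^sup>2"]) auto
qed

lemma weak_D: "weak_partial i g (D i)"
  using weak_partial_mult[OF weak_gradient_imp_weak_partial[OF grad] C1_fun_gauss_density]
  by (simp add: g_def[abs_def] D_def[abs_def])

lemma D_coords:
  assumes "i \<in> Basis"
  shows "AE u in lborel_on Basis. g (of_coords u) = antideriv (\<lambda>t. D i (of_coords (u(i := t)))) (u i)"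
  by (rule weak_partial_coords[OF weak_D g_int D_int[OF assms] assms])

lemma W11: "W11_density Basis (\<lambda>u. g (of_coords u)) (\<lambda>i u. D i (of_coords u))"
  unfolding W11_density_def
proof (intro conjI allI ballI)
  show "integrable (lborel_on Basis) (\<lambda>u. g (of_coords u))"
    using g_int by (simp add: integrable_of_coords)
  fix i :: 'a assume i: "i \<in> Basis"
  show "integrable (lborel_on Basis) (\<lambda>u. D i (of_coords u))"
    using D_int[OF i] by (simp add: integrable_of_coords)
  show "integrable (lborel_on Basis) (\<lambda>u. (D i (of_coords u))\<^sup>2 / g (of_coords u))"
    using D_sq_int[OF i] by (subst integrable_of_coords) auto
qed (auto simp: g_nonneg D_coords)

text \<open>Each coordinate is integrated by parts against \<open>D i\<close>, which gives minus the
  total mass, that is -1; summation over the basis produces the dimension.\<close>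

lemma integral_inner_v:
  shows "(\<integral>x. x \<bullet> v x \<partial>\<mu>) = (\<integral>x. (norm x)\<^sup>2 \<partial>\<mu>) - real DIM('a)"
proof -
  have xm: "(\<lambda>x. x) \<in> borel_measurable \<mu>" and vm: "v \<in> borel_measurable \<mu>" by measurable
  have comp: "integrable \<mu> (\<lambda>x. (v x \<bullet> i - x \<bullet> i) * (x \<bullet> i)) \<and> (\<integral>x. (v x \<bullet> i - x \<bullet> i) * (x \<bullet> i) \<partial>\<mu>) = - 1"
    if i: "i \<in> Basis" for i
  proof -
    have "integrable \<mu> (\<lambda>x. (v x \<bullet> i - x \<bullet> i) \<bullet> (x \<bullet> i))"
    proof (rule integrable_inner_L2)
      show "integrable \<mu> (\<lambda>x. (norm (v x \<bullet> i - x \<bullet> i))\<^sup>2)" using v_comp_int[OF i] by simp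
      show "integrable \<mu> (\<lambda>x. (norm (x \<bullet> i))\<^sup>2)"
      proof (rule Bochner_Integration.integrable_bound[OF mom])
        show "AE x in \<mu>. norm ((norm (x \<bullet> i))\<^sup>2) \<le> norm ((norm x)\<^sup>2)"
          using Basis_le_norm[OF i] by (intro AE_I2) (simp add: abs_le_square_iff[symmetric])
      qed measurable
    qed measurable
    then have I: "integrable \<mu> (\<lambda>x. (v x \<bullet> i - x \<bullet> i) * (x \<bullet> i))" by simp
    then have "integrable lborel (\<lambda>x. g x * ((v x \<bullet> i - x \<bullet> i) * (x \<bullet> i)))" by (subst (asm) integrable_mu) auto
    moreover have AE: "AE x in lborel. D i x * (x \<bullet> i) = g x * ((v x \<bullet> i - x \<bullet> i) * (x \<bullet> i))"
      using D_eq[OF i] by eventually_elim simp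
    ultimately have J: "integrable lborel (\<lambda>x. D i x * (x \<bullet> i))"
      by (subst integrable_cong_AE[where g="\<lambda>x. g x * ((v x \<bullet> i - x \<bullet> i) * (x \<bullet> i))"]) auto
    have tr: "integrable lborel (\<lambda>x. D i x * (x \<bullet> i)) \<longleftrightarrow> integrable (lborel_on Basis) (\<lambda>u. D i (of_coords u) * u i)"
      "(\<integral>x. D i x * (x \<bullet> i) \<partial>lborel) = (\<integral>u. D i (of_coords u) * u i \<partial>lborel_on Basis)"
      using i by (intro transfer_of_coords; simp)+
    have "(\<integral>u. D i (of_coords u) * u i \<partial>lborel_on Basis) = - (\<integral>u. g (of_coords u) \<partial>lborel_on Basis)"
    proof (rule integral_deriv_times_coordinate[OF finite_Basis i])
      show "integrable (lborel_on Basis) (\<lambda>u. g (of_coords u))" "integrable (lborel_on Basis) (\<lambda>u. D i (of_coords u))"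
        using g_int D_int[OF i] by (simp_all add: integrable_of_coords)
      show "integrable (lborel_on Basis) (\<lambda>u. D i (of_coords u) * u i)" using J tr(1) by blast
    qed (auto simp: g_nonneg D_coords i)
    also have "(\<integral>u. g (of_coords u) \<partial>lborel_on Basis) = 1" using g_total by (simp add: integral_of_coords)
    finally have "(\<integral>x. D i x * (x \<bullet> i) \<partial>lborel) = - 1" using tr(2) by simp
    moreover have "(\<integral>x. D i x * (x \<bullet> i) \<partial>lborel) = (\<integral>x. (v x \<bullet> i - x \<bullet> i) * (x \<bullet> i) \<partial>\<mu>)"
      using AE by (subst integral_mu) (auto intro!: integral_cong_AE)
    ultimately show ?thesis using I by simp
  qed
  have "(\<integral>x. x \<bullet> v x \<partial>\<mu>) - (\<integral>x. (norm x)\<^sup>2 \<partial>\<mu>) = (\<integral>x. x \<bullet> v x - (norm x)\<^sup>2 \<partial>\<mu>)"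
    using integrable_inner_L2[OF xm vm mom v_sq_int] mom by simp
  also have "\<dots> = (\<integral>x. (\<Sum>i\<in>Basis. (v x \<bullet> i - x \<bullet> i) * (x \<bullet> i)) \<partial>\<mu>)"
  proof (rule Bochner_Integration.integral_cong[OF refl])
    fix x
    have "(v x - x) \<bullet> x = (\<Sum>i\<in>Basis. (v x \<bullet> i - x \<bullet> i) * (x \<bullet> i))"
      by (subst euclidean_inner) (simp only: inner_diff_left)
    moreover have "x \<bullet> v x - (norm x)\<^sup>2 = (v x - x) \<bullet> x"
      by (simp add: power2_norm_eq_inner inner_diff_left inner_commute[of x "v x"])
    ultimately show "x \<bullet> v x - (norm x)\<^sup>2 = (\<Sum>i\<in>Basis. (v x \<bullet> i - x \<bullet> i) * (x \<bullet> i))"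
      by (simp only:)
  qed
  also have "\<dots> = (\<Sum>i\<in>Basis. (\<integral>x. (v x \<bullet> i - x \<bullet> i) * (x \<bullet> i) \<partial>\<mu>))"
    using comp by (intro Bochner_Integration.integral_sum) auto
  also have "\<dots> = (\<Sum>i\<in>(Basis::'a set). - 1)"
    using comp by (intro sum.cong) auto
  also have "\<dots> = - real DIM('a)" by simp
  finally show ?thesis by simp
qed

end

section \<open>Transport to the Gaussian and the deficit\<close>

context log_sobolev
begin

text \<open>\<open>e\<close> is the diagonal of the Jacobian of the Knothe map \<open>Z\<close>.\<close>

lemma transport:
  obtains Z :: "'a \<Rightarrow> 'a" and e :: "'a \<Rightarrow> 'a \<Rightarrow> real" where
    "Z \<in> borel_measurable borel" "\<And>b. b \<in> Basis \<Longrightarrow> e b \<in> borel_measurable borel" "\<And>b x. b \<in> Basis \<Longrightarrow> 0 \<le> e b x"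
    "distr \<mu> borel Z = gaussian"
    "AE x in \<mu>. g x = (\<Prod>b\<in>Basis. std_normal_density (Z x \<bullet> b) * e b x)"
    "\<And>b. b \<in> Basis \<Longrightarrow> integrable \<mu> (\<lambda>x. (Z x \<bullet> b)\<^sup>2)"
    "\<And>b. b \<in> Basis \<Longrightarrow> (\<integral>x. (Z x \<bullet> b)\<^sup>2 \<partial>\<mu>) = 1"
    "\<And>b. b \<in> Basis \<Longrightarrow> integrable \<mu> (e b)"
    "\<And>b. b \<in> Basis \<Longrightarrow> (\<integral>x. e b x \<partial>\<mu>) = - (\<integral>x. (v x \<bullet> b - x \<bullet> b) * (Z x \<bullet> b) \<partial>\<mu>)"
proof -
  obtain T d where K: "Knothe_map Basis (\<lambda>u. g (of_coords u)) (\<lambda>i u. D i (of_coords u)) T d"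
    using Knothe_map_exists[OF finite_Basis W11] by blast
  have tot: "(\<integral>u. g (of_coords u) \<partial>lborel_on Basis) = 1" using g_total by (simp add: integral_of_coords)
  note K' = K[unfolded Knothe_map_def tot]
  have T [measurable]: "T b \<in> borel_measurable (lborel_on Basis)" and d [measurable]: "d b \<in> borel_measurable (lborel_on Basis)"
    and dnn: "0 \<le> d b y" if "b \<in> Basis" for b y
    using K' that by auto
  have law: "(\<integral>\<^sup>+y. ennreal (g (of_coords y)) * h (\<lambda>k\<in>Basis. T k y) \<partial>lborel_on Basis) =
      (\<integral>\<^sup>+u. ennreal (\<Prod>k\<in>Basis. std_normal_density (u k)) * h u \<partial>lborel_on Basis)"
    if "h \<in> borel_measurable (lborel_on Basis)" for h
    using K' that by auto
  have factor: "AE y in lborel_on Basis. g (of_coords y) \<noteq> 0 \<longrightarrow>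
        g (of_coords y) = (\<Prod>k\<in>Basis. std_normal_density (T k y) * d k y)"
    using K' by auto
  have ints: "integrable (lborel_on Basis) (\<lambda>y. g (of_coords y) * (T k y)\<^sup>2)"
        "(\<integral>y. g (of_coords y) * (T k y)\<^sup>2 \<partial>lborel_on Basis) = 1"
        "integrable (lborel_on Basis) (\<lambda>y. g (of_coords y) * d k y)"
        "(\<integral>y. g (of_coords y) * d k y \<partial>lborel_on Basis) = - (\<integral>y. D k (of_coords y) * T k y \<partial>lborel_on Basis)" if "k \<in> Basis" for k
    using K' that by auto
  \<comment> \<open>The map obtained so far acts on functions over \<open>Basis\<close>;
    \<open>coords\<close> and \<open>of_coords\<close> move it to the Euclidean space.\<close>
  define Z where "Z x = of_coords (\<lambda>b\<in>Basis. T b (coords x))" for x :: 'a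
  define e where "e b x = d b (coords x)" for b x :: 'a
  have TT [measurable]: "(\<lambda>y. \<lambda>b\<in>Basis. T b y) \<in> measurable (lborel_on Basis) (lborel_on Basis)"
    by (rule measurable_restrict) simp
  have Zm [measurable]: "Z \<in> borel_measurable borel"
    unfolding Z_def[abs_def] by measurable
  have em [measurable]: "e b \<in> borel_measurable borel" if "b \<in> Basis" for b
    unfolding e_def[abs_def] using that by measurable
  have Zb: "Z x \<bullet> b = T b (coords x)" if "b \<in> Basis" for x b
    using that by (simp add: Z_def)
  have lawZ: "distr \<mu> borel Z = gaussian"
  proof (rule measure_eqI)
    fix A assume "A \<in> sets (distr \<mu> borel Z)"
    then have A [measurable]: "A \<in> sets borel" by simp
    have "emeasure (distr \<mu> borel Z) A = (\<integral>\<^sup>+y. indicator A y \<partial>distr \<mu> borel Z)" by simp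
    also have "\<dots> = (\<integral>\<^sup>+x. indicator A (Z x) \<partial>\<mu>)" by (rule nn_integral_distr) measurable
    also have "\<dots> = (\<integral>\<^sup>+x. ennreal (g x) * indicator A (Z x) \<partial>lborel)"
      unfolding mu_lborel by (rule nn_integral_density) measurable
    also have "\<dots> = (\<integral>\<^sup>+u. ennreal (g (of_coords u)) * indicator A (Z (of_coords u)) \<partial>lborel_on Basis)"
      by (rule nn_integral_of_coords[symmetric]) measurable
    also have "\<dots> = (\<integral>\<^sup>+u. ennreal (g (of_coords u)) * indicator A (of_coords (\<lambda>k\<in>Basis. T k u)) \<partial>lborel_on Basis)"
      by (rule nn_integral_cong) (simp add: Z_def coords_of_coords)
    also have "\<dots> = (\<integral>\<^sup>+u. ennreal (\<Prod>k\<in>Basis. std_normal_density (u k)) * indicator A (of_coords u) \<partial>lborel_on Basis)"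
      by (rule law) measurable
    also have "\<dots> = (\<integral>\<^sup>+u. ennreal (gauss_density (of_coords u :: 'a)) * indicator A (of_coords u) \<partial>lborel_on Basis)"
      by (rule nn_integral_cong) (simp add: gauss_density_eq_prod)
    also have "\<dots> = (\<integral>\<^sup>+x. ennreal (gauss_density x) * indicator A x \<partial>lborel)"
      by (rule nn_integral_of_coords) measurable
    also have "\<dots> = emeasure gaussian A"
      unfolding gaussian_def by (rule emeasure_density[symmetric]) auto
    finally show "emeasure (distr \<mu> borel Z) A = emeasure gaussian A" .
  qed simp
  have prod_m [measurable]: "(\<lambda>x. \<Prod>b\<in>Basis. std_normal_density (Z x \<bullet> b) * e b x) \<in> borel_measurable borel"
  proof (intro borel_measurable_prod borel_measurable_times em)
    fix b :: 'a
    show "(\<lambda>x. std_normal_density (Z x \<bullet> b)) \<in> borel_measurable borel" by measurable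
  qed
  have factorZ: "AE x in \<mu>. g x = (\<Prod>b\<in>Basis. std_normal_density (Z x \<bullet> b) * e b x)"
    unfolding AE_mu_iff
  proof (rule AE_of_coordsD)
    have "{x \<in> space borel. g x \<noteq> 0 \<longrightarrow> g x = (\<Prod>b\<in>Basis. std_normal_density (Z x \<bullet> b) * e b x)} \<in> sets borel"
      by (rule sets_Collect_eq_if_nonzero[OF g_meas prod_m])
    then show "{x. g x \<noteq> 0 \<longrightarrow> g x = (\<Prod>b\<in>Basis. std_normal_density (Z x \<bullet> b) * e b x)} \<in> sets borel" by simp
    show "AE u in lborel_on Basis. g (of_coords u) \<noteq> 0 \<longrightarrow>
        g (of_coords u) = (\<Prod>b\<in>Basis. std_normal_density (Z (of_coords u) \<bullet> b) * e b (of_coords u))"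
      using factor AE_space
    proof eventually_elim
      case (elim u)
      have "(\<Prod>b\<in>Basis. std_normal_density (Z (of_coords u) \<bullet> b) * e b (of_coords u)) = (\<Prod>k\<in>Basis. std_normal_density (T k u) * d k u)"
        by (rule prod.cong[OF refl]) (simp add: Zb e_def coords_of_coords[OF elim(2)])
      then show ?case using elim(1) by (simp only:) 
    qed
  qed
  have comp: "integrable \<mu> (\<lambda>x. (Z x \<bullet> b)\<^sup>2) \<and> (\<integral>x. (Z x \<bullet> b)\<^sup>2 \<partial>\<mu>) = 1 \<and> integrable \<mu> (e b) \<and>
    (\<integral>x. e b x \<partial>\<mu>) = - (\<integral>x. (v x \<bullet> b - x \<bullet> b) * (Z x \<bullet> b) \<partial>\<mu>)" if b: "b \<in> Basis" for b
  proof -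
    have tr1: "integrable lborel (\<lambda>x. g x * (Z x \<bullet> b)\<^sup>2) \<longleftrightarrow> integrable (lborel_on Basis) (\<lambda>y. g (of_coords y) * (T b y)\<^sup>2)"
      "(\<integral>x. g x * (Z x \<bullet> b)\<^sup>2 \<partial>lborel) = (\<integral>y. g (of_coords y) * (T b y)\<^sup>2 \<partial>lborel_on Basis)"
      by (rule transfer_of_coords; simp add: Zb[OF b] coords_of_coords b)+
    have ge_m: "(\<lambda>x. g x * e b x) \<in> borel_measurable borel"
      by (intro borel_measurable_times g_meas em b)
    have ge: "g (of_coords u) * e b (of_coords u) = g (of_coords u) * d b u" if "u \<in> space (lborel_on Basis)" for u
      by (simp add: e_def coords_of_coords[OF that])
    note tr2 = transfer_of_coords[OF ge_m ge]
    have tr3: "(\<integral>x. D b x * (Z x \<bullet> b) \<partial>lborel) = (\<integral>y. D b (of_coords y) * T b y \<partial>lborel_on Basis)"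
      by (rule transfer_of_coords(2)) (simp_all add: Zb[OF b] coords_of_coords b)
    have "(\<integral>x. D b x * (Z x \<bullet> b) \<partial>lborel) = (\<integral>x. g x * ((v x \<bullet> b - x \<bullet> b) * (Z x \<bullet> b)) \<partial>lborel)"
      using D_eq[OF b] by (intro integral_cong_AE) auto
    also have "\<dots> = (\<integral>x. (v x \<bullet> b - x \<bullet> b) * (Z x \<bullet> b) \<partial>\<mu>)"
      by (rule integral_mu[symmetric]) measurable
    finally have DZ: "(\<integral>x. D b x * (Z x \<bullet> b) \<partial>lborel) = (\<integral>x. (v x \<bullet> b - x \<bullet> b) * (Z x \<bullet> b) \<partial>\<mu>)" .
    have m1: "(\<lambda>x. (Z x \<bullet> b)\<^sup>2) \<in> borel_measurable borel" by measurable
    show ?thesis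
      unfolding integrable_mu[OF m1] integral_mu[OF m1] integrable_mu[OF em[OF b]] integral_mu[OF em[OF b]]
      using tr1 tr2 tr3 DZ ints[OF b] by simp
  qed
  have e_nonneg: "0 \<le> e b x" if "b \<in> Basis" for b x
    using dnn[OF that] by (simp add: e_def)
  show ?thesis
    by (rule that[OF Zm em _ lawZ factorZ]) (use comp e_nonneg in auto)
qed

text \<open>Expanding the square gives \<open>I - 2 * (c - vz - n - n / 2 + m / 2)\<close>, where
  the bracket is the mean of a pointwise upper bound \<open>R\<close> of \<open>ln f\<close>. Twice
  the deficit is \<open>I\<close> minus twice the mean of \<open>ln f\<close>, so all that is lost
  is the loss in the logarithm bound for the diagonal derivatives.\<close>

lemma deficit_transport_bound:
  obtains Z :: "'a \<Rightarrow> 'a" where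
    "Z \<in> borel_measurable borel" "distr \<mu> borel Z = gaussian"
    "integrable \<mu> (\<lambda>x. (norm (Z x))\<^sup>2)" "(\<integral>x. (norm (Z x))\<^sup>2 \<partial>\<mu>) = real DIM('a)"
    "(\<integral>x. (norm (x - v x - Z x))\<^sup>2 \<partial>\<mu>) \<le> 2 * lsi_deficit \<mu> f G"
proof -
  obtain Z :: "'a \<Rightarrow> 'a" and e :: "'a \<Rightarrow> 'a \<Rightarrow> real" where
    Zm [measurable]: "Z \<in> borel_measurable borel" and em: "\<And>b. b \<in> Basis \<Longrightarrow> e b \<in> borel_measurable borel"
    and enn: "\<And>b x. b \<in> Basis \<Longrightarrow> 0 \<le> e b x"
    and law: "distr \<mu> borel Z = gaussian"
    and factor: "AE x in \<mu>. g x = (\<Prod>b\<in>Basis. std_normal_density (Z x \<bullet> b) * e b x)"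
    and Zb: "\<And>b. b \<in> Basis \<Longrightarrow> integrable \<mu> (\<lambda>x. (Z x \<bullet> b)\<^sup>2)"
    "\<And>b. b \<in> Basis \<Longrightarrow> (\<integral>x. (Z x \<bullet> b)\<^sup>2 \<partial>\<mu>) = 1"
    and eb: "\<And>b. b \<in> Basis \<Longrightarrow> integrable \<mu> (e b)"
    "\<And>b. b \<in> Basis \<Longrightarrow> (\<integral>x. e b x \<partial>\<mu>) = - (\<integral>x. (v x \<bullet> b - x \<bullet> b) * (Z x \<bullet> b) \<partial>\<mu>)"
    using transport by blast
  have nsq: "(norm x)\<^sup>2 = (\<Sum>b\<in>Basis. (x \<bullet> b)\<^sup>2)" for x :: 'a
    unfolding power2_norm_eq_inner by (subst euclidean_inner) (simp only: power2_eq_square)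
  have intZ: "integrable \<mu> (\<lambda>x. (norm (Z x))\<^sup>2)"
    unfolding nsq using Zb(1) by (intro Bochner_Integration.integrable_sum)
  have EZ: "(\<integral>x. (norm (Z x))\<^sup>2 \<partial>\<mu>) = real DIM('a)"
    unfolding nsq by (subst Bochner_Integration.integral_sum) (simp_all add: Zb)
  have xm: "(\<lambda>x. x) \<in> borel_measurable \<mu>" and vm: "v \<in> borel_measurable \<mu>" and Zmu: "Z \<in> borel_measurable \<mu>" by measurable
  define m n c vz I where "m = (\<integral>x. (norm x)\<^sup>2 \<partial>\<mu>)" and "n = real DIM('a)"
    and "c = (\<integral>x. x \<bullet> Z x \<partial>\<mu>)" and "vz = (\<integral>x. v x \<bullet> Z x \<partial>\<mu>)" and "I = (\<integral>x. (norm (v x))\<^sup>2 \<partial>\<mu>)"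
  note ixz = integrable_inner_L2[OF xm Zmu mom intZ]
  note ivz = integrable_inner_L2[OF vm Zmu v_sq_int intZ]
  note ixv = integrable_inner_L2[OF xm vm mom v_sq_int]
  have ivxz: "integrable \<mu> (\<lambda>x. (v x \<bullet> b - x \<bullet> b) * (Z x \<bullet> b))" if b: "b \<in> Basis" for b
  proof -
    have "integrable \<mu> (\<lambda>x. (v x \<bullet> b - x \<bullet> b) \<bullet> (Z x \<bullet> b))"
      by (rule integrable_inner_L2) (use v_comp_int[OF b] Zb(1)[OF b] in simp_all)
    then show ?thesis by simp
  qed
  \<comment> \<open>The mean trace of the Jacobian equals the mean of
    \<open>(x - v x) \<bullet> Z x\<close>.\<close>
  have sum_e: "(\<Sum>b\<in>Basis. (\<integral>x. e b x \<partial>\<mu>)) = c - vz"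
  proof -
    have "(\<Sum>b\<in>Basis. (\<integral>x. e b x \<partial>\<mu>)) = - (\<Sum>b\<in>Basis. (\<integral>x. (v x \<bullet> b - x \<bullet> b) * (Z x \<bullet> b) \<partial>\<mu>))"
      by (simp add: eb(2) sum_negf)
    also have "(\<Sum>b\<in>Basis. (\<integral>x. (v x \<bullet> b - x \<bullet> b) * (Z x \<bullet> b) \<partial>\<mu>)) = (\<integral>x. (\<Sum>b\<in>Basis. (v x \<bullet> b - x \<bullet> b) * (Z x \<bullet> b)) \<partial>\<mu>)"
      by (rule Bochner_Integration.integral_sum[symmetric]) (rule ivxz)
    also have "\<dots> = (\<integral>x. v x \<bullet> Z x - x \<bullet> Z x \<partial>\<mu>)"
    proof (rule Bochner_Integration.integral_cong[OF refl])
      fix x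
      have "(v x - x) \<bullet> Z x = (\<Sum>b\<in>Basis. (v x \<bullet> b - x \<bullet> b) * (Z x \<bullet> b))"
        by (subst euclidean_inner) (simp only: inner_diff_left)
      then show "(\<Sum>b\<in>Basis. (v x \<bullet> b - x \<bullet> b) * (Z x \<bullet> b)) = v x \<bullet> Z x - x \<bullet> Z x"
        by (simp only: inner_diff_left)
    qed
    also have "\<dots> = vz - c" using ixz ivz by (simp add: c_def vz_def)
    finally show ?thesis by simp
  qed
  \<comment> \<open>Each \<open>e b x - 1\<close> bounds a logarithm, and the squares are the
    exponents of the Gaussian densities at \<open>Z x\<close> and at \<open>x\<close>, whose
    normalising constants cancel.\<close>
  define R where "R x = (\<Sum>b\<in>Basis. e b x - 1 - (Z x \<bullet> b)\<^sup>2 / 2) + (norm x)\<^sup>2 / 2" for x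
  have R_int: "integrable \<mu> R"
    unfolding R_def[abs_def]
    by (intro Bochner_Integration.integrable_add Bochner_Integration.integrable_sum Bochner_Integration.integrable_diff
        integrable_divide eb(1) Zb(1) mom integrable_const)
  have ER: "(\<integral>x. R x \<partial>\<mu>) = c - vz - n - n / 2 + m / 2"
  proof -
    \<comment> \<open>\<open>3 / 2\<close> is the 1 from the logarithm bound plus half the unit
      second moment of a component of \<open>Z\<close>.\<close>
    have tm: "integrable \<mu> (\<lambda>x. e b x - 1 - (Z x \<bullet> b)\<^sup>2 / 2)"
      "(\<integral>x. e b x - 1 - (Z x \<bullet> b)\<^sup>2 / 2 \<partial>\<mu>) = (\<integral>x. e b x \<partial>\<mu>) - 3 / 2" if b: "b \<in> Basis" for b
      using eb(1)[OF b] Zb[OF b] by (simp_all add: prob_space)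
    have "(\<integral>x. R x \<partial>\<mu>) = (\<Sum>b\<in>Basis. (\<integral>x. e b x - 1 - (Z x \<bullet> b)\<^sup>2 / 2 \<partial>\<mu>)) + m / 2"
      unfolding R_def using tm(1) mom
      by (subst Bochner_Integration.integral_add) (auto simp: m_def intro!: Bochner_Integration.integral_sum)
    also have "\<dots> = (\<Sum>b\<in>Basis. (\<integral>x. e b x \<partial>\<mu>) - 3 / 2) + m / 2" by (simp add: tm(2))
    also have "\<dots> = c - vz - n - n / 2 + m / 2" by (simp add: sum_subtractf sum_e n_def)
    finally show ?thesis .
  qed
  have fpos: "AE x in \<mu>. 0 < f x"
    unfolding AE_mu_iff using f_nonneg by (auto simp: g_eq_0_iff less_le)
  have upper: "AE x in \<mu>. ln (f x) \<le> R x"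
    using factor fpos
  proof eventually_elim
    case (elim x)
    \<comment> \<open>At a point of positive density no factor of the product vanishes, so the
      logarithm may be split.\<close>
    have ne: "e b x \<noteq> 0" if "b \<in> Basis" for b
    proof
      assume "e b x = 0"
      then have "g x = 0" using elim(1) that by (auto simp: prod_zero_iff)
      then show False using elim(2) g_eq_0_iff[of x] by simp
    qed
    then have pos: "0 < e b x" if "b \<in> Basis" for b using enn[OF that, of x] that by (simp add: less_le)
    have lnstd: "ln (std_normal_density t) = - ln (sqrt (2 * pi)) - t\<^sup>2 / 2" for t
      by (simp add: std_normal_density_def ln_div ln_mult)
    have spos: "0 < std_normal_density t" for t by (rule normal_density_pos) simp
    then have sne: "std_normal_density t \<noteq> 0" for t by (metis less_irrefl)
    have "ln (f x) = ln (g x) - ln (gauss_density x)"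
      using elim(2) gauss_density_pos[of x] by (simp add: g_def ln_mult)
    also have "ln (g x) = (\<Sum>b\<in>Basis. ln (std_normal_density (Z x \<bullet> b) * e b x))"
      unfolding elim(1) by (rule ln_prod) (use ne sne in auto)
    also have "ln (gauss_density x) = (\<Sum>b\<in>Basis. ln (std_normal_density (x \<bullet> b)))"
      unfolding gauss_density_eq_prod by (rule ln_prod) (use sne in auto)
    also have "(\<Sum>b\<in>Basis. ln (std_normal_density (Z x \<bullet> b) * e b x)) - (\<Sum>b\<in>Basis. ln (std_normal_density (x \<bullet> b)))
      = (\<Sum>b\<in>Basis. ln (std_normal_density (Z x \<bullet> b) * e b x) - ln (std_normal_density (x \<bullet> b)))"
      by (rule sum_subtractf[symmetric])
    also have "\<dots> \<le> (\<Sum>b\<in>Basis. (e b x - 1 - (Z x \<bullet> b)\<^sup>2 / 2) + (x \<bullet> b)\<^sup>2 / 2)"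
    proof (rule sum_mono)
      fix b :: 'a assume b: "b \<in> Basis"
      have "ln (std_normal_density (Z x \<bullet> b) * e b x) = ln (std_normal_density (Z x \<bullet> b)) + ln (e b x)"
        using pos[OF b] spos by (intro ln_mult_pos)
      then show "ln (std_normal_density (Z x \<bullet> b) * e b x) - ln (std_normal_density (x \<bullet> b)) \<le> (e b x - 1 - (Z x \<bullet> b)\<^sup>2 / 2) + (x \<bullet> b)\<^sup>2 / 2"
        using ln_le_minus_one[OF pos[OF b]] by (simp add: lnstd)
    qed
    also have "\<dots> = R x" by (simp add: R_def nsq sum.distrib sum_divide_distrib)
    finally show ?case .
  qed
  \<comment> \<open>This controls \<open>ln f\<close> from below: \<open>- ln f\<close> is at most
    \<open>1 / f\<close>, whose mean under \<mu> is at most the total Gaussian mass.\<close>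
  have inv_int: "integrable \<mu> (\<lambda>x. 1 / f x)"
  proof -
    have "prob_space (gaussian :: 'a measure)" using prob_space_distr[OF Zmu] by (simp add: law)
    then interpret gam: prob_space "gaussian :: 'a measure" .
    have "integrable (gaussian :: 'a measure) (\<lambda>_. 1 :: real)" by simp
    then have "integrable lborel (\<lambda>x::'a. gauss_density x)"
      unfolding gaussian_def by (subst (asm) integrable_density) (auto simp: gauss_density_nonneg)
    then have "integrable lborel (\<lambda>x. g x * (1 / f x))"
    proof (rule Bochner_Integration.integrable_bound)
      show "AE x in lborel. norm (g x * (1 / f x)) \<le> norm (gauss_density x)"
        using gauss_density_nonneg by (intro AE_I2) (simp add: g_def)
    qed measurable
    then show ?thesis by (subst integrable_mu) auto
  qed
  \<comment> \<open>Without integrability the Bochner integral of \<open>ln f\<close> would be 0 by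
    convention and could not be compared with that of \<open>R\<close>.\<close>
  have ln_int: "integrable \<mu> (\<lambda>x. ln (f x))"
  proof (rule Bochner_Integration.integrable_bound)
    show "integrable \<mu> (\<lambda>x. \<bar>R x\<bar> + 1 / f x)" using R_int inv_int by simp
    show "AE x in \<mu>. norm (ln (f x)) \<le> norm (\<bar>R x\<bar> + 1 / f x)"
      using upper fpos
    proof eventually_elim
      case (elim x)
      have "ln (1 / f x) \<le> 1 / f x - 1" using elim(2) by (intro ln_le_minus_one) simp
      then have "- ln (f x) \<le> 1 / f x" using elim(2) by (simp add: ln_div)
      moreover have "0 < 1 / f x" using elim(2) by simp
      ultimately show ?case using elim(1) unfolding real_norm_def by linarith
    qed
  qed measurable
  have H: "(\<integral>x. ln (f x) \<partial>\<mu>) \<le> c - vz - n - n / 2 + m / 2"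
    using integral_mono_AE[OF ln_int R_int upper] by (simp add: ER)
  have def: "2 * lsi_deficit \<mu> f G = I - 2 * (\<integral>x. ln (f x) \<partial>\<mu>)"
    by (simp add: lsi_deficit_def I_def v_def)
  have xv: "(\<integral>x. x \<bullet> v x \<partial>\<mu>) = m - n" using integral_inner_v by (simp add: m_def n_def)
  define U where "U x = x - Z x" for x
  have Um: "U \<in> borel_measurable \<mu>" unfolding U_def[abs_def] by measurable
  have Ueq: "U x = 1 *\<^sub>R x + (- 1) *\<^sub>R Z x" for x by (simp add: U_def)
  have U_int: "integrable \<mu> (\<lambda>x. (norm (U x))\<^sup>2)"
    unfolding Ueq by (rule has_integral_norm_sq_combination(1)[OF xm Zmu mom intZ])
  have EU: "(\<integral>x. (norm (U x))\<^sup>2 \<partial>\<mu>) = m - 2 * c + n"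
    unfolding Ueq has_integral_norm_sq_combination(2)[OF xm Zmu mom intZ] by (simp add: m_def c_def EZ n_def)
  have EUv: "(\<integral>x. U x \<bullet> v x \<partial>\<mu>) = (m - n) - vz"
  proof -
    have "(\<integral>x. U x \<bullet> v x \<partial>\<mu>) = (\<integral>x. x \<bullet> v x - v x \<bullet> Z x \<partial>\<mu>)"
      by (rule Bochner_Integration.integral_cong[OF refl]) (simp add: U_def inner_diff_left inner_commute)
    also have "\<dots> = (m - n) - vz" using ixv ivz by (simp add: xv vz_def)
    finally show ?thesis .
  qed
  have "(\<integral>x. (norm (x - v x - Z x))\<^sup>2 \<partial>\<mu>) = (\<integral>x. (norm (1 *\<^sub>R U x + (- 1) *\<^sub>R v x))\<^sup>2 \<partial>\<mu>)"
    by (rule Bochner_Integration.integral_cong[OF refl]) (simp add: U_def algebra_simps)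
  also have "\<dots> = (m - 2 * c + n) - 2 * ((m - n) - vz) + I"
    unfolding has_integral_norm_sq_combination(2)[OF Um vm U_int v_sq_int] by (simp add: EU EUv I_def)
  also have "\<dots> \<le> 2 * lsi_deficit \<mu> f G" unfolding def using H by simp
  finally have main: "(\<integral>x. (norm (x - v x - Z x))\<^sup>2 \<partial>\<mu>) \<le> 2 * lsi_deficit \<mu> f G" .
  show ?thesis by (rule that[OF Zm law intZ EZ main])
qed

lemma decomposition: "W2_decomposition \<mu> (lsi_deficit \<mu> f G)"
proof -
  obtain Z :: "'a \<Rightarrow> 'a" where
    Zm [measurable]: "Z \<in> borel_measurable borel" and law: "distr \<mu> borel Z = gaussian"
    and intZ: "integrable \<mu> (\<lambda>x. (norm (Z x))\<^sup>2)" and EZ: "(\<integral>x. (norm (Z x))\<^sup>2 \<partial>\<mu>) = real DIM('a)"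
    and Q: "(\<integral>x. (norm (x - v x - Z x))\<^sup>2 \<partial>\<mu>) \<le> 2 * lsi_deficit \<mu> f G"
    using deficit_transport_bound by blast
  define \<delta> m c where "\<delta> = lsi_deficit \<mu> f G" and "m = (\<integral>x. (norm x)\<^sup>2 \<partial>\<mu>)" and "c = (\<integral>x. x \<bullet> Z x \<partial>\<mu>)"
  \<comment> \<open>The deficit dominates the integral of a square. Its nonnegativity is the
    logarithmic Sobolev inequality itself, and both decompositions below depend on it.\<close>
  have "0 \<le> (\<integral>x. (norm (x - v x - Z x))\<^sup>2 \<partial>\<mu>)" by simp
  from order_trans[OF this Q] have \<delta>: "0 \<le> \<delta>" by (simp add: \<delta>_def)
  have m0: "0 \<le> m" by (simp add: m_def)
  have xm: "(\<lambda>x. x) \<in> borel_measurable \<mu>" and vm: "v \<in> borel_measurable \<mu>" and Zmu: "Z \<in> borel_measurable \<mu>" by measurable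
  have bound: "real DIM('a) - c \<le> sqrt (2 * \<delta> * m)"
  proof -
    define V where "V x = x - v x" for x
    have Vm: "V \<in> borel_measurable \<mu>" unfolding V_def[abs_def] by measurable
    have Veq: "V x = 1 *\<^sub>R x + (- 1) *\<^sub>R v x" for x by (simp add: V_def)
    have V_int: "integrable \<mu> (\<lambda>x. (norm (V x))\<^sup>2)"
      unfolding Veq by (rule has_integral_norm_sq_combination(1)[OF xm vm mom v_sq_int])
    have "integrable \<mu> (\<lambda>x. (norm (1 *\<^sub>R V x + (- 1) *\<^sub>R Z x))\<^sup>2)"
      by (rule has_integral_norm_sq_combination(1)[OF Vm Zmu V_int intZ])
    then have D_int: "integrable \<mu> (\<lambda>x. (norm (x - v x - Z x))\<^sup>2)" by (simp add: V_def)
    have Dm: "(\<lambda>x. x - v x - Z x) \<in> borel_measurable \<mu>" by measurable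
    have "(\<integral>x. x \<bullet> (x - v x - Z x) \<partial>\<mu>) = (\<integral>x. (norm x)\<^sup>2 - x \<bullet> v x - x \<bullet> Z x \<partial>\<mu>)"
      by (rule Bochner_Integration.integral_cong[OF refl]) (simp add: inner_diff_right power2_norm_eq_inner)
    also have "\<dots> = m - (m - real DIM('a)) - c"
      using mom integrable_inner_L2[OF xm vm mom v_sq_int] integrable_inner_L2[OF xm Zmu mom intZ]
      by (simp add: integral_inner_v m_def c_def)
    finally have "real DIM('a) - c = (\<integral>x. x \<bullet> (x - v x - Z x) \<partial>\<mu>)" by simp
    also have "\<dots> \<le> sqrt (m * (\<integral>x. (norm (x - v x - Z x))\<^sup>2 \<partial>\<mu>))"
      unfolding m_def by (rule Cauchy_Schwarz_L2[OF xm Dm mom D_int])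
    also have "\<dots> \<le> sqrt (m * (2 * \<delta>))"
      using Q m0 by (intro real_sqrt_le_mono mult_left_mono) (simp_all add: \<delta>_def)
    finally show ?thesis by (simp add: mult_ac)
  qed
  show ?thesis
  proof (cases "c \<le> real DIM('a)")
    case True
    show ?thesis
      using W2_decomposition_project[OF prob sets_mu mom Zm law intZ \<delta> m_def EZ[symmetric] c_def bound True]
      by (simp add: \<delta>_def)
  next
    case False
    then have "real DIM('a) < c" by simp
    from W2_decomposition_flip[OF prob sets_mu mom Zm law intZ \<delta> EZ[symmetric] c_def this]
    show ?thesis by (simp add: \<delta>_def)
  qed
qed

end

theorem theorem5:
  fixes \<mu> :: "'a::euclidean_space measure"
    and f :: "'a \<Rightarrow> real" and G :: "'a \<Rightarrow> 'a"
  assumes "prob_space \<mu>" and "sets \<mu> = sets borel"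
    and "integrable \<mu> (\<lambda>x. (norm x)\<^sup>2)"
    and "f \<in> borel_measurable borel" and "\<forall>x. f x \<ge> 0"
    and "\<mu> = density gaussian (\<lambda>x. ennreal (f x))"
    and "weak_gradient f G"
    and "fisher_info \<mu> f G < \<infinity>"
  shows "\<exists>(P :: ('a \<times> 'a) measure) Y W.
           prob_space P \<and>
           Y \<in> borel_measurable P \<and> W \<in> borel_measurable P \<and>
           integrable P (\<lambda>\<omega>. (norm (Y \<omega>))\<^sup>2) \<and> integrable P (\<lambda>\<omega>. (norm (W \<omega>))\<^sup>2) \<and>
           distr P borel (\<lambda>\<omega>. Y \<omega> + W \<omega>) = \<mu> \<and>
           (\<integral>\<omega>. Y \<omega> \<bullet> W \<omega> \<partial>P) = 0 \<and>
           W2sq (distr P borel Y) gaussian < \<infinity> \<and>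
           lsi_deficit \<mu> f G \<ge> (1/2) * enn2real (W2sq (distr P borel Y) gaussian)"
proof -
  interpret log_sobolev \<mu> f G
    by (rule log_sobolev.intro) (use assms in auto)
  show ?thesis using decomposition unfolding W2_decomposition_def .
qed

end
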